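(* Let $\mathcal V$ be a proper variety of biases. (1) There is a largest nonnegative integer $h$ such that $\mathfrak I_h\in\mathcal V$. Furthermore, $h$ is the largest possible value of the index of $\operatorname{typ}_S(e)$ within $\operatorname{Typ}S$, for $S\in\mathcal V$ and $e\in\operatorname{Idp}S$. (2) For any $S\in\mathcal V$, every element of the type monoid $\operatorname{Typ}S$ has finite index. In particular, $\operatorname{Typ}S$ is the positive cone of an Archimedean dimension group. (3) The variety $\mathcal V$ is generated by the collection of all its fully group-matricial members.
   Context: Inverse semigroups: a semigroup $S$ is inverse if every $x\in S$ has a unique $x^{-1}$ with $x=xx^{-1}x$ and $x^{-1}=x^{-1}xx^{-1}$. Put $\mathbf d(x)=x^{-1}x$, $\mathbf r(x)=xx^{-1}$; $\operatorname{Idp}S$ is the set of idempotents; the natural ordering is $x\le y$ iff $x=y\,\mathbf d(x)$. In an inverse semigroup with zero, $x,y$ are orthogonal if $x^{-1}y=xy^{-1}=0$. A Boolean inverse semigroup is an inverse semigroup $S$ with zero such that $\operatorname{Idp}S$ is a generalized Boolean algebra and any two orthogonal $x,y$ have a join $x\oplus y$ for the natural ordering. Biases: on a Boolean inverse semigroup define $x\oslash y=(\mathbf r(x)\smallsetminus\mathbf r(y))\,x\,(\mathbf d(x)\smallsetminus\mathbf d(y))$ and $x\triangledown y=(x\oslash y)\oplus y$. Boolean inverse semigroups, viewed as algebras $(S,0,{}^{-1},\cdot,\oslash,\triangledown)$, are exactly the models of a finite set of identities; these algebras are called biases, so a bias is the same as a Boolean inverse semigroup. Bias homomorphisms are exactly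 the semigroup homomorphisms $f$ with $f(0)=0$ and $f(x\oplus y)=f(x)\oplus f(y)$ for orthogonal $x,y$. A variety of biases is the class of all biases satisfying some set of identities in this similarity type; it is proper if it is not the class of all biases. $\mathfrak I_n$ is the symmetric inverse semigroup of all partial one-to-one functions on $[n]=\{1,\dots,n\}$ under composition ($\mathfrak I_0$ is the one-element bias). Type monoid: Green's relation $\mathscr D$ is $\mathscr L\circ\mathscr R$, where $x\mathscr L y$ iff $\mathbf d(x)=\mathbf d(y)$ and $x\mathscr R y$ iff $\mathbf r(x)=\mathbf r(y)$. The type interval $\operatorname{Int}S$ is the set of $\mathscr D$-classes $\operatorname{typ}_S(x)=x/\mathscr D$, with the partial addition $\operatorname{typ}_S(x)+\operatorname{typ}_S(y)=\operatorname{typ}_S(x\oplus y)$ for orthogonal $x,y$; $\operatorname{Typ}S$ is its universal (commutative) monoid. In a commutative monoid $M$, $x\le^+y$ means $x+z=y$ for some $z\in M$; $M$ is conical if $x+y=0$ implies $x=y=0$. The index of $e$ in a conical commutative monoid $M$ is the least nonnegative integer $n$, if it exists, such that $(n+1)x\le^+e$ implies $x=0$ for all $x\in M$, and $\infty$ otherwise. A refinement monoid is a commutative monoid in which $a_0+a_1=b_0+b_1$ always implies the existence of $c_{i,j}$ ($i,j\in\{0,1\}$) with $a_i=c_{i,0}+c_{i,1}$ and $b_i=c_{0,i}+c_{1,i}$. A dimension group is a partially ordered abelian group $G$ that is directed, unperforated ($0\le mx$ with $m$ a positive integer implies $0\le x$), and whose positive cone $G^+=\{x\mid 0\le x\}$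 is a refinement monoid. A partially ordered abelian group is Archimedean if, whenever $na\le b$ for all $n\in\{0,1,2,\dots\}$, one has $a\le0$. For a positive integer $n$ and a Boolean inverse semigroup $S$, a generalized rook matrix of order $n$ over $S$ is a matrix $(x_{i,j})_{1\le i,j\le n}$ over $S$ with $x_{i,j}^{-1}x_{i,k}=x_{j,i}x_{k,i}^{-1}=0$ whenever $j\ne k$; these form a Boolean inverse semigroup $\mathrm M^{\oplus}_n(S)$ under $(xy)_{i,j}=\bigoplus_kx_{i,k}y_{k,j}$. For a group $G$, $G^{\sqcup0}=G\cup\{0\}$ is $G$ with a new zero. A Boolean inverse monoid is fully group-matricial if it is isomorphic to $\mathrm M^{\oplus}_n(G^{\sqcup0})$ for some positive integer $n$ and some group $G$. *)

theory Defs
  imports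
    "HOL-Algebra.Lattice"
    "HOL-Algebra.Group"
    "HOL-Library.Multiset"
    "HOL-Library.Extended_Nat"
    "Jordan_Normal_Form.Matrix"
begin

section \<open>Inverse semigroups with zero\<close>

record 'a semigroup0 = "'a partial_object" +
  smul :: "'a \<Rightarrow> 'a \<Rightarrow> 'a" (infixl \<open>\<odot>\<index>\<close> 70)
  szero :: 'a

definition is_sinv :: "'a semigroup0 \<Rightarrow> 'a \<Rightarrow> 'a \<Rightarrow> bool" where
  "is_sinv S x y \<longleftrightarrow> y \<in> carrier S \<and>
     x = x \<odot>\<^bsub>S\<^esub> y \<odot>\<^bsub>S\<^esub> x \<and> y = y \<odot>\<^bsub>S\<^esub> x \<odot>\<^bsub>S\<^esub> y"

definition sinv :: "'a semigroup0 \<Rightarrow> 'a \<Rightarrow> 'a" where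
  "sinv S x = (THE y. is_sinv S x y)"

definition sdom :: "'a semigroup0 \<Rightarrow> 'a \<Rightarrow> 'a" where
  "sdom S x = sinv S x \<odot>\<^bsub>S\<^esub> x"

definition sran :: "'a semigroup0 \<Rightarrow> 'a \<Rightarrow> 'a" where
  "sran S x = x \<odot>\<^bsub>S\<^esub> sinv S x"

definition Idp :: "'a semigroup0 \<Rightarrow> 'a set" where
  "Idp S = {e \<in> carrier S. e \<odot>\<^bsub>S\<^esub> e = e}"

definition natural_order :: "'a semigroup0 \<Rightarrow> 'a gorder" where
  "natural_order S = \<lparr>carrier = carrier S, eq = (=), le = (\<lambda>x y. x = y \<odot>\<^bsub>S\<^esub> sdom S x)\<rparr>"

definition Idp_order :: "'a semigroup0 \<Rightarrow> 'a gorder" where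
  "Idp_order S = natural_order S \<lparr>carrier := Idp S\<rparr>"

definition orthogonal :: "'a semigroup0 \<Rightarrow> 'a \<Rightarrow> 'a \<Rightarrow> bool" where
  "orthogonal S x y \<longleftrightarrow> sinv S x \<odot>\<^bsub>S\<^esub> y = szero S \<and> x \<odot>\<^bsub>S\<^esub> sinv S y = szero S"

locale inverse_semigroup0 =
  fixes S :: "'a semigroup0" (structure)
  assumes smul_closed: "x \<in> carrier S \<Longrightarrow> y \<in> carrier S \<Longrightarrow> x \<odot> y \<in> carrier S"
    and smul_assoc: "x \<in> carrier S \<Longrightarrow> y \<in> carrier S \<Longrightarrow> z \<in> carrier S \<Longrightarrow>
          (x \<odot> y) \<odot> z = x \<odot> (y \<odot> z)"
    and unique_inverse: "x \<in> carrier S \<Longrightarrow> \<exists>!y. is_sinv S x y"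
    and szero_closed: "szero S \<in> carrier S"
    and szero_left: "x \<in> carrier S \<Longrightarrow> szero S \<odot> x = szero S"
    and szero_right: "x \<in> carrier S \<Longrightarrow> x \<odot> szero S = szero S"


section \<open>Boolean inverse semigroups and their bias operations\<close>

locale generalized_boolean_algebra = lattice L + weak_partial_order_bottom L
  for L :: "'a gorder" (structure) +
  assumes meet_join_distrib: "a \<in> carrier L \<Longrightarrow> b \<in> carrier L \<Longrightarrow> c \<in> carrier L \<Longrightarrow>
        a \<sqinter> (b \<squnion> c) = (a \<sqinter> b) \<squnion> (a \<sqinter> c)"
    and section_complement: "a \<in> carrier L \<Longrightarrow> b \<in> carrier L \<Longrightarrow> a \<sqsubseteq> b \<Longrightarrow>
        \<exists>c\<in>carrier L. a \<sqinter> c = \<bottom> \<and> a \<squnion> c = b"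

definition lattice_diff :: "'a gorder \<Rightarrow> 'a \<Rightarrow> 'a \<Rightarrow> 'a" where
  "lattice_diff L a b =
     (THE c. c \<in> carrier L \<and> b \<sqinter>\<^bsub>L\<^esub> c = \<bottom>\<^bsub>L\<^esub> \<and> (a \<sqinter>\<^bsub>L\<^esub> b) \<squnion>\<^bsub>L\<^esub> c = a)"

locale boolean_inverse_semigroup = inverse_semigroup0 S for S :: "'a semigroup0" (structure) +
  assumes Idp_boolean: "generalized_boolean_algebra (Idp_order S)"
    and orthogonal_join: "x \<in> carrier S \<Longrightarrow> y \<in> carrier S \<Longrightarrow> orthogonal S x y \<Longrightarrow>
          \<exists>z. least (natural_order S) z (Upper (natural_order S) {x, y})"

definition oplus :: "'a semigroup0 \<Rightarrow> 'a \<Rightarrow> 'a \<Rightarrow> 'a" where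
  "oplus S x y = x \<squnion>\<^bsub>natural_order S\<^esub> y"

definition bias_diff :: "'a semigroup0 \<Rightarrow> 'a \<Rightarrow> 'a \<Rightarrow> 'a" where
  "bias_diff S x y =
     lattice_diff (Idp_order S) (sran S x) (sran S y) \<odot>\<^bsub>S\<^esub> x \<odot>\<^bsub>S\<^esub>
     lattice_diff (Idp_order S) (sdom S x) (sdom S y)"

definition bias_skew :: "'a semigroup0 \<Rightarrow> 'a \<Rightarrow> 'a \<Rightarrow> 'a" where
  "bias_skew S x y = oplus S (bias_diff S x y) y"

definition bias_hom :: "'a semigroup0 \<Rightarrow> 'b semigroup0 \<Rightarrow> ('a \<Rightarrow> 'b) set" where
  "bias_hom S T = {f. f \<in> carrier S \<rightarrow> carrier T \<and>
     (\<forall>x\<in>carrier S. \<forall>y\<in>carrier S. f (x \<odot>\<^bsub>S\<^esub> y) = f x \<odot>\<^bsub>T\<^esub> f y) \<and>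
     f (szero S) = szero T \<and>
     (\<forall>x\<in>carrier S. \<forall>y\<in>carrier S. orthogonal S x y \<longrightarrow> f (oplus S x y) = oplus T (f x) (f y))}"

definition bias_isomorphic :: "'a semigroup0 \<Rightarrow> 'b semigroup0 \<Rightarrow> bool" where
  "bias_isomorphic S T \<longleftrightarrow> (\<exists>f\<in>bias_hom S T. bij_betw f (carrier S) (carrier T))"


section \<open>Varieties of biases\<close>

datatype bias_term =
    BVar nat
  | BZero
  | BInv bias_term
  | BMul bias_term bias_term
  | BDiff bias_term bias_term
  | BSkew bias_term bias_term

primrec bias_eval :: "'a semigroup0 \<Rightarrow> (nat \<Rightarrow> 'a) \<Rightarrow> bias_term \<Rightarrow> 'a" where
  "bias_eval S v (BVar i) = v i"
| "bias_eval S v BZero = szero S"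
| "bias_eval S v (BInv s) = sinv S (bias_eval S v s)"
| "bias_eval S v (BMul s t) = bias_eval S v s \<odot>\<^bsub>S\<^esub> bias_eval S v t"
| "bias_eval S v (BDiff s t) = bias_diff S (bias_eval S v s) (bias_eval S v t)"
| "bias_eval S v (BSkew s t) = bias_skew S (bias_eval S v s) (bias_eval S v t)"

type_synonym bias_identity = "bias_term \<times> bias_term"

definition satisfies_identity :: "'a semigroup0 \<Rightarrow> bias_identity \<Rightarrow> bool" where
  "satisfies_identity S e \<longleftrightarrow>
     (\<forall>v. range v \<subseteq> carrier S \<longrightarrow> bias_eval S v (fst e) = bias_eval S v (snd e))"

text \<open>
  A variety is a proper class, so it is given by a set of identities, and the constant below
  is its intersection with the biases over the type \<open>'a\<close>.
\<close>

definition bias_variety :: "bias_identity set \<Rightarrow> 'a semigroup0 set" where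
  "bias_variety E = {S. boolean_inverse_semigroup S \<and> (\<forall>e\<in>E. satisfies_identity S e)}"

text \<open>
  The variety given by \<open>E\<close> is proper iff the next predicate holds for some type \<open>'p\<close>.
  Hence it is meant to be used as a hypothesis in which \<open>'p\<close> occurs nowhere else, so that the
  universal quantification over \<open>'p\<close> outside the implication is an existential one in the
  hypothesis.
\<close>

definition proper_bias_variety :: "'p itself \<Rightarrow> bias_identity set \<Rightarrow> bool" where
  "proper_bias_variety _ E \<longleftrightarrow>
     (bias_variety E :: 'p semigroup0 set) \<noteq> {S. boolean_inverse_semigroup S}"


section \<open>Symmetric inverse semigroups and generalized rook matrices\<close>

definition symmetric_inverse :: "nat \<Rightarrow> (nat \<rightharpoonup> nat) semigroup0" where
  "symmetric_inverse n =
     \<lparr>carrier = {f. dom f \<subseteq> {1..n} \<and> ran f \<subseteq> {1..n} \<and> inj_on f (dom f)},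
      smul = (\<lambda>f g. f \<circ>\<^sub>m g),
      szero = Map.empty\<rparr>"

definition group_adjoin_zero :: "'g monoid \<Rightarrow> 'g option semigroup0" where
  "group_adjoin_zero G =
     \<lparr>carrier = insert None (Some ` carrier G),
      smul = (\<lambda>a b. case (a, b) of (Some x, Some y) \<Rightarrow> Some (x \<otimes>\<^bsub>G\<^esub> y) | _ \<Rightarrow> None),
      szero = None\<rparr>"

text \<open>
  Indices run over \<open>0..<n\<close>.  The terms of each of the sums defining a product of generalized rook
  matrices are pairwise orthogonal, and their orthogonal sum is the join of the set of these
  terms for the natural ordering.
\<close>

definition rook_matrices :: "nat \<Rightarrow> 'a semigroup0 \<Rightarrow> 'a mat semigroup0" where
  "rook_matrices n S =
     \<lparr>carrier = {x \<in> carrier_mat n n.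
        (\<forall>i<n. \<forall>j<n. x $$ (i, j) \<in> carrier S) \<and>
        (\<forall>i<n. \<forall>j<n. \<forall>k<n. j \<noteq> k \<longrightarrow>
           sinv S (x $$ (i, j)) \<odot>\<^bsub>S\<^esub> x $$ (i, k) = szero S \<and>
           x $$ (j, i) \<odot>\<^bsub>S\<^esub> sinv S (x $$ (k, i)) = szero S)},
      smul = (\<lambda>x y. mat n n (\<lambda>(i, j).
        \<Squnion>\<^bsub>natural_order S\<^esub> ((\<lambda>k. x $$ (i, k) \<odot>\<^bsub>S\<^esub> y $$ (k, j)) ` {..<n}))),
      szero = mat n n (\<lambda>_. szero S)\<rparr>"

text \<open>
  Taking \<open>G\<close> over the type of \<open>S\<close> is no restriction: since \<open>n > 0\<close>, every group \<open>G\<close> embeds into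
  the semigroup of rook matrices over \<open>G\<close> with zero, via the entry in the upper left corner.
\<close>

definition fully_group_matricial :: "'a semigroup0 \<Rightarrow> bool" where
  "fully_group_matricial S \<longleftrightarrow>
     boolean_inverse_semigroup S \<and>
     (\<exists>u\<in>carrier S. \<forall>x\<in>carrier S. u \<odot>\<^bsub>S\<^esub> x = x \<and> x \<odot>\<^bsub>S\<^esub> u = x) \<and>
     (\<exists>n>0. \<exists>G :: 'a monoid. group G \<and>
        bias_isomorphic S (rook_matrices n (group_adjoin_zero G)))"


section \<open>The type monoid\<close>

definition green_L :: "'a semigroup0 \<Rightarrow> 'a rel" where
  "green_L S = {(x, y). x \<in> carrier S \<and> y \<in> carrier S \<and> sdom S x = sdom S y}"

definition green_R :: "'a semigroup0 \<Rightarrow> 'a rel" where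
  "green_R S = {(x, y). x \<in> carrier S \<and> y \<in> carrier S \<and> sran S x = sran S y}"

definition green_D :: "'a semigroup0 \<Rightarrow> 'a rel" where
  "green_D S = green_L S O green_R S"

text \<open>\<open>psum P a b c\<close> states that the partial sum of \<open>a\<close> and \<open>b\<close> is defined and equal to \<open>c\<close>.\<close>

record 'a partial_monoid = "'a partial_object" +
  psum :: "'a \<Rightarrow> 'a \<Rightarrow> 'a \<Rightarrow> bool"
  pzero :: 'a

definition type_interval :: "'a semigroup0 \<Rightarrow> 'a set partial_monoid" where
  "type_interval S =
     \<lparr>carrier = carrier S // green_D S,
      psum = (\<lambda>a b c. \<exists>x\<in>carrier S. \<exists>y\<in>carrier S. orthogonal S x y \<and>
         a = green_D S `` {x} \<and> b = green_D S `` {y} \<and> c = green_D S `` {oplus S x y}),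
      pzero = green_D S `` {szero S}\<rparr>"

text \<open>
  The universal monoid of a partial commutative monoid is the free commutative monoid on its
  elements (finite multisets), divided by the least monoid congruence that identifies formal sums
  with partial sums wherever these are defined, and the zero element with the empty sum.
  Commutative monoids use the multiplicatively written library notion, so that
  the multiple \<open>n x\<close> is \<open>x [^] n\<close> and zero is \<open>\<one>\<close>.
\<close>

inductive universal_cong :: "'a partial_monoid \<Rightarrow> 'a multiset \<Rightarrow> 'a multiset \<Rightarrow> bool"
  for P :: "'a partial_monoid" where
  ucong_refl: "set_mset u \<subseteq> carrier P \<Longrightarrow> universal_cong P u u"
| ucong_sym: "universal_cong P u v \<Longrightarrow> universal_cong P v u"
| ucong_trans: "universal_cong P u v \<Longrightarrow> universal_cong P v w \<Longrightarrow> universal_cong P u w"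
| ucong_add: "universal_cong P u v \<Longrightarrow> set_mset w \<subseteq> carrier P \<Longrightarrow> universal_cong P (u + w) (v + w)"
| ucong_zero: "universal_cong P {#pzero P#} {#}"
| ucong_sum: "psum P a b c \<Longrightarrow> universal_cong P {#a, b#} {#c#}"

definition universal_class :: "'a partial_monoid \<Rightarrow> 'a multiset \<Rightarrow> 'a multiset set" where
  "universal_class P u = {v. universal_cong P u v}"

definition universal_monoid :: "'a partial_monoid \<Rightarrow> 'a multiset set monoid" where
  "universal_monoid P =
     \<lparr>carrier = universal_class P ` {u. set_mset u \<subseteq> carrier P},
      monoid.mult = (\<lambda>A B. \<Union>u\<in>A. \<Union>v\<in>B. universal_class P (u + v)),
      one = universal_class P {#}\<rparr>"

definition Typ :: "'a semigroup0 \<Rightarrow> 'a set multiset set monoid" where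
  "Typ S = universal_monoid (type_interval S)"

definition typ_elem :: "'a semigroup0 \<Rightarrow> 'a \<Rightarrow> 'a set multiset set" where
  "typ_elem S x = universal_class (type_interval S) {#green_D S `` {x}#}"


section \<open>Index, refinement monoids and dimension groups\<close>

definition monoid_le :: "('m, 'b) monoid_scheme \<Rightarrow> 'm \<Rightarrow> 'm \<Rightarrow> bool" where
  "monoid_le M x y \<longleftrightarrow> (\<exists>z\<in>carrier M. x \<otimes>\<^bsub>M\<^esub> z = y)"

definition index_bound :: "('m, 'b) monoid_scheme \<Rightarrow> 'm \<Rightarrow> nat \<Rightarrow> bool" where
  "index_bound M e n \<longleftrightarrow>
     (\<forall>x\<in>carrier M. monoid_le M (x [^]\<^bsub>M\<^esub> (n + 1)) e \<longrightarrow> x = \<one>\<^bsub>M\<^esub>)"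

definition monoid_index :: "('m, 'b) monoid_scheme \<Rightarrow> 'm \<Rightarrow> enat" where
  "monoid_index M e =
     (if \<exists>n. index_bound M e n then enat (LEAST n. index_bound M e n) else \<infinity>)"

locale refinement_monoid = comm_monoid M for M (structure) +
  assumes refinement:
    "a0 \<in> carrier M \<Longrightarrow> a1 \<in> carrier M \<Longrightarrow> b0 \<in> carrier M \<Longrightarrow> b1 \<in> carrier M \<Longrightarrow>
     a0 \<otimes> a1 = b0 \<otimes> b1 \<Longrightarrow>
     \<exists>c00\<in>carrier M. \<exists>c01\<in>carrier M. \<exists>c10\<in>carrier M. \<exists>c11\<in>carrier M.
       a0 = c00 \<otimes> c01 \<and> a1 = c10 \<otimes> c11 \<and> b0 = c00 \<otimes> c10 \<and> b1 = c01 \<otimes> c11"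

locale partially_ordered_abelian_group = comm_group G for G (structure) +
  fixes leq :: "'g \<Rightarrow> 'g \<Rightarrow> bool" (infix \<open>\<preceq>\<close> 50)
  assumes leq_refl: "x \<in> carrier G \<Longrightarrow> x \<preceq> x"
    and leq_antisym: "x \<in> carrier G \<Longrightarrow> y \<in> carrier G \<Longrightarrow> x \<preceq> y \<Longrightarrow> y \<preceq> x \<Longrightarrow> x = y"
    and leq_trans: "x \<in> carrier G \<Longrightarrow> y \<in> carrier G \<Longrightarrow> z \<in> carrier G \<Longrightarrow>
          x \<preceq> y \<Longrightarrow> y \<preceq> z \<Longrightarrow> x \<preceq> z"
    and leq_translate: "x \<in> carrier G \<Longrightarrow> y \<in> carrier G \<Longrightarrow> z \<in> carrier G \<Longrightarrow>
          x \<preceq> y \<Longrightarrow> x \<otimes> z \<preceq> y \<otimes> z"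

definition positive_cone :: "'g monoid \<Rightarrow> ('g \<Rightarrow> 'g \<Rightarrow> bool) \<Rightarrow> 'g monoid" where
  "positive_cone G leq = G \<lparr>carrier := {x \<in> carrier G. leq \<one>\<^bsub>G\<^esub> x}\<rparr>"

locale dimension_group = partially_ordered_abelian_group G leq
  for G :: "'g monoid" (structure) and leq (infix \<open>\<preceq>\<close> 50) +
  assumes directed: "x \<in> carrier G \<Longrightarrow> y \<in> carrier G \<Longrightarrow> \<exists>z\<in>carrier G. x \<preceq> z \<and> y \<preceq> z"
    and unperforated: "x \<in> carrier G \<Longrightarrow> (m::nat) > 0 \<Longrightarrow> \<one> \<preceq> x [^] m \<Longrightarrow> \<one> \<preceq> x"
    and cone_refinement: "refinement_monoid (positive_cone G (\<preceq>))"

locale archimedean_dimension_group = dimension_group G leq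
  for G :: "'g monoid" (structure) and leq (infix \<open>\<preceq>\<close> 50) +
  assumes archimedean: "a \<in> carrier G \<Longrightarrow> b \<in> carrier G \<Longrightarrow>
        (\<And>n::nat. a [^] n \<preceq> b) \<Longrightarrow> a \<preceq> \<one>"

text \<open>
  A directed partially ordered abelian group consists of the differences of elements of its
  positive cone, so one whose cone is isomorphic to \<open>M\<close> always has a copy over the type
  used for \<open>G\<close> here (sets of pairs of elements of \<open>M\<close>).
\<close>

definition is_archimedean_dimension_group_cone :: "'m monoid \<Rightarrow> bool" where
  "is_archimedean_dimension_group_cone M \<longleftrightarrow>
     (\<exists>(G :: ('m \<times> 'm) set monoid) leq.
        archimedean_dimension_group G leq \<and> M \<cong> positive_cone G leq)"

end

theory Submission
  imports Defs
begin

text \<open>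
  Every Boolean inverse semigroup \<open>S\<close> acts faithfully by partial bijections on its germs at prime
  filters of idempotents, so identities of biases can be tested on partial bijections. There a
  term is evaluated at a point by looking at finitely many other points; hence an identity that
  holds in all \<open>\<II>\<^sub>n\<close> holds everywhere, and a proper variety \<open>\<V>\<close> contains a largest
  \<open>\<II>\<^sub>h\<close>. If \<open>(h + 1) x \<le> typ e\<close> with \<open>x \<noteq> 0\<close> in \<open>Typ S\<close>, then \<open>S\<close> contains bijections from one
  nonempty set onto \<open>h + 1\<close> disjoint sets, that is, matrix units generating a copy of
  \<open>\<II>\<^sub>h\<^sub>+\<^sub>1\<close>; this bounds the index. \<open>Typ S\<close> is a refinement monoid, by confluence of the
  splitting of formal sums, and conical refinement monoids with finite indices are cancellative,
  unperforated and Archimedean, since failure would produce nonzero elements with arbitrarily many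
  copies below a fixed one. Finally, an identity failing in \<open>S \<in> \<V>\<close> at some point fails in the
  restriction of a countable subbias to the orbit of that point. The latter is transitive, so by the
  same bound it has at most \<open>h\<close> pairwise disjoint nonempty idempotents; such a bias is a bias of
  rook matrices over the group of an atom.
\<close>

text \<open>Germs are needed because the action on prime filters alone is not faithful: a group with
  zero has a single nonempty prime filter, on which all its units act alike. Germs add the missing
  isotropy, and the bias operations become set operations on relations, so identities are compared
  pointwise instead of being derived by rewriting terms.

  \<open>Typ S\<close> is a quotient of formal sums, so an inequality there need not be visible in
  \<open>S\<close>. Below the type of an element it is: the values that a formal sum takes in the
  type interval are invariant under the congruence, hence copies below \<open>typ e\<close> are
  realized by actual disjoint sets.

  A variety has members over every type, while a statement can only mention given types. The
  generating members can be taken over \<open>nat\<close> because a failing identity involves a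
  single valuation, whose values generate a countable subbias.

  The bound \<open>h\<close> on the index is attained in the symmetric inverse semigroup on
  \<open>h\<close> points, at its identity.\<close>

no_notation Module.smult (infixl \<open>\<odot>\<index>\<close> 70)

section \<open>Biases of partial bijections\<close>

definition pbij :: "('x \<times> 'x) set \<Rightarrow> bool" where
  "pbij r \<longleftrightarrow> single_valued r \<and> single_valued (r\<inverse>)"

text \<open>\<open>bias_diff\<close> for partial bijections. Removing the pairs that start in the
  domain of \<open>s\<close> or end in its range is exactly what makes the union with
  \<open>s\<close> in \<open>rel_skew\<close> a partial bijection again.\<close>

definition rel_diff :: "('x \<times> 'x) set \<Rightarrow> ('x \<times> 'x) set \<Rightarrow> ('x \<times> 'x) set" where
  "rel_diff r s = {(a, b) \<in> r. a \<notin> Domain s \<and> b \<notin> Range s}"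

definition rel_skew :: "('x \<times> 'x) set \<Rightarrow> ('x \<times> 'x) set \<Rightarrow> ('x \<times> 'x) set" where
  "rel_skew r s = rel_diff r s \<union> s"

text \<open>\<open>BMul\<close> swaps its arguments: relations compose from left to right, whereas
  in a product the right factor acts first.\<close>

primrec rel_eval :: "(nat \<Rightarrow> ('x \<times> 'x) set) \<Rightarrow> bias_term \<Rightarrow> ('x \<times> 'x) set" where
  "rel_eval v (BVar i) = v i"
| "rel_eval v BZero = {}"
| "rel_eval v (BInv s) = (rel_eval v s)\<inverse>"
| "rel_eval v (BMul s t) = rel_eval v t O rel_eval v s"
| "rel_eval v (BDiff s t) = rel_diff (rel_eval v s) (rel_eval v t)"
| "rel_eval v (BSkew s t) = rel_skew (rel_eval v s) (rel_eval v t)"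

definition rel_sat :: "('x \<times> 'x) set set \<Rightarrow> bias_identity set \<Rightarrow> bool" where
  "rel_sat A E \<longleftrightarrow> (\<forall>(l, r) \<in> E. \<forall>v. range v \<subseteq> A \<longrightarrow> rel_eval v l = rel_eval v r)"

lemma pbij_fun: "pbij r \<Longrightarrow> (a, b) \<in> r \<Longrightarrow> (a, c) \<in> r \<Longrightarrow> b = c"
  and pbij_inj: "pbij r \<Longrightarrow> (a, c) \<in> r \<Longrightarrow> (b, c) \<in> r \<Longrightarrow> a = b"
  by (auto simp: pbij_def single_valued_def)

lemma pbijI:
  assumes "\<And>a b c. (a, b) \<in> r \<Longrightarrow> (a, c) \<in> r \<Longrightarrow> b = c"
    and "\<And>a b c. (a, c) \<in> r \<Longrightarrow> (b, c) \<in> r \<Longrightarrow> a = b"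
  shows "pbij r"
  unfolding pbij_def single_valued_def using assms by blast

lemma pbij_empty [simp]: "pbij {}"
  by (simp add: pbij_def)

lemma pbij_Id_on [simp]: "pbij (Id_on D)"
  by (rule pbijI) auto

lemma pbij_converse [simp]: "pbij (r\<inverse>) \<longleftrightarrow> pbij r"
  by (auto simp: pbij_def)

lemma pbij_comp: "pbij r \<Longrightarrow> pbij s \<Longrightarrow> pbij (r O s)"
  by (rule pbijI) (blast dest: pbij_fun pbij_inj)+

lemma pbij_subset: "pbij r \<Longrightarrow> s \<subseteq> r \<Longrightarrow> pbij s"
  by (rule pbijI) (blast dest: pbij_fun pbij_inj)+

lemma pbij_Un:
  assumes "pbij r" "pbij s" "Domain r \<inter> Domain s = {}" "Range r \<inter> Range s = {}"
  shows "pbij (r \<union> s)"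
  using assms by (intro pbijI) (blast dest: pbij_fun pbij_inj)+

lemma pbij_comp_converse: "pbij r \<Longrightarrow> r O r\<inverse> = Id_on (Domain r)"
  by (auto dest: pbij_inj)

lemma pbij_converse_comp: "pbij r \<Longrightarrow> r\<inverse> O r = Id_on (Range r)"
  by (auto dest: pbij_fun)

text \<open>Each equation traces a pair through three arrows, and functionality and injectivity
  force the middle arrow to be that pair reversed. This identifies \<open>sinv\<close> with the
  converse in every bias of partial bijections.\<close>

lemma pbij_converse_unique:
  assumes "pbij r" "pbij q" "r O q O r = r" "q O r O q = q"
  shows "q = r\<inverse>"
proof (intro equalityI subrelI; clarsimp)
  fix a b assume "(a, b) \<in> q"
  then obtain c d where "(a, c) \<in> q" "(c, d) \<in> r" "(d, b) \<in> q"
    using assms(4) by blast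
  then show "(b, a) \<in> r"
    using \<open>(a, b) \<in> q\<close> assms(1,2) by (metis pbij_fun pbij_inj)
next
  fix a b assume "(b, a) \<in> r"
  then obtain c d where "(b, c) \<in> r" "(c, d) \<in> q" "(d, a) \<in> r"
    using assms(3) by blast
  then show "(a, b) \<in> q"
    using \<open>(b, a) \<in> r\<close> assms(1,2) by (metis pbij_fun pbij_inj)
qed

lemma pbij_idem_iff: "pbij r \<Longrightarrow> r O r = r \<longleftrightarrow> r = Id_on (Domain r)"
proof
  assume r: "pbij r" "r O r = r"
  have "a = b" if "(a, b) \<in> r" for a b
    using that r by (metis (no_types, lifting) pbij_fun pbij_inj relcompE prod.inject)
  then show "r = Id_on (Domain r)" by auto
next
  assume "r = Id_on (Domain r)"
  then obtain D where "r = Id_on D" by blast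
  then show "r O r = r" by auto
qed

text \<open>These are the subbiases of the bias of all partial bijections of a type:
  \<open>rel_diff\<close> is a restriction to differences of domains and ranges, and
  \<open>rel_skew\<close> is a disjoint union.\<close>

locale rel_bias =
  fixes A :: "('x \<times> 'x) set set"
  assumes elem_pbij: "r \<in> A \<Longrightarrow> pbij r"
    and empty_mem: "{} \<in> A"
    and comp_mem: "r \<in> A \<Longrightarrow> s \<in> A \<Longrightarrow> r O s \<in> A"
    and converse_mem: "r \<in> A \<Longrightarrow> r\<inverse> \<in> A"
    and Un_mem: "r \<in> A \<Longrightarrow> s \<in> A \<Longrightarrow> Domain r \<inter> Domain s = {} \<Longrightarrow> Range r \<inter> Range s = {} \<Longrightarrow>
      r \<union> s \<in> A"
    and Id_on_diff_mem: "r \<in> A \<Longrightarrow> s \<in> A \<Longrightarrow> Id_on (Domain r - Domain s) \<in> A"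
begin

text \<open>The idempotents of \<open>A\<close> are the relations \<open>Id_on D\<close>; passing to
  the sets \<open>D\<close> turns the generalized Boolean algebra of idempotents into a ring of
  sets.\<close>

definition supports :: "'x set set" where
  "supports = Domain ` A"

lemma Id_on_Domain_mem: "r \<in> A \<Longrightarrow> Id_on (Domain r) \<in> A"
  using Id_on_diff_mem[of r "{}"] empty_mem by simp

lemma supports_iff: "D \<in> supports \<longleftrightarrow> Id_on D \<in> A"
proof
  assume "Id_on D \<in> A"
  then have "Domain (Id_on D) \<in> supports" unfolding supports_def by blast
  then show "D \<in> supports" by simp
qed (auto simp: supports_def Id_on_Domain_mem)

lemma Domain_supports: "r \<in> A \<Longrightarrow> Domain r \<in> supports"
  by (simp add: supports_def)

lemma Range_supports: "r \<in> A \<Longrightarrow> Range r \<in> supports"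
  using Domain_supports[OF converse_mem] by simp

lemma empty_supports: "{} \<in> supports"
  using Domain_supports[OF empty_mem] by simp

lemma Diff_supports: "D \<in> supports \<Longrightarrow> E \<in> supports \<Longrightarrow> D - E \<in> supports"
  using Id_on_diff_mem[of "Id_on D" "Id_on E"] by (simp add: supports_iff)

lemma Int_supports: "D \<in> supports \<Longrightarrow> E \<in> supports \<Longrightarrow> D \<inter> E \<in> supports"
  using Diff_supports[of D "D - E"] Diff_supports[of D E]
  by (metis Diff_Diff_Int)

lemma Un_supports:
  assumes "D \<in> supports" "E \<in> supports" shows "D \<union> E \<in> supports"
proof -
  have "Id_on (D - E) \<union> Id_on E \<in> A"
    using assms Diff_supports[OF assms] by (intro Un_mem) (auto simp: supports_iff)
  also have "Id_on (D - E) \<union> Id_on E = Id_on (D \<union> E)" by auto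
  finally show ?thesis by (simp add: supports_iff)
qed

lemma finite_Union_supports: "finite F \<Longrightarrow> F \<subseteq> supports \<Longrightarrow> \<Union>F \<in> supports"
  by (induction rule: finite_induct) (auto intro: empty_supports Un_supports)

lemma restrict_mem: "r \<in> A \<Longrightarrow> D \<in> supports \<Longrightarrow> E \<in> supports \<Longrightarrow> r \<inter> D \<times> E \<in> A"
proof -
  assume "r \<in> A" "D \<in> supports" "E \<in> supports"
  then have "Id_on D O r O Id_on E \<in> A" by (simp add: supports_iff comp_mem)
  also have "Id_on D O r O Id_on E = r \<inter> D \<times> E" by auto
  finally show ?thesis .
qed

lemma rel_diff_mem:
  assumes "r \<in> A" "s \<in> A" shows "rel_diff r s \<in> A"
proof -
  have "rel_diff r s = r \<inter> (Domain r - Domain s) \<times> (Range r - Range s)"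
    by (auto simp: rel_diff_def)
  with assms show ?thesis
    by (simp add: restrict_mem Diff_supports Domain_supports Range_supports)
qed

lemma rel_skew_mem:
  assumes "r \<in> A" "s \<in> A" shows "rel_skew r s \<in> A"
  unfolding rel_skew_def using assms
  by (intro Un_mem rel_diff_mem) (auto simp: rel_diff_def)

lemma rel_eval_mem: "range v \<subseteq> A \<Longrightarrow> rel_eval v t \<in> A"
  by (induction t) (auto intro: empty_mem comp_mem converse_mem rel_diff_mem rel_skew_mem)

lemma finite_Un_mem:
  assumes "finite I" "\<And>i. i \<in> I \<Longrightarrow> f i \<in> A"
    and "\<And>i j. i \<in> I \<Longrightarrow> j \<in> I \<Longrightarrow> i \<noteq> j \<Longrightarrow>
      Domain (f i) \<inter> Domain (f j) = {} \<and> Range (f i) \<inter> Range (f j) = {}"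
  shows "(\<Union>i\<in>I. f i) \<in> A"
  using assms
proof (induction rule: finite_induct)
  case (insert i I)
  have "f i \<union> (\<Union>i\<in>I. f i) \<in> A"
  proof (rule Un_mem)
    show "f i \<in> A" by (simp add: insert.prems)
    show "(\<Union>i\<in>I. f i) \<in> A" by (rule insert.IH) (use insert.prems in auto)
    have d: "Domain (f i) \<inter> Domain (f j) = {} \<and> Range (f i) \<inter> Range (f j) = {}" if "j \<in> I" for j
      using insert.prems(2)[of i j] insert.hyps(2) that by blast
    show "Domain (f i) \<inter> Domain (\<Union>i\<in>I. f i) = {}" using d by fast
    show "Range (f i) \<inter> Range (\<Union>i\<in>I. f i) = {}" using d by fast
  qed
  then show ?case by simp
qed (simp add: empty_mem)

end

lemma rel_bias_pbij: "rel_bias {r. pbij r \<and> r \<subseteq> Y \<times> Y}"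
proof
  show "Id_on (Domain r - Domain s) \<in> {r. pbij r \<and> r \<subseteq> Y \<times> Y}"
    if "r \<in> {r. pbij r \<and> r \<subseteq> Y \<times> Y}" for r s using that by auto
  show "r \<union> s \<in> {r. pbij r \<and> r \<subseteq> Y \<times> Y}"
    if "r \<in> {r. pbij r \<and> r \<subseteq> Y \<times> Y}" "s \<in> {r. pbij r \<and> r \<subseteq> Y \<times> Y}"
      "Domain r \<inter> Domain s = {}" "Range r \<inter> Range s = {}" for r s
    using that pbij_Un by blast
qed (auto simp: pbij_comp)

lemma rel_sat_subset: "rel_sat A E \<Longrightarrow> B \<subseteq> A \<Longrightarrow> rel_sat B E"
  by (fastforce simp: rel_sat_def)

text \<open>
  An isomorphism of \<open>S\<close> onto a bias of partial bijections; \<open>x \<odot> y\<close> is \<open>y\<close> followed by \<open>x\<close>.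
\<close>

locale rel_representation = rel_bias A
  for S :: "'a semigroup0" (structure) and \<rho> :: "'a \<Rightarrow> ('x \<times> 'x) set"
    and A :: "('x \<times> 'x) set set" +
  assumes mult_closed: "x \<in> carrier S \<Longrightarrow> y \<in> carrier S \<Longrightarrow> x \<odot> y \<in> carrier S"
    and zero_closed: "szero S \<in> carrier S"
    and rep_inj: "inj_on \<rho> (carrier S)"
    and rep_image: "\<rho> ` carrier S = A"
    and rep_mult: "x \<in> carrier S \<Longrightarrow> y \<in> carrier S \<Longrightarrow> \<rho> (x \<odot> y) = \<rho> y O \<rho> x"
    and rep_zero: "\<rho> (szero S) = {}"
begin

lemma rep_mem: "x \<in> carrier S \<Longrightarrow> \<rho> x \<in> A"
  using rep_image by blast

lemma rep_pbij: "x \<in> carrier S \<Longrightarrow> pbij (\<rho> x)"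
  by (simp add: rep_mem elem_pbij)

lemma rep_eq_iff: "x \<in> carrier S \<Longrightarrow> y \<in> carrier S \<Longrightarrow> \<rho> x = \<rho> y \<longleftrightarrow> x = y"
  using rep_inj by (simp add: inj_on_eq_iff)

definition of_rel :: "('x \<times> 'x) set \<Rightarrow> 'a" where
  "of_rel = inv_into (carrier S) \<rho>"

lemma of_rel_closed: "r \<in> A \<Longrightarrow> of_rel r \<in> carrier S"
  using inv_into_into[of r \<rho> "carrier S"] rep_image by (simp add: of_rel_def)

lemma rep_of_rel: "r \<in> A \<Longrightarrow> \<rho> (of_rel r) = r"
  using f_inv_into_f[of r \<rho> "carrier S"] rep_image by (simp add: of_rel_def)

lemma of_rel_unique: "x \<in> carrier S \<Longrightarrow> \<rho> x = r \<Longrightarrow> x = of_rel r"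
  using rep_inj by (auto simp: of_rel_def)

lemma is_sinv_iff:
  assumes "x \<in> carrier S" shows "is_sinv S x y \<longleftrightarrow> y = of_rel ((\<rho> x)\<inverse>)"
proof -
  have "is_sinv S x y \<longleftrightarrow> \<rho> y = (\<rho> x)\<inverse>" if y: "y \<in> carrier S"
  proof -
    have "is_sinv S x y \<longleftrightarrow> \<rho> x = \<rho> x O \<rho> y O \<rho> x \<and> \<rho> y = \<rho> y O \<rho> x O \<rho> y"
      using assms y mult_closed
      by (simp add: is_sinv_def rep_mult[symmetric] rep_eq_iff)
    also have "\<dots> \<longleftrightarrow> \<rho> y = (\<rho> x)\<inverse>"
    proof
      assume "\<rho> y = (\<rho> x)\<inverse>"
      then show "\<rho> x = \<rho> x O \<rho> y O \<rho> x \<and> \<rho> y = \<rho> y O \<rho> x O \<rho> y"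
        using rep_pbij[OF assms] by (auto dest: pbij_fun pbij_inj)
    qed (use rep_pbij assms y in \<open>metis pbij_converse_unique\<close>)
    finally show ?thesis .
  qed
  moreover have "of_rel ((\<rho> x)\<inverse>) \<in> carrier S" "\<rho> (of_rel ((\<rho> x)\<inverse>)) = (\<rho> x)\<inverse>"
    using assms by (simp_all add: of_rel_closed rep_of_rel converse_mem rep_mem)
  ultimately show ?thesis
    by (metis is_sinv_def of_rel_unique)
qed

lemma sinv_eq: "x \<in> carrier S \<Longrightarrow> sinv S x = of_rel ((\<rho> x)\<inverse>)"
  by (simp add: sinv_def is_sinv_iff)

lemma sinv_closed: "x \<in> carrier S \<Longrightarrow> sinv S x \<in> carrier S"
  by (simp add: sinv_eq of_rel_closed converse_mem rep_mem)

lemma rep_sinv: "x \<in> carrier S \<Longrightarrow> \<rho> (sinv S x) = (\<rho> x)\<inverse>"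
  by (simp add: sinv_eq rep_of_rel converse_mem rep_mem)

lemma sdom_closed: "x \<in> carrier S \<Longrightarrow> sdom S x \<in> carrier S"
  and sran_closed: "x \<in> carrier S \<Longrightarrow> sran S x \<in> carrier S"
  by (simp_all add: sdom_def sran_def mult_closed sinv_closed)

lemma rep_sdom: "x \<in> carrier S \<Longrightarrow> \<rho> (sdom S x) = Id_on (Domain (\<rho> x))"
  by (simp add: sdom_def rep_mult sinv_closed rep_sinv pbij_comp_converse rep_pbij)

lemma rep_sran: "x \<in> carrier S \<Longrightarrow> \<rho> (sran S x) = Id_on (Range (\<rho> x))"
  by (simp add: sran_def rep_mult sinv_closed rep_sinv pbij_converse_comp rep_pbij)

lemma inverse_semigroup0: "inverse_semigroup0 S"
proof
  fix x y z assume "x \<in> carrier S" "y \<in> carrier S" "z \<in> carrier S"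
  then show "x \<odot> y \<odot> z = x \<odot> (y \<odot> z)"
    by (simp add: rep_eq_iff[symmetric] mult_closed rep_mult O_assoc)
next
  fix x assume x: "x \<in> carrier S"
  show "\<exists>!y. is_sinv S x y" by (simp add: is_sinv_iff x)
  show "szero S \<odot> x = szero S" "x \<odot> szero S = szero S"
    using x zero_closed by (simp_all add: rep_eq_iff[symmetric] mult_closed rep_mult rep_zero)
qed (simp_all add: mult_closed zero_closed)

section \<open>Natural order, idempotents and joins of represented elements\<close>

lemma natural_order_iff:
  assumes "x \<in> carrier S" "y \<in> carrier S"
  shows "x = y \<odot> sdom S x \<longleftrightarrow> \<rho> x \<subseteq> \<rho> y"
proof -
  have "x = y \<odot> sdom S x \<longleftrightarrow> \<rho> x = Id_on (Domain (\<rho> x)) O \<rho> y"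
    using assms by (simp add: rep_eq_iff[symmetric] mult_closed sdom_closed rep_mult rep_sdom)
  also have "\<dots> \<longleftrightarrow> \<rho> x \<subseteq> \<rho> y"
    using rep_pbij[OF assms(2)] by (auto dest: pbij_fun)
  finally show ?thesis .
qed

lemma Idp_iff: "x \<in> Idp S \<longleftrightarrow> x \<in> carrier S \<and> \<rho> x = Id_on (Domain (\<rho> x))"
  using rep_eq_iff[of "x \<odot> x" x]
  by (auto simp del: Id_on_iff simp: Idp_def mult_closed rep_mult pbij_idem_iff rep_pbij)

lemma IdpE:
  assumes "e \<in> Idp S"
  obtains D where "e \<in> carrier S" "D \<in> supports" "\<rho> e = Id_on D"
  using assms rep_mem unfolding Idp_iff supports_iff by metis

lemma of_rel_Idp: "D \<in> supports \<Longrightarrow> of_rel (Id_on D) \<in> Idp S"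
  by (simp add: Idp_iff supports_iff of_rel_closed rep_of_rel)

lemma sdom_Idp: "x \<in> carrier S \<Longrightarrow> sdom S x \<in> Idp S"
  and sran_Idp: "x \<in> carrier S \<Longrightarrow> sran S x \<in> Idp S"
  by (simp_all add: Idp_iff rep_sdom rep_sran sdom_closed sran_closed)

lemma carrier_natural_order: "carrier (natural_order S) = carrier S"
  and carrier_Idp_order: "carrier (Idp_order S) = Idp S"
  and eq_Idp_order: "eq (Idp_order S) = (=)"
  by (simp_all add: natural_order_def Idp_order_def)

lemma le_natural_order:
  "x \<in> carrier S \<Longrightarrow> y \<in> carrier S \<Longrightarrow> le (natural_order S) x y \<longleftrightarrow> \<rho> x \<subseteq> \<rho> y"
  by (simp add: natural_order_def natural_order_iff)

lemma le_Idp_order: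
  "x \<in> Idp S \<Longrightarrow> y \<in> Idp S \<Longrightarrow> le (Idp_order S) x y \<longleftrightarrow> \<rho> x \<subseteq> \<rho> y"
  by (simp add: Idp_order_def natural_order_def natural_order_iff Idp_iff)

text \<open>An equivalence rather than an implication: \<open>oplus\<close> is a chosen least upper
  bound, and only uniqueness gives that choice a value.\<close>

lemma least_Upper_natural_order:
  assumes x: "x \<in> carrier S" and y: "y \<in> carrier S" and U: "\<rho> x \<union> \<rho> y \<in> A"
  shows "least (natural_order S) z (Upper (natural_order S) {x, y}) \<longleftrightarrow> z = of_rel (\<rho> x \<union> \<rho> y)"
proof -
  let ?u = "of_rel (\<rho> x \<union> \<rho> y)"
  have u: "?u \<in> carrier S" "\<rho> ?u = \<rho> x \<union> \<rho> y" using U by (simp_all add: of_rel_closed rep_of_rel)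
  have Up: "Upper (natural_order S) {x, y} = {w \<in> carrier S. \<rho> x \<union> \<rho> y \<subseteq> \<rho> w}"
  proof -
    have "Upper (natural_order S) {x, y} =
      {w \<in> carrier S. le (natural_order S) x w \<and> le (natural_order S) y w}"
      using x y by (auto simp: Upper_def carrier_natural_order)
    also have "\<dots> = {w \<in> carrier S. \<rho> x \<union> \<rho> y \<subseteq> \<rho> w}"
      using x y by (auto simp: le_natural_order)
    finally show ?thesis .
  qed
  show ?thesis unfolding least_def Up
  proof safe
    assume "z \<in> carrier S" "\<rho> x \<union> \<rho> y \<subseteq> \<rho> z"
      and "\<forall>w\<in>{w \<in> carrier S. \<rho> x \<union> \<rho> y \<subseteq> \<rho> w}. z \<sqsubseteq>\<^bsub>natural_order S\<^esub> w"
    then have "\<rho> z = \<rho> x \<union> \<rho> y" using u by (auto simp: le_natural_order)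
    then show "z = ?u" using \<open>z \<in> carrier S\<close> of_rel_unique by blast
  qed (use u in \<open>auto simp: le_natural_order carrier_natural_order\<close>)
qed

lemma oplus_eq:
  assumes "x \<in> carrier S" "y \<in> carrier S" "\<rho> x \<union> \<rho> y \<in> A"
  shows "oplus S x y = of_rel (\<rho> x \<union> \<rho> y)"
  by (simp add: oplus_def join_def Lattice.sup_def least_Upper_natural_order[OF assms])

lemma orthogonal_iff:
  assumes "x \<in> carrier S" "y \<in> carrier S"
  shows "orthogonal S x y \<longleftrightarrow>
    Domain (\<rho> x) \<inter> Domain (\<rho> y) = {} \<and> Range (\<rho> x) \<inter> Range (\<rho> y) = {}"
  using assms
  by (auto simp: orthogonal_def rep_eq_iff[symmetric] mult_closed zero_closed sinv_closed
      rep_mult rep_zero rep_sinv)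

lemma orthogonal_Un_mem:
  "x \<in> carrier S \<Longrightarrow> y \<in> carrier S \<Longrightarrow> orthogonal S x y \<Longrightarrow> \<rho> x \<union> \<rho> y \<in> A"
  by (simp add: orthogonal_iff Un_mem rep_mem)

lemma rep_oplus:
  assumes "x \<in> carrier S" "y \<in> carrier S" "orthogonal S x y"
  shows "oplus S x y \<in> carrier S" "\<rho> (oplus S x y) = \<rho> x \<union> \<rho> y"
  using orthogonal_Un_mem[OF assms] assms by (simp_all add: oplus_eq of_rel_closed rep_of_rel)

lemma Idp_Un:
  assumes "e \<in> Idp S" "f \<in> Idp S"
  shows "of_rel (\<rho> e \<union> \<rho> f) \<in> Idp S" "\<rho> (of_rel (\<rho> e \<union> \<rho> f)) = \<rho> e \<union> \<rho> f"
proof -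
  obtain D E where *: "D \<in> supports" "E \<in> supports" "\<rho> e = Id_on D" "\<rho> f = Id_on E"
    using assms by (metis IdpE)
  then have **: "\<rho> e \<union> \<rho> f = Id_on (D \<union> E)" "D \<union> E \<in> supports"
    by (auto simp: Un_supports)
  then show "of_rel (\<rho> e \<union> \<rho> f) \<in> Idp S" "\<rho> (of_rel (\<rho> e \<union> \<rho> f)) = \<rho> e \<union> \<rho> f"
    by (simp_all add: of_rel_Idp rep_of_rel supports_iff)
qed

lemma Idp_Int:
  assumes "e \<in> Idp S" "f \<in> Idp S"
  shows "of_rel (\<rho> e \<inter> \<rho> f) \<in> Idp S" "\<rho> (of_rel (\<rho> e \<inter> \<rho> f)) = \<rho> e \<inter> \<rho> f"
proof -
  obtain D E where *: "D \<in> supports" "E \<in> supports" "\<rho> e = Id_on D" "\<rho> f = Id_on E"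
    using assms by (metis IdpE)
  then have **: "\<rho> e \<inter> \<rho> f = Id_on (D \<inter> E)" "D \<inter> E \<in> supports"
    by (auto simp: Int_supports)
  then show "of_rel (\<rho> e \<inter> \<rho> f) \<in> Idp S" "\<rho> (of_rel (\<rho> e \<inter> \<rho> f)) = \<rho> e \<inter> \<rho> f"
    by (simp_all add: of_rel_Idp rep_of_rel supports_iff)
qed

lemma Idp_Diff:
  assumes "e \<in> Idp S" "f \<in> Idp S"
  shows "of_rel (\<rho> e - \<rho> f) \<in> Idp S" "\<rho> (of_rel (\<rho> e - \<rho> f)) = \<rho> e - \<rho> f"
proof -
  obtain D E where *: "D \<in> supports" "E \<in> supports" "\<rho> e = Id_on D" "\<rho> f = Id_on E"
    using assms by (metis IdpE)
  then have **: "\<rho> e - \<rho> f = Id_on (D - E)" "D - E \<in> supports"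
    by (auto simp: Diff_supports)
  then show "of_rel (\<rho> e - \<rho> f) \<in> Idp S" "\<rho> (of_rel (\<rho> e - \<rho> f)) = \<rho> e - \<rho> f"
    by (simp_all add: of_rel_Idp rep_of_rel supports_iff)
qed

lemma Idp_eq_iff: "e \<in> Idp S \<Longrightarrow> f \<in> Idp S \<Longrightarrow> e = f \<longleftrightarrow> \<rho> e = \<rho> f"
  by (simp add: Idp_iff rep_eq_iff)

lemma least_Upper_Idp_order:
  assumes e: "e \<in> Idp S" and f: "f \<in> Idp S"
  shows "least (Idp_order S) z (Upper (Idp_order S) {e, f}) \<longleftrightarrow> z = of_rel (\<rho> e \<union> \<rho> f)"
proof -
  let ?u = "of_rel (\<rho> e \<union> \<rho> f)"
  note u = Idp_Un[OF e f]
  have Up: "Upper (Idp_order S) {e, f} = {w \<in> Idp S. \<rho> e \<union> \<rho> f \<subseteq> \<rho> w}"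
  proof -
    have "Upper (Idp_order S) {e, f} = {w \<in> Idp S. le (Idp_order S) e w \<and> le (Idp_order S) f w}"
      using e f by (auto simp: Upper_def carrier_Idp_order)
    also have "\<dots> = {w \<in> Idp S. \<rho> e \<union> \<rho> f \<subseteq> \<rho> w}"
      using e f by (auto simp: le_Idp_order)
    finally show ?thesis .
  qed
  show ?thesis unfolding least_def Up
  proof safe
    assume "z \<in> Idp S" "\<rho> e \<union> \<rho> f \<subseteq> \<rho> z"
      and "\<forall>w\<in>{w \<in> Idp S. \<rho> e \<union> \<rho> f \<subseteq> \<rho> w}. z \<sqsubseteq>\<^bsub>Idp_order S\<^esub> w"
    then have "\<rho> z = \<rho> e \<union> \<rho> f" using u by (auto simp: le_Idp_order)
    then show "z = ?u" using \<open>z \<in> Idp S\<close> u by (simp add: Idp_eq_iff)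
  qed (use u in \<open>auto simp: le_Idp_order carrier_Idp_order\<close>)
qed

lemma greatest_Lower_Idp_order:
  assumes e: "e \<in> Idp S" and f: "f \<in> Idp S"
  shows "greatest (Idp_order S) z (Lower (Idp_order S) {e, f}) \<longleftrightarrow> z = of_rel (\<rho> e \<inter> \<rho> f)"
proof -
  let ?u = "of_rel (\<rho> e \<inter> \<rho> f)"
  note u = Idp_Int[OF e f]
  have Up: "Lower (Idp_order S) {e, f} = {w \<in> Idp S. \<rho> w \<subseteq> \<rho> e \<inter> \<rho> f}"
  proof -
    have "Lower (Idp_order S) {e, f} = {w \<in> Idp S. le (Idp_order S) w e \<and> le (Idp_order S) w f}"
      using e f by (auto simp: Lower_def carrier_Idp_order)
    also have "\<dots> = {w \<in> Idp S. \<rho> w \<subseteq> \<rho> e \<inter> \<rho> f}"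
      using e f by (auto simp: le_Idp_order)
    finally show ?thesis .
  qed
  show ?thesis unfolding greatest_def Up
  proof safe
    assume "z \<in> Idp S" "\<rho> z \<subseteq> \<rho> e \<inter> \<rho> f"
      and "\<forall>w\<in>{w \<in> Idp S. \<rho> w \<subseteq> \<rho> e \<inter> \<rho> f}. w \<sqsubseteq>\<^bsub>Idp_order S\<^esub> z"
    then have "\<rho> z = \<rho> e \<inter> \<rho> f" using u by (auto simp: le_Idp_order)
    then show "z = ?u" using \<open>z \<in> Idp S\<close> u by (simp add: Idp_eq_iff)
  qed (use u in \<open>auto simp: le_Idp_order carrier_Idp_order\<close>)
qed

lemma zero_Idp: "szero S \<in> Idp S"
  by (simp add: Idp_iff zero_closed rep_zero)

lemma least_Idp_order: "least (Idp_order S) z (Idp S) \<longleftrightarrow> z = szero S"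
proof
  assume "least (Idp_order S) z (Idp S)"
  then have "z \<in> Idp S" "le (Idp_order S) z (szero S)" using zero_Idp by (auto simp: least_def)
  then have "\<rho> z = {}" using zero_Idp by (simp add: le_Idp_order rep_zero)
  then show "z = szero S" using \<open>z \<in> Idp S\<close> zero_Idp by (simp add: Idp_eq_iff rep_zero)
qed (use zero_Idp in \<open>auto simp: least_def carrier_Idp_order le_Idp_order rep_zero\<close>)

lemma bottom_Idp_order: "\<bottom>\<^bsub>Idp_order S\<^esub> = szero S"
  by (simp add: bottom_def carrier_Idp_order least_Idp_order)

lemma join_Idp_order: "e \<in> Idp S \<Longrightarrow> f \<in> Idp S \<Longrightarrow> e \<squnion>\<^bsub>Idp_order S\<^esub> f = of_rel (\<rho> e \<union> \<rho> f)"
  by (simp add: join_def Lattice.sup_def least_Upper_Idp_order)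

lemma meet_Idp_order: "e \<in> Idp S \<Longrightarrow> f \<in> Idp S \<Longrightarrow> e \<sqinter>\<^bsub>Idp_order S\<^esub> f = of_rel (\<rho> e \<inter> \<rho> f)"
  by (simp add: meet_def Lattice.inf_def greatest_Lower_Idp_order)

lemma lattice_diff_eq:
  assumes e: "e \<in> Idp S" and f: "f \<in> Idp S"
  shows "lattice_diff (Idp_order S) e f = of_rel (\<rho> e - \<rho> f)"
  unfolding lattice_diff_def carrier_Idp_order bottom_Idp_order
proof (rule the_equality)
  note d = Idp_Diff[OF e f] Idp_Int[OF e f]
  show "of_rel (\<rho> e - \<rho> f) \<in> Idp S \<and>
    f \<sqinter>\<^bsub>Idp_order S\<^esub> of_rel (\<rho> e - \<rho> f) = szero S \<and>
    e \<sqinter>\<^bsub>Idp_order S\<^esub> f \<squnion>\<^bsub>Idp_order S\<^esub> of_rel (\<rho> e - \<rho> f) = e"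
    using d e f by (simp add: meet_Idp_order join_Idp_order)
      (metis Diff_disjoint Idp_Int Idp_Un Idp_eq_iff Int_Diff_Un rep_zero zero_Idp)
next
  fix c assume c: "c \<in> Idp S \<and> f \<sqinter>\<^bsub>Idp_order S\<^esub> c = szero S \<and>
    e \<sqinter>\<^bsub>Idp_order S\<^esub> f \<squnion>\<^bsub>Idp_order S\<^esub> c = e"
  then have "\<rho> f \<inter> \<rho> c = {}" "\<rho> e \<inter> \<rho> f \<union> \<rho> c = \<rho> e"
    using e f Idp_Int[of f c] Idp_Int[OF e f] Idp_Un[of "of_rel (\<rho> e \<inter> \<rho> f)" c]
    by (auto simp: meet_Idp_order join_Idp_order rep_zero)
  then have "\<rho> c = \<rho> e - \<rho> f" by blast
  then show "c = of_rel (\<rho> e - \<rho> f)" using c Idp_Diff[OF e f] by (simp add: Idp_eq_iff)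
qed

lemma generalized_boolean_algebra: "generalized_boolean_algebra (Idp_order S)"
proof -
  interpret L: weak_partial_order "Idp_order S"
    by standard (auto simp: carrier_Idp_order eq_Idp_order le_Idp_order Idp_eq_iff)
  interpret L: partial_order "Idp_order S"
    by standard (simp add: eq_Idp_order)
  interpret L: lattice "Idp_order S"
    by standard (auto simp: carrier_Idp_order least_Upper_Idp_order greatest_Lower_Idp_order)
  show ?thesis
  proof
    show "\<exists>x. least (Idp_order S) x (carrier (Idp_order S))"
      by (simp add: carrier_Idp_order least_Idp_order)
  next
    fix a b c assume "a \<in> carrier (Idp_order S)" "b \<in> carrier (Idp_order S)" "c \<in> carrier (Idp_order S)"
    then show "a \<sqinter>\<^bsub>Idp_order S\<^esub> (b \<squnion>\<^bsub>Idp_order S\<^esub> c) =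
       a \<sqinter>\<^bsub>Idp_order S\<^esub> b \<squnion>\<^bsub>Idp_order S\<^esub> a \<sqinter>\<^bsub>Idp_order S\<^esub> c"
      by (simp add: carrier_Idp_order meet_Idp_order join_Idp_order Idp_Un Idp_Int Int_Un_distrib)
  next
    fix a b assume ab: "a \<in> carrier (Idp_order S)" "b \<in> carrier (Idp_order S)" "a \<sqsubseteq>\<^bsub>Idp_order S\<^esub> b"
    then have *: "a \<in> Idp S" "b \<in> Idp S" "\<rho> a \<subseteq> \<rho> b"
      by (auto simp: carrier_Idp_order le_Idp_order)
    note d = Idp_Diff[OF *(2,1)]
    have "a \<sqinter>\<^bsub>Idp_order S\<^esub> of_rel (\<rho> b - \<rho> a) = \<bottom>\<^bsub>Idp_order S\<^esub>"
      using d * Idp_Int[OF *(1) d(1)] zero_Idp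
      by (simp add: meet_Idp_order bottom_Idp_order Idp_eq_iff rep_zero)
    moreover have "a \<squnion>\<^bsub>Idp_order S\<^esub> of_rel (\<rho> b - \<rho> a) = b"
      using d * Idp_Un[OF *(1) d(1)]
      by (simp add: join_Idp_order Idp_eq_iff) blast
    ultimately show "\<exists>c\<in>carrier (Idp_order S).
          a \<sqinter>\<^bsub>Idp_order S\<^esub> c = \<bottom>\<^bsub>Idp_order S\<^esub> \<and> a \<squnion>\<^bsub>Idp_order S\<^esub> c = b"
      using d(1) by (auto simp: carrier_Idp_order)
  qed
qed

lemma boolean_inverse_semigroup: "boolean_inverse_semigroup S"
proof (intro boolean_inverse_semigroup.intro boolean_inverse_semigroup_axioms.intro)
  fix x y assume "x \<in> carrier S" "y \<in> carrier S" "orthogonal S x y"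
  then show "\<exists>z. least (natural_order S) z (Upper (natural_order S) {x, y})"
    by (simp add: least_Upper_natural_order orthogonal_Un_mem)
qed (fact inverse_semigroup0 generalized_boolean_algebra)+

lemma rep_bias_diff:
  assumes "x \<in> carrier S" "y \<in> carrier S"
  shows "bias_diff S x y \<in> carrier S" "\<rho> (bias_diff S x y) = rel_diff (\<rho> x) (\<rho> y)"
proof -
  have c: "of_rel (\<rho> (sran S x) - \<rho> (sran S y)) \<in> carrier S"
    "of_rel (\<rho> (sdom S x) - \<rho> (sdom S y)) \<in> carrier S"
    using Idp_Diff[of "sran S x" "sran S y"] Idp_Diff[of "sdom S x" "sdom S y"] assms
    by (simp_all add: sdom_Idp sran_Idp Idp_iff[of "of_rel _"])
  show "bias_diff S x y \<in> carrier S"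
    using assms c by (simp add: bias_diff_def lattice_diff_eq sdom_Idp sran_Idp mult_closed)
  have "\<rho> (bias_diff S x y) = (Id_on (Domain (\<rho> x)) - Id_on (Domain (\<rho> y))) O \<rho> x O
      (Id_on (Range (\<rho> x)) - Id_on (Range (\<rho> y)))"
    using assms c Idp_Diff[of "sran S x" "sran S y"] Idp_Diff[of "sdom S x" "sdom S y"]
    by (simp add: bias_diff_def lattice_diff_eq sdom_Idp sran_Idp mult_closed rep_mult rep_sdom rep_sran)
  also have "\<dots> = rel_diff (\<rho> x) (\<rho> y)"
    by (auto simp: rel_diff_def)
  finally show "\<rho> (bias_diff S x y) = rel_diff (\<rho> x) (\<rho> y)" .
qed

lemma rep_bias_skew:
  assumes "x \<in> carrier S" "y \<in> carrier S"
  shows "bias_skew S x y \<in> carrier S" "\<rho> (bias_skew S x y) = rel_skew (\<rho> x) (\<rho> y)"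
proof -
  have "orthogonal S (bias_diff S x y) y"
    using assms by (auto simp: orthogonal_iff rep_bias_diff rel_diff_def)
  then show "bias_skew S x y \<in> carrier S" "\<rho> (bias_skew S x y) = rel_skew (\<rho> x) (\<rho> y)"
    using assms by (simp_all add: bias_skew_def rep_oplus rep_bias_diff rel_skew_def)
qed

lemma rep_bias_eval:
  assumes "range v \<subseteq> carrier S"
  shows "bias_eval S v t \<in> carrier S \<and> \<rho> (bias_eval S v t) = rel_eval (\<lambda>i. \<rho> (v i)) t"
proof -
  have "\<And>i. v i \<in> carrier S" using assms by blast
  then show ?thesis
    by (induction t)
      (simp_all add: zero_closed rep_zero sinv_closed rep_sinv mult_closed rep_mult rep_bias_diff rep_bias_skew)
qed

text \<open>Valuations in \<open>S\<close> and in \<open>A\<close> correspond to each other through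
  \<open>\<rho>\<close> and \<open>of_rel\<close>. From here on membership in a variety is a
  property of the set of relations, whatever the type of \<open>S\<close> is.\<close>

lemma bias_variety_iff: "S \<in> bias_variety E \<longleftrightarrow> rel_sat A E"
proof -
  have "satisfies_identity S (l, r) \<longleftrightarrow> (\<forall>v. range v \<subseteq> A \<longrightarrow> rel_eval v l = rel_eval v r)" for l r
  proof
    assume s: "satisfies_identity S (l, r)"
    show "\<forall>v. range v \<subseteq> A \<longrightarrow> rel_eval v l = rel_eval v r"
    proof (intro allI impI)
      fix v :: "nat \<Rightarrow> ('x \<times> 'x) set" assume v: "range v \<subseteq> A"
      then have v': "\<And>i. v i \<in> A" by blast
      then have *: "range (\<lambda>i. of_rel (v i)) \<subseteq> carrier S" by (auto simp: of_rel_closed)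
      with s have "bias_eval S (\<lambda>i. of_rel (v i)) l = bias_eval S (\<lambda>i. of_rel (v i)) r"
        by (simp add: satisfies_identity_def)
      then show "rel_eval v l = rel_eval v r"
        using rep_bias_eval[OF *, of l] rep_bias_eval[OF *, of r] v' by (simp add: rep_of_rel)
    qed
  next
    assume *: "\<forall>v. range v \<subseteq> A \<longrightarrow> rel_eval v l = rel_eval v r"
    show "satisfies_identity S (l, r)"
      unfolding satisfies_identity_def fst_conv snd_conv
    proof (intro allI impI)
      fix v :: "nat \<Rightarrow> 'a" assume v: "range v \<subseteq> carrier S"
      then have "range (\<lambda>i. \<rho> (v i)) \<subseteq> A" by (auto intro: rep_mem)
      then have "rel_eval (\<lambda>i. \<rho> (v i)) l = rel_eval (\<lambda>i. \<rho> (v i)) r" using * by blast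
      then show "bias_eval S v l = bias_eval S v r"
        using rep_bias_eval[OF v, of l] rep_bias_eval[OF v, of r] rep_eq_iff by metis
    qed
  qed
  then show ?thesis
    by (auto simp: bias_variety_def rel_sat_def boolean_inverse_semigroup)
qed

end

section \<open>Every Boolean inverse semigroup is a bias of partial bijections\<close>

context inverse_semigroup0
begin

lemma mult_eq_left:
  "x \<odot> y = w \<Longrightarrow> x \<in> carrier S \<Longrightarrow> y \<in> carrier S \<Longrightarrow> z \<in> carrier S \<Longrightarrow> x \<odot> (y \<odot> z) = w \<odot> z"
  using smul_assoc[of x y z] by simp

lemma mult_absorb_trans:
  "x \<odot> y = x \<Longrightarrow> y \<odot> z = y \<Longrightarrow> x \<in> carrier S \<Longrightarrow> y \<in> carrier S \<Longrightarrow> z \<in> carrier S \<Longrightarrow> x \<odot> z = x"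
  using smul_assoc[of x y z] by simp

lemma is_sinv_sinv: "x \<in> carrier S \<Longrightarrow> is_sinv S x (sinv S x)"
  unfolding sinv_def by (rule theI') (rule unique_inverse)

lemma sinv_unique: "x \<in> carrier S \<Longrightarrow> is_sinv S x y \<Longrightarrow> sinv S x = y"
  using is_sinv_sinv unique_inverse by blast

lemma sinv_closed [simp]: "x \<in> carrier S \<Longrightarrow> sinv S x \<in> carrier S"
  using is_sinv_sinv by (auto simp: is_sinv_def)

declare smul_closed [simp] szero_closed [simp] szero_left [simp] szero_right [simp] smul_assoc [simp]

lemma mult_sinv_mult [simp]: "x \<in> carrier S \<Longrightarrow> x \<odot> (sinv S x \<odot> x) = x"
  using is_sinv_sinv[of x] by (simp add: is_sinv_def)

lemma sinv_mult_sinv [simp]: "x \<in> carrier S \<Longrightarrow> sinv S x \<odot> (x \<odot> sinv S x) = sinv S x"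
  using is_sinv_sinv[of x] by (simp add: is_sinv_def)

lemma mult_sinv_mult_left [simp]:
  "x \<in> carrier S \<Longrightarrow> z \<in> carrier S \<Longrightarrow> x \<odot> (sinv S x \<odot> (x \<odot> z)) = x \<odot> z"
  using mult_sinv_mult[of x] by (metis sinv_closed smul_assoc smul_closed)

lemma sinv_mult_sinv_left [simp]:
  "x \<in> carrier S \<Longrightarrow> z \<in> carrier S \<Longrightarrow> sinv S x \<odot> (x \<odot> (sinv S x \<odot> z)) = sinv S x \<odot> z"
  using sinv_mult_sinv[of x] by (metis sinv_closed smul_assoc smul_closed)

lemma sinv_sinv [simp]: "x \<in> carrier S \<Longrightarrow> sinv S (sinv S x) = x"
  by (rule sinv_unique) (simp_all add: is_sinv_def)

lemma Idp_closed [simp]: "e \<in> Idp S \<Longrightarrow> e \<in> carrier S"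
  and Idp_idem [simp]: "e \<in> Idp S \<Longrightarrow> e \<odot> e = e"
  by (simp_all add: Idp_def)

lemma IdpI: "e \<in> carrier S \<Longrightarrow> e \<odot> e = e \<Longrightarrow> e \<in> Idp S"
  unfolding Idp_def by blast

lemma szero_Idp [simp]: "szero S \<in> Idp S"
  by (rule IdpI) simp_all

lemma Idp_idem_left [simp]: "e \<in> Idp S \<Longrightarrow> z \<in> carrier S \<Longrightarrow> e \<odot> (e \<odot> z) = e \<odot> z"
  by (rule mult_eq_left[OF Idp_idem]) simp_all

lemma sinv_Idp [simp]: "e \<in> Idp S \<Longrightarrow> sinv S e = e"
  by (rule sinv_unique) (simp_all add: is_sinv_def)

text \<open>If \<open>a\<close> is the inverse of \<open>e \<odot> f\<close>, then
  \<open>f \<odot> (a \<odot> e)\<close> is an inverse as well, so it equals \<open>a\<close>. This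
  makes \<open>a\<close> idempotent, hence its own inverse, and \<open>a\<close> is
  \<open>e \<odot> f\<close>.\<close>

lemma Idp_mult [simp]:
  assumes "e \<in> Idp S" "f \<in> Idp S" shows "e \<odot> f \<in> Idp S"
proof -
  define a where "a = sinv S (e \<odot> f)"
  have a [simp]: "a \<in> carrier S" using assms by (simp add: a_def)
  have 1: "e \<odot> (f \<odot> (a \<odot> (e \<odot> f))) = e \<odot> f" and 2: "a \<odot> (e \<odot> (f \<odot> a)) = a"
    using mult_sinv_mult[of "e \<odot> f"] sinv_mult_sinv[of "e \<odot> f"] assms
    by (simp_all add: a_def[symmetric])
  have 3: "f \<odot> (a \<odot> (e \<odot> (f \<odot> (a \<odot> e)))) = f \<odot> (a \<odot> e)"
    using 2 assms by (metis Idp_closed a smul_assoc smul_closed)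
  have "is_sinv S (e \<odot> f) (f \<odot> (a \<odot> e))"
    using assms 1 3 by (simp add: is_sinv_def)
  then have "sinv S (e \<odot> f) = f \<odot> (a \<odot> e)"
    by (intro sinv_unique) (use assms in simp_all)
  then have a_eq: "a = f \<odot> (a \<odot> e)"
    unfolding a_def[symmetric] .
  have "(f \<odot> (a \<odot> e)) \<odot> (f \<odot> (a \<odot> e)) = f \<odot> (a \<odot> e)" using assms 3 by simp
  then have "a \<odot> a = a" by (simp add: a_eq[symmetric])
  then have "a \<in> Idp S" using a by (rule IdpI[rotated])
  moreover have "sinv S a = e \<odot> f" using assms by (simp add: a_def)
  ultimately show ?thesis using sinv_Idp by metis
qed

text \<open>Since products of idempotents are idempotent, \<open>f \<odot> e\<close> is an inverse
  of \<open>e \<odot> f\<close>; but an idempotent is its own inverse.\<close>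

lemma Idp_commute:
  assumes "e \<in> Idp S" "f \<in> Idp S" shows "e \<odot> f = f \<odot> e"
proof -
  have "e \<odot> (f \<odot> (e \<odot> f)) = e \<odot> f" "f \<odot> (e \<odot> (f \<odot> e)) = f \<odot> e"
    using Idp_idem[OF Idp_mult[OF assms]] Idp_idem[OF Idp_mult[OF assms(2,1)]] assms
    by (simp_all del: Idp_idem)
  then have "is_sinv S (e \<odot> f) (f \<odot> e)"
    using assms by (simp add: is_sinv_def)
  then show ?thesis using sinv_unique[of "e \<odot> f"] assms by simp
qed

lemma Idp_commute_left:
  "e \<in> Idp S \<Longrightarrow> f \<in> Idp S \<Longrightarrow> z \<in> carrier S \<Longrightarrow> e \<odot> (f \<odot> z) = f \<odot> (e \<odot> z)"
  using Idp_commute[of e f] mult_eq_left by (metis Idp_closed)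

lemma sinv_mult_Idp [simp]: "x \<in> carrier S \<Longrightarrow> sinv S x \<odot> x \<in> Idp S"
  and mult_sinv_Idp [simp]: "x \<in> carrier S \<Longrightarrow> x \<odot> sinv S x \<in> Idp S"
  by (rule IdpI; simp)+

lemma sinv_mult:
  assumes x [simp]: "x \<in> carrier S" and y [simp]: "y \<in> carrier S"
  shows "sinv S (x \<odot> y) = sinv S y \<odot> sinv S x"
proof (rule sinv_unique)
  have c: "y \<odot> (sinv S y \<odot> (sinv S x \<odot> (x \<odot> z))) = sinv S x \<odot> (x \<odot> (y \<odot> (sinv S y \<odot> z)))"
    if "z \<in> carrier S" for z
    using Idp_commute_left[of "y \<odot> sinv S y" "sinv S x \<odot> x" z] that by simp
  show "is_sinv S (x \<odot> y) (sinv S y \<odot> sinv S x)"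
    unfolding is_sinv_def
  proof (intro conjI)
    show "x \<odot> y = x \<odot> y \<odot> (sinv S y \<odot> sinv S x) \<odot> (x \<odot> y)"
      by (simp add: c)
    have "sinv S y \<odot> (sinv S x \<odot> (x \<odot> (y \<odot> (sinv S y \<odot> sinv S x)))) =
       sinv S y \<odot> (y \<odot> (sinv S y \<odot> (sinv S x \<odot> (x \<odot> sinv S x))))"
      by (subst c) simp_all
    then show "sinv S y \<odot> sinv S x = sinv S y \<odot> sinv S x \<odot> (x \<odot> y) \<odot> (sinv S y \<odot> sinv S x)"
      by simp
  qed simp
qed simp

lemma sdom_Idp [simp]: "x \<in> carrier S \<Longrightarrow> sdom S x \<in> Idp S"
  by (simp add: sdom_def)

lemma sdom_closed [simp]: "x \<in> carrier S \<Longrightarrow> sdom S x \<in> carrier S"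
  by (simp add: sdom_def)

lemma sdom_of_Idp [simp]: "e \<in> Idp S \<Longrightarrow> sdom S e = e"
  by (simp add: sdom_def)

lemma mult_sdom [simp]: "x \<in> carrier S \<Longrightarrow> x \<odot> sdom S x = x"
  by (simp add: sdom_def)

lemma sdom_mult: "x \<in> carrier S \<Longrightarrow> y \<in> carrier S \<Longrightarrow> sdom S (x \<odot> y) = sinv S y \<odot> (sdom S x \<odot> y)"
  by (simp add: sdom_def sinv_mult)

lemma sdom_mult_Idp:
  assumes "x \<in> carrier S" "e \<in> Idp S" shows "sdom S (x \<odot> e) = sdom S x \<odot> e"
  using assms Idp_commute_left[of e "sdom S x" e] Idp_commute[of e "sdom S x"] by (simp add: sdom_mult)

lemma mult_absorb_commute:
  "x \<odot> u = x \<Longrightarrow> x \<in> carrier S \<Longrightarrow> u \<in> Idp S \<Longrightarrow> f \<in> Idp S \<Longrightarrow> x \<odot> f \<odot> u = x \<odot> f"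
  using Idp_commute[of f u] mult_eq_left[of x u x f] by simp

text \<open>The conjugate is \<open>sdom S (e \<odot> x)\<close>, the part of the domain of
  \<open>x\<close> that \<open>x\<close> sends below \<open>e\<close>.\<close>

lemma conj_Idp:
  assumes [simp]: "x \<in> carrier S" "e \<in> Idp S" shows "sinv S x \<odot> (e \<odot> x) \<in> Idp S"
proof (rule IdpI)
  have "sinv S x \<odot> (e \<odot> x) \<odot> (sinv S x \<odot> (e \<odot> x)) = sinv S x \<odot> (e \<odot> ((x \<odot> sinv S x) \<odot> (e \<odot> x)))"
    by simp
  also have "\<dots> = sinv S x \<odot> ((x \<odot> sinv S x) \<odot> (e \<odot> (e \<odot> x)))"
    by (subst Idp_commute_left) simp_all
  also have "\<dots> = sinv S x \<odot> (e \<odot> x)" by simp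
  finally show "sinv S x \<odot> (e \<odot> x) \<odot> (sinv S x \<odot> (e \<odot> x)) = sinv S x \<odot> (e \<odot> x)" .
qed simp

lemma Idp_mult_conj:
  assumes [simp]: "x \<in> carrier S" "e \<in> Idp S" shows "x \<odot> (sinv S x \<odot> (e \<odot> x)) = e \<odot> x"
  using Idp_commute_left[of "x \<odot> sinv S x" e x] by simp

lemma sdom_mult_le: "x \<in> carrier S \<Longrightarrow> y \<in> carrier S \<Longrightarrow> sdom S (x \<odot> y) \<odot> sdom S y = sdom S (x \<odot> y)"
  using sdom_mult_Idp[of "x \<odot> y" "sdom S y"] by simp

lemma sdom_left_mult:
  assumes "x \<in> carrier S" "y \<in> carrier S" shows "sdom S x \<odot> y = y \<odot> sdom S (x \<odot> y)"
  using assms Idp_mult_conj[of y "sdom S x"] by (simp add: sdom_mult)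

section \<open>Joins of idempotents, prime filters and germs\<close>

lemma le_natural_order: "le (natural_order S) x y \<longleftrightarrow> x = y \<odot> sdom S x"
  by (simp add: natural_order_def)

lemma le_Idp_order: "e \<in> Idp S \<Longrightarrow> f \<in> Idp S \<Longrightarrow> le (Idp_order S) e f \<longleftrightarrow> e \<odot> f = e"
  using Idp_commute[of e f] by (auto simp: Idp_order_def natural_order_def)

lemma carrier_Idp_order: "carrier (Idp_order S) = Idp S"
  by (simp add: Idp_order_def)

text \<open>
  Distributivity is built into the notion of join: \<open>g \<odot> e \<le> k\<close> and \<open>g \<odot> f \<le> k\<close> entail
  \<open>g \<odot> j \<le> k\<close>.
\<close>

definition is_join :: "'a \<Rightarrow> 'a \<Rightarrow> 'a \<Rightarrow> bool" where
  "is_join e f j \<longleftrightarrow> e \<in> Idp S \<and> f \<in> Idp S \<and> j \<in> Idp S \<and> e \<odot> j = e \<and> f \<odot> j = f \<and>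
     (\<forall>g\<in>Idp S. \<forall>k\<in>Idp S. g \<odot> e \<odot> k = g \<odot> e \<longrightarrow> g \<odot> f \<odot> k = g \<odot> f \<longrightarrow> g \<odot> j \<odot> k = g \<odot> j)"

lemma is_join_distrib:
  "is_join e f j \<Longrightarrow> g \<in> Idp S \<Longrightarrow> k \<in> Idp S \<Longrightarrow> g \<odot> e \<odot> k = g \<odot> e \<Longrightarrow> g \<odot> f \<odot> k = g \<odot> f \<Longrightarrow>
    g \<odot> j \<odot> k = g \<odot> j"
  unfolding is_join_def by blast

text \<open>The distributive clause of \<open>is_join\<close> with \<open>j\<close> itself as the
  multiplier.\<close>

lemma is_join_least:
  assumes "is_join e f j" "k \<in> Idp S" "e \<odot> k = e" "f \<odot> k = f" shows "j \<odot> k = j"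
proof -
  have "j \<odot> e \<odot> k = j \<odot> e" "j \<odot> f \<odot> k = j \<odot> f"
    using assms by (auto simp: is_join_def)
  then have "j \<odot> j \<odot> k = j \<odot> j" using assms unfolding is_join_def by blast
  then show ?thesis using assms(1) by (simp add: is_join_def)
qed

definition prime_filter :: "'a set \<Rightarrow> bool" where
  "prime_filter p \<longleftrightarrow> p \<subseteq> Idp S \<and> szero S \<notin> p \<and> (\<forall>e\<in>p. \<forall>f\<in>p. e \<odot> f \<in> p) \<and>
     (\<forall>e\<in>p. \<forall>f\<in>Idp S. e \<odot> f = e \<longrightarrow> f \<in> p) \<and>
     (\<forall>e f j. is_join e f j \<longrightarrow> j \<in> p \<longrightarrow> e \<in> p \<or> f \<in> p)"

lemma prime_filter_Idp: "prime_filter p \<Longrightarrow> e \<in> p \<Longrightarrow> e \<in> Idp S"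
  and prime_filter_zero: "prime_filter p \<Longrightarrow> szero S \<notin> p"
  and prime_filter_mult: "prime_filter p \<Longrightarrow> e \<in> p \<Longrightarrow> f \<in> p \<Longrightarrow> e \<odot> f \<in> p"
  and prime_filter_up: "prime_filter p \<Longrightarrow> e \<in> p \<Longrightarrow> f \<in> Idp S \<Longrightarrow> e \<odot> f = e \<Longrightarrow> f \<in> p"
  and prime_filter_join: "prime_filter p \<Longrightarrow> is_join e f j \<Longrightarrow> j \<in> p \<Longrightarrow> e \<in> p \<or> f \<in> p"
  unfolding prime_filter_def by blast+

lemma prime_filter_mult_iff:
  assumes "prime_filter p" "e \<in> Idp S" "f \<in> Idp S" shows "e \<odot> f \<in> p \<longleftrightarrow> e \<in> p \<and> f \<in> p"
proof -
  have "e \<odot> f \<odot> e = e \<odot> f" "e \<odot> f \<odot> f = e \<odot> f"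
    using assms Idp_commute[of f e] by simp_all
  then show ?thesis using assms prime_filter_up prime_filter_mult Idp_mult by metis
qed

text \<open>
  Left multiplication represents \<open>S\<close> on the germs \<open>x p\<close>, the elements \<open>x\<close> with \<open>d(x) \<in> p\<close> up to
  agreement on some member of the prime filter \<open>p\<close>.
\<close>

definition germ :: "'a set \<Rightarrow> 'a \<Rightarrow> 'a set" where
  "germ p x = {y \<in> carrier S. sdom S y \<in> p \<and> (\<exists>e\<in>p. x \<odot> e = y \<odot> e)}"

text \<open>The groupoid of germs acting on its source fibres: the filter \<open>p\<close> stays
  fixed and is kept in the pair, so germs at different filters are different points. The germ of
  \<open>x\<close> is in the domain of \<open>s\<close> when \<open>s \<odot> x\<close> still has
  its domain in \<open>p\<close>.\<close>

definition germ_rep :: "'a \<Rightarrow> (('a set \<times> 'a set) \<times> ('a set \<times> 'a set)) set" where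
  "germ_rep s = {((p, germ p x), (p, germ p (s \<odot> x))) | p x.
     prime_filter p \<and> x \<in> carrier S \<and> sdom S (s \<odot> x) \<in> p}"

lemma germ_sym_trans:
  assumes p: "prime_filter p" and c: "x \<in> carrier S" "y \<in> carrier S" "z \<in> carrier S"
    and "\<exists>e\<in>p. x \<odot> e = y \<odot> e" "\<exists>e\<in>p. y \<odot> e = z \<odot> e"
  shows "\<exists>e\<in>p. x \<odot> e = z \<odot> e"
proof -
  obtain e f where ef: "e \<in> p" "f \<in> p" "x \<odot> e = y \<odot> e" "y \<odot> f = z \<odot> f" using assms by blast
  have I: "e \<in> Idp S" "f \<in> Idp S" using ef p prime_filter_Idp by auto
  have "x \<odot> (e \<odot> f) = x \<odot> e \<odot> f" using c I by simp
  also have "\<dots> = y \<odot> f \<odot> e" using ef(3) c I Idp_commute[of e f] by simp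
  also have "\<dots> = z \<odot> (e \<odot> f)" unfolding ef(4) using c I Idp_commute[of e f] by simp
  finally show ?thesis using ef p prime_filter_mult by blast
qed

lemma germ_eq_iff:
  assumes p: "prime_filter p" and x: "x \<in> carrier S" "sdom S x \<in> p" and y: "y \<in> carrier S" "sdom S y \<in> p"
  shows "germ p x = germ p y \<longleftrightarrow> (\<exists>e\<in>p. x \<odot> e = y \<odot> e)"
proof
  assume "germ p x = germ p y"
  moreover have "y \<in> germ p y" using y by (auto simp: germ_def)
  ultimately show "\<exists>e\<in>p. x \<odot> e = y \<odot> e" by (auto simp: germ_def)
next
  assume e: "\<exists>e\<in>p. x \<odot> e = y \<odot> e"
  then have e': "\<exists>e\<in>p. y \<odot> e = x \<odot> e" by metis
  show "germ p x = germ p y"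
    unfolding germ_def using germ_sym_trans[OF p _ _ _ e] germ_sym_trans[OF p _ _ _ e'] x y by blast
qed

lemma sdom_mult_mem:
  assumes "prime_filter p" "s \<in> carrier S" "x \<in> carrier S" "sdom S (s \<odot> x) \<in> p" shows "sdom S x \<in> p"
  using prime_filter_up[OF assms(1) assms(4)] assms sdom_mult_le by simp

text \<open>Where \<open>x\<close> and \<open>y\<close> agree on \<open>e\<close>, so do
  \<open>s \<odot> x\<close> and \<open>s \<odot> y\<close>. Their domains coincide after
  multiplication by \<open>e\<close>, so membership in the filter passes from one to the
  other.\<close>

lemma germ_sdom_mult:
  assumes p: "prime_filter p" and c: "s \<in> carrier S" "x \<in> carrier S" "y \<in> carrier S"
    and x: "sdom S (s \<odot> x) \<in> p" and e: "e \<in> p" "x \<odot> e = y \<odot> e"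
  shows "sdom S (s \<odot> y) \<in> p" "germ p (s \<odot> x) = germ p (s \<odot> y)"
proof -
  have eI: "e \<in> Idp S" using p e prime_filter_Idp by blast
  have eq: "s \<odot> x \<odot> e = s \<odot> y \<odot> e" using c e eI by simp
  have "sdom S (s \<odot> x \<odot> e) = sdom S (s \<odot> x) \<odot> e" "sdom S (s \<odot> y \<odot> e) = sdom S (s \<odot> y) \<odot> e"
    by (rule sdom_mult_Idp; use c eI in simp)+
  then have "sdom S (s \<odot> y) \<odot> e \<in> p"
    using prime_filter_mult[OF p x e(1)] eq by simp
  then show y: "sdom S (s \<odot> y) \<in> p" using prime_filter_mult_iff[OF p] eI c by simp
  show "germ p (s \<odot> x) = germ p (s \<odot> y)"
    using germ_eq_iff[OF p _ x _ y] c e(1) eq smul_closed by blast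
qed

lemma germ_repI:
  "prime_filter p \<Longrightarrow> x \<in> carrier S \<Longrightarrow> sdom S (s \<odot> x) \<in> p \<Longrightarrow>
    ((p, germ p x), (p, germ p (s \<odot> x))) \<in> germ_rep s"
  unfolding germ_rep_def by blast

lemma germ_repE:
  assumes "(a, b) \<in> germ_rep s"
  obtains p x where "prime_filter p" "x \<in> carrier S" "sdom S (s \<odot> x) \<in> p" "a = (p, germ p x)"
    "b = (p, germ p (s \<odot> x))"
  using assms unfolding germ_rep_def by blast

text \<open>The definition only offers some representative of the germ; independence of
  representatives allows it to be replaced by the given \<open>x\<close>, so that composites can be
  computed along one chain of representatives.\<close>

lemma germ_rep_at:
  assumes s: "s \<in> carrier S" and x: "x \<in> carrier S" and p: "prime_filter p" and d: "sdom S x \<in> p"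
  shows "((p, germ p x), b) \<in> germ_rep s \<longleftrightarrow> sdom S (s \<odot> x) \<in> p \<and> b = (p, germ p (s \<odot> x))"
proof
  assume "((p, germ p x), b) \<in> germ_rep s"
  then obtain y where y: "y \<in> carrier S" "sdom S (s \<odot> y) \<in> p" "germ p x = germ p y"
    "b = (p, germ p (s \<odot> y))"
    unfolding germ_rep_def by blast
  have "sdom S y \<in> p" using sdom_mult_mem[OF p s y(1,2)] .
  then obtain e where "e \<in> p" "y \<odot> e = x \<odot> e" using y germ_eq_iff[OF p x d, of y] by metis
  from germ_sdom_mult[OF p s y(1) x y(2) this] y show
    "sdom S (s \<odot> x) \<in> p \<and> b = (p, germ p (s \<odot> x))" by simp
qed (use assms in \<open>auto simp: germ_rep_def\<close>)

lemma germ_rep_mult: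
  assumes s: "s \<in> carrier S" and t: "t \<in> carrier S"
  shows "germ_rep (s \<odot> t) = germ_rep t O germ_rep s"
proof (intro equalityI subrelI)
  fix a b assume "(a, b) \<in> germ_rep (s \<odot> t)"
  then obtain p x where px: "prime_filter p" "x \<in> carrier S" "sdom S (s \<odot> t \<odot> x) \<in> p"
    "a = (p, germ p x)" "b = (p, germ p (s \<odot> t \<odot> x))" by (rule germ_repE)
  have d: "sdom S (t \<odot> x) \<in> p" using sdom_mult_mem[of p s "t \<odot> x"] px s t by simp
  have "(a, (p, germ p (t \<odot> x))) \<in> germ_rep t"
    using d px by (auto simp: germ_rep_def)
  moreover have "((p, germ p (t \<odot> x)), b) \<in> germ_rep s"
    using px d s t by (simp add: germ_rep_at)
  ultimately show "(a, b) \<in> germ_rep t O germ_rep s" by blast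
next
  fix a b assume "(a, b) \<in> germ_rep t O germ_rep s"
  then obtain c where c: "(a, c) \<in> germ_rep t" "(c, b) \<in> germ_rep s" by blast
  from c(1) obtain p x where px: "prime_filter p" "x \<in> carrier S" "sdom S (t \<odot> x) \<in> p"
    "a = (p, germ p x)" "c = (p, germ p (t \<odot> x))" by (rule germ_repE)
  then have "sdom S (s \<odot> (t \<odot> x)) \<in> p" "b = (p, germ p (s \<odot> (t \<odot> x)))"
    using c(2) s t by (simp_all add: germ_rep_at)
  then show "(a, b) \<in> germ_rep (s \<odot> t)"
    using px s t by (auto simp: germ_rep_def)
qed

lemma germ_rep_pbij:
  assumes s: "s \<in> carrier S" shows "pbij (germ_rep s)"
proof (rule pbijI)
  fix a b c assume "(a, b) \<in> germ_rep s" "(a, c) \<in> germ_rep s"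
  then show "b = c"
    by (elim germ_repE) (metis germ_rep_at Pair_inject s sdom_mult_mem \<open>(a, b) \<in> germ_rep s\<close>)
next
  fix a b c assume "(a, c) \<in> germ_rep s" "(b, c) \<in> germ_rep s"
  then obtain p x y where px: "prime_filter p" "x \<in> carrier S" "sdom S (s \<odot> x) \<in> p"
    "a = (p, germ p x)" "c = (p, germ p (s \<odot> x))"
    and y: "y \<in> carrier S" "sdom S (s \<odot> y) \<in> p"
    "b = (p, germ p y)" "germ p (s \<odot> x) = germ p (s \<odot> y)"
    by (elim germ_repE) (metis prod.inject)
  then obtain e where e: "e \<in> p" "s \<odot> x \<odot> e = s \<odot> y \<odot> e"
    using germ_eq_iff[of p "s \<odot> x" "s \<odot> y"] s by auto
  have eI: "e \<in> Idp S" using e px prime_filter_Idp by blast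
  define f where "f = sdom S (s \<odot> x)" define g where "g = sdom S (s \<odot> y)"
  have fg: "f \<in> Idp S" "g \<in> Idp S" using s px y by (simp_all add: f_def g_def)
  \<comment> \<open>Cancelling \<open>s\<close> leaves \<open>sdom S s\<close> in front of
    \<open>x\<close> and \<open>y\<close>. Moved to the right it becomes \<open>f\<close> and
    \<open>g\<close>, which agree on \<open>e\<close>; so \<open>x\<close> and \<open>y\<close>
    agree on \<open>f \<odot> e\<close>, a member of \<open>p\<close>.\<close>
  have 1: "sdom S s \<odot> x = x \<odot> f" "sdom S s \<odot> y = y \<odot> g"
    using s px y sdom_left_mult[of s x] sdom_left_mult[of s y] by (simp_all add: f_def g_def)
  have 2: "sdom S s \<odot> x \<odot> e = sdom S s \<odot> y \<odot> e"
    using e(2) s px(2) y(1) eI by (simp add: sdom_def)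
  have 3: "f \<odot> e = g \<odot> e"
    using arg_cong[OF e(2), of "sdom S"] s px(2) y(1) eI
    by (simp del: smul_assoc add: sdom_mult_Idp f_def g_def)
  have "x \<odot> (f \<odot> e) = y \<odot> (g \<odot> e)" using 2 unfolding 1 using px(2) y(1) fg eI by simp
  then have "x \<odot> (f \<odot> e) = y \<odot> (f \<odot> e)" by (simp add: 3)
  moreover have "f \<odot> e \<in> p" using px e by (simp add: f_def prime_filter_mult)
  ultimately show "a = b"
    using germ_eq_iff[of p x y] px y sdom_mult_mem[OF _ s] by auto
qed

lemma germ_rep_zero: "germ_rep (szero S) = {}"
proof -
  have "sdom S (szero S) = szero S" by simp
  then show ?thesis by (auto simp: germ_rep_def dest: prime_filter_zero)
qed

lemma germ_rep_sinv: "s \<in> carrier S \<Longrightarrow> germ_rep (sinv S s) = (germ_rep s)\<inverse>"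
  by (rule pbij_converse_unique) (simp_all add: germ_rep_pbij germ_rep_mult[symmetric])

lemma germ_rep_sdom: "s \<in> carrier S \<Longrightarrow> germ_rep (sdom S s) = Id_on (Domain (germ_rep s))"
  by (simp add: sdom_def germ_rep_mult germ_rep_sinv pbij_comp_converse germ_rep_pbij)

lemma germ_rep_Idp: "e \<in> Idp S \<Longrightarrow> germ_rep e = Id_on (Domain (germ_rep e))"
  using germ_rep_sdom[of e] by simp

text \<open>Undo the conjugation: \<open>?k\<close> bounds \<open>e\<close> and \<open>f\<close>
  inside the range of \<open>x\<close>, so the distributive clause of \<open>is_join\<close>, with
  multiplier \<open>x \<odot> sinv S x\<close>, makes it bound \<open>j\<close> there. Conjugating
  once more gives the claim.\<close>

lemma is_join_conj:
  assumes j: "is_join e f j" and x [simp]: "x \<in> carrier S"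
    and g: "is_join (sinv S x \<odot> (e \<odot> x)) (sinv S x \<odot> (f \<odot> x)) g"
  shows "(sinv S x \<odot> (j \<odot> x)) \<odot> g = sinv S x \<odot> (j \<odot> x)"
proof -
  have [simp]: "e \<in> Idp S" "f \<in> Idp S" "j \<in> Idp S" "g \<in> Idp S" using j g by (simp_all add: is_join_def)
  let ?r = "x \<odot> sinv S x" and ?k = "x \<odot> (g \<odot> sinv S x)"
  have k: "?k \<in> Idp S" using conj_Idp[of "sinv S x" g] by simp
  have *: "?r \<odot> e \<odot> ?k = ?r \<odot> e" if [simp]: "e \<in> Idp S" and g: "(sinv S x \<odot> (e \<odot> x)) \<odot> g = sinv S x \<odot> (e \<odot> x)"
    for e
  proof -
    have "?r \<odot> e \<odot> ?k = x \<odot> (((sinv S x \<odot> (e \<odot> x)) \<odot> g) \<odot> sinv S x)" by simp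
    also have "\<dots> = ?r \<odot> (e \<odot> ?r)" unfolding g by simp
    also have "\<dots> = ?r \<odot> e" using Idp_commute[of e ?r] by simp
    finally show ?thesis .
  qed
  have "?r \<odot> j \<odot> ?k = ?r \<odot> j"
    using j k *[of e] *[of f] g unfolding is_join_def by (metis mult_sinv_Idp x)
  then have k2: "x \<odot> (sinv S x \<odot> (j \<odot> ?k)) = x \<odot> (sinv S x \<odot> j)" by simp
  have "x \<odot> g = x \<odot> (sdom S x \<odot> g)" by (simp add: sdom_def)
  also have "\<dots> = ?k \<odot> x" using Idp_commute[of g "sdom S x"] by (simp add: sdom_def)
  finally have xg: "x \<odot> g = ?k \<odot> x" .
  have "(sinv S x \<odot> (j \<odot> x)) \<odot> g = sinv S x \<odot> (j \<odot> (x \<odot> g))" by simp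
  also have "\<dots> = sinv S x \<odot> (x \<odot> (sinv S x \<odot> (j \<odot> ?k))) \<odot> x" unfolding xg by simp
  also have "\<dots> = sinv S x \<odot> (j \<odot> x)" unfolding k2 by simp
  finally show ?thesis .
qed

end

section \<open>Prime filters separate the elements of a Boolean inverse semigroup\<close>

context boolean_inverse_semigroup
begin

lemma meet_Idp_order:
  assumes [simp]: "e \<in> Idp S" "f \<in> Idp S" shows "e \<sqinter>\<^bsub>Idp_order S\<^esub> f = e \<odot> f"
proof -
  have "greatest (Idp_order S) z (Lower (Idp_order S) {e, f}) \<longleftrightarrow> z = e \<odot> f" for z
  proof -
    have L: "Lower (Idp_order S) {e, f} = {z \<in> Idp S. z \<odot> e = z \<and> z \<odot> f = z}"
      by (auto simp: Lower_def carrier_Idp_order le_Idp_order)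
    have ef: "e \<odot> f \<in> {z \<in> Idp S. z \<odot> e = z \<and> z \<odot> f = z}"
      using Idp_commute[of f e] by simp
    show ?thesis unfolding L greatest_def
    proof safe
      assume "z \<in> Idp S" "z \<odot> e = z" "z \<odot> f = z"
        "\<forall>x\<in>{z \<in> Idp S. z \<odot> e = z \<and> z \<odot> f = z}. x \<sqsubseteq>\<^bsub>Idp_order S\<^esub> z"
      then have "(e \<odot> f) \<odot> z = e \<odot> f" "z \<odot> e \<odot> f = z" using ef by (auto simp: le_Idp_order)
      then show "z = e \<odot> f" using Idp_commute[of "e \<odot> f" z] \<open>z \<in> Idp S\<close> by simp
    next
      fix z assume z: "z \<in> Idp S" "z \<odot> e = z" "z \<odot> f = z"
      then have "z \<odot> (e \<odot> f) = z" using smul_assoc[of z e f] by simp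
      then show "z \<sqsubseteq>\<^bsub>Idp_order S\<^esub> e \<odot> f" using z by (simp add: le_Idp_order)
    qed (use ef in \<open>auto simp: carrier_Idp_order\<close>)
  qed
  then show ?thesis by (simp add: meet_def Lattice.inf_def)
qed

lemma bottom_Idp_order: "\<bottom>\<^bsub>Idp_order S\<^esub> = szero S"
proof -
  interpret G: generalized_boolean_algebra "Idp_order S" by (rule Idp_boolean)
  have "\<bottom>\<^bsub>Idp_order S\<^esub> \<in> Idp S" "\<bottom>\<^bsub>Idp_order S\<^esub> \<sqsubseteq>\<^bsub>Idp_order S\<^esub> szero S"
    using G.bottom_closed G.bottom_lower[of "szero S"] by (simp_all add: carrier_Idp_order)
  then show ?thesis by (simp add: le_Idp_order)
qed

text \<open>The distributive law of the Boolean algebra supplies the clause of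
  \<open>is_join\<close> with the multiplier \<open>g\<close>.\<close>

lemma is_join_join:
  assumes e: "e \<in> Idp S" and f: "f \<in> Idp S" shows "is_join e f (e \<squnion>\<^bsub>Idp_order S\<^esub> f)"
proof -
  interpret G: generalized_boolean_algebra "Idp_order S" by (rule Idp_boolean)
  let ?L = "Idp_order S" let ?j = "e \<squnion>\<^bsub>?L\<^esub> f"
  note c = carrier_Idp_order
  have j: "?j \<in> Idp S" using G.join_closed e f by (simp add: c)
  have "e \<odot> ?j = e" "f \<odot> ?j = f"
    using G.join_left[of e f] G.join_right[of e f] e f j by (simp_all add: c le_Idp_order)
  moreover have "g \<odot> ?j \<odot> k = g \<odot> ?j"
    if "g \<in> Idp S" "k \<in> Idp S" "g \<odot> e \<odot> k = g \<odot> e" "g \<odot> f \<odot> k = g \<odot> f" for g k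
  proof -
    have "(g \<sqinter>\<^bsub>?L\<^esub> e) \<squnion>\<^bsub>?L\<^esub> (g \<sqinter>\<^bsub>?L\<^esub> f) \<sqsubseteq>\<^bsub>?L\<^esub> k"
      using that e f by (intro G.join_le) (simp_all add: c le_Idp_order meet_Idp_order)
    then have "g \<sqinter>\<^bsub>?L\<^esub> ?j \<sqsubseteq>\<^bsub>?L\<^esub> k"
      using G.meet_join_distrib[of g e f] that e f by (simp add: c)
    then show ?thesis using that j by (simp add: le_Idp_order meet_Idp_order)
  qed
  ultimately show ?thesis using e f j by (simp add: is_join_def)
qed

lemma is_join_complement:
  assumes "e \<in> Idp S" "f \<in> Idp S" "e \<odot> f = e"
  obtains c where "e \<odot> c = szero S" "is_join e c f"
proof -
  interpret G: generalized_boolean_algebra "Idp_order S" by (rule Idp_boolean)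
  obtain c where "c \<in> Idp S" "e \<sqinter>\<^bsub>Idp_order S\<^esub> c = szero S" "e \<squnion>\<^bsub>Idp_order S\<^esub> c = f"
    using G.section_complement[of e f] assms
    by (auto simp: carrier_Idp_order le_Idp_order bottom_Idp_order)
  then show ?thesis using that[of c] is_join_join[of e c] assms by (simp add: meet_Idp_order)
qed

text \<open>Cutting \<open>z\<close> down to the join \<open>?j\<close> of the two domains leaves an
  upper bound of \<open>x\<close> and \<open>y\<close>, so minimality of \<open>z\<close> gives
  \<open>z \<odot> ?j = z\<close>. Hence the domain of an orthogonal join is the join of the
  domains.\<close>

lemma orthogonal_joinE:
  assumes x: "x \<in> carrier S" and y: "y \<in> carrier S" and o: "orthogonal S x y"
  obtains z where "z \<in> carrier S" "z \<odot> sdom S x = x" "z \<odot> sdom S y = y"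
    "is_join (sdom S x) (sdom S y) (sdom S z)"
    "\<And>w. w \<in> carrier S \<Longrightarrow> w \<odot> sdom S x = x \<Longrightarrow> w \<odot> sdom S y = y \<Longrightarrow> w \<odot> sdom S z = z"
proof -
  obtain z where z: "least (natural_order S) z (Upper (natural_order S) {x, y})"
    using orthogonal_join[OF x y o] ..
  have U: "Upper (natural_order S) {x, y} =
    {w \<in> carrier S. w \<odot> sdom S x = x \<and> w \<odot> sdom S y = y}"
    using x y by (auto simp: Upper_def natural_order_def)
  have zc: "z \<in> carrier S" and zx: "z \<odot> sdom S x = x" and zy: "z \<odot> sdom S y = y"
    and least: "\<And>w. w \<in> carrier S \<Longrightarrow> w \<odot> sdom S x = x \<Longrightarrow> w \<odot> sdom S y = y \<Longrightarrow> w \<odot> sdom S z = z"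
    using z unfolding U least_def by (auto simp: le_natural_order)
  let ?j = "sdom S x \<squnion>\<^bsub>Idp_order S\<^esub> sdom S y"
  have j: "is_join (sdom S x) (sdom S y) ?j" using is_join_join x y by simp
  then have jI: "?j \<in> Idp S" by (simp add: is_join_def)
  have "sdom S x \<odot> sdom S z = sdom S x" "sdom S y \<odot> sdom S z = sdom S y"
    using sdom_mult_Idp[of z "sdom S x"] sdom_mult_Idp[of z "sdom S y"] zx zy zc x y
      Idp_commute[of "sdom S z"] by simp_all
  then have 1: "?j \<odot> sdom S z = ?j" using is_join_least[OF j] zc by simp
  have "?j \<odot> sdom S x = sdom S x" "?j \<odot> sdom S y = sdom S y"
    using j Idp_commute[OF jI] x y by (simp_all add: is_join_def)
  then have "z \<odot> ?j \<odot> sdom S z = z"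
    using zc jI zx zy x y by (intro least) simp_all
  then have "z \<odot> ?j = z" using 1 zc jI by simp
  then have "sdom S z = sdom S z \<odot> ?j" using sdom_mult_Idp[of z ?j] zc jI by simp
  also have "\<dots> = ?j" using 1 Idp_commute[of "sdom S z" ?j] zc jI by simp
  finally show ?thesis using that zc zx zy least j by simp
qed

text \<open>At the germ of \<open>x\<close> over \<open>p\<close>, the idempotent \<open>j\<close>
  is defined iff \<open>sinv S x \<odot> (j \<odot> x)\<close> belongs to \<open>p\<close>. By
  \<open>is_join_conj\<close> this element lies below a join of the conjugates of \<open>e\<close>
  and \<open>f\<close>, and \<open>p\<close> is prime.\<close>

lemma Domain_germ_rep_join:
  assumes j: "is_join e f j"
  shows "Domain (germ_rep j) = Domain (germ_rep e) \<union> Domain (germ_rep f)"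
proof -
  have [simp]: "e \<in> Idp S" "f \<in> Idp S" "j \<in> Idp S" using j by (simp_all add: is_join_def)
  have sub: "Domain (germ_rep e) \<subseteq> Domain (germ_rep j)" if "e \<in> Idp S" "e \<odot> j = e" for e
  proof -
    have "Domain (germ_rep e) = Domain (germ_rep j O germ_rep e)"
      using germ_rep_mult[of e j] that by simp
    then show ?thesis by blast
  qed
  have "a \<in> Domain (germ_rep e) \<union> Domain (germ_rep f)" if "a \<in> Domain (germ_rep j)" for a
  proof -
    from that obtain p x where px: "prime_filter p" "x \<in> carrier S" "sdom S (j \<odot> x) \<in> p"
      "a = (p, germ p x)" by (auto simp: germ_rep_def)
    let ?e = "sinv S x \<odot> (e \<odot> x)" and ?f = "sinv S x \<odot> (f \<odot> x)"
    obtain g where g: "is_join ?e ?f g"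
      using is_join_join[of ?e ?f] conj_Idp px by auto
    have "sinv S x \<odot> (j \<odot> x) \<in> p" using px by (simp add: sdom_mult)
    then have "g \<in> p"
      using is_join_conj[OF j _ g] px(1,2) g prime_filter_up unfolding is_join_def by metis
    then have "?e \<in> p \<or> ?f \<in> p" using px g prime_filter_join by blast
    then have "sdom S (e \<odot> x) \<in> p \<or> sdom S (f \<odot> x) \<in> p" using px by (simp add: sdom_mult)
    then show ?thesis using px germ_repI[of p x e] germ_repI[of p x f] by blast
  qed
  then show ?thesis using sub[of e] sub[of f] j by (auto simp: is_join_def)
qed

text \<open>Prime ideal theorem. There need not be a greatest idempotent, so the argument takes
  place below \<open>u\<close>: a maximal ideal \<open>J\<close> that contains \<open>I\<close> and
  omits \<open>u\<close> contains each \<open>e\<close> below \<open>u\<close> or its complement in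
  \<open>u\<close>. The filter consists of the idempotents whose part below \<open>u\<close> lies
  outside \<open>J\<close>.\<close>

lemma prime_filter_exists:
  assumes u: "u \<in> Idp S" and I: "I \<subseteq> {e \<in> Idp S. e \<odot> u = e}" "szero S \<in> I" "u \<notin> I"
    and down: "\<And>e f. e \<in> I \<Longrightarrow> f \<in> Idp S \<Longrightarrow> e \<odot> f \<in> I"
    and join: "\<And>e f j. e \<in> I \<Longrightarrow> f \<in> I \<Longrightarrow> is_join e f j \<Longrightarrow> j \<in> I"
  obtains p where "prime_filter p" "u \<in> p" "p \<inter> I = {}"
proof -
  define \<J> where "\<J> = {J. I \<subseteq> J \<and> J \<subseteq> {e \<in> Idp S. e \<odot> u = e} \<and> u \<notin> J \<and>
    (\<forall>e\<in>J. \<forall>f\<in>Idp S. e \<odot> f \<in> J) \<and> (\<forall>e\<in>J. \<forall>f\<in>J. \<forall>j. is_join e f j \<longrightarrow> j \<in> J)}"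
  have "\<exists>M\<in>\<J>. \<forall>X\<in>\<J>. M \<subseteq> X \<longrightarrow> X = M"
  proof (rule subset_Zorn_nonempty)
    have "I \<in> \<J>" unfolding \<J>_def using I down join by blast
    then show "\<J> \<noteq> {}" by blast
  next
    fix C assume C: "C \<noteq> {}" "subset.chain \<J> C"
    then have CJ: "C \<subseteq> \<J>" and chain: "\<And>X Y. X \<in> C \<Longrightarrow> Y \<in> C \<Longrightarrow> X \<subseteq> Y \<or> Y \<subseteq> X"
      by (auto simp: subset.chain_def)
    have "j \<in> \<Union>C" if "e \<in> \<Union>C" "f \<in> \<Union>C" "is_join e f j" for e f j
    proof -
      obtain X Y where "X \<in> C" "e \<in> X" "Y \<in> C" "f \<in> Y" using \<open>e \<in> \<Union>C\<close> \<open>f \<in> \<Union>C\<close> by blast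
      then obtain Z where "Z \<in> C" "e \<in> Z" "f \<in> Z" using chain by blast
      moreover have "Z \<in> \<J>" using \<open>Z \<in> C\<close> CJ by blast
      ultimately have "j \<in> Z" using that(3) unfolding \<J>_def by blast
      then show ?thesis using \<open>Z \<in> C\<close> by blast
    qed
    moreover have "I \<subseteq> \<Union>C" using C(1) CJ unfolding \<J>_def by blast
    moreover have "\<forall>e\<in>\<Union>C. \<forall>f\<in>Idp S. e \<odot> f \<in> \<Union>C" using CJ unfolding \<J>_def by blast
    moreover have "\<Union>C \<subseteq> {e \<in> Idp S. e \<odot> u = e}" "u \<notin> \<Union>C" using CJ unfolding \<J>_def by blast+
    ultimately show "\<Union>C \<in> \<J>" unfolding \<J>_def by blast
  qed
  then obtain J where J: "J \<in> \<J>" and max: "\<And>X. X \<in> \<J> \<Longrightarrow> J \<subseteq> X \<Longrightarrow> X = J" by blast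
  have JI: "I \<subseteq> J" and Ju: "\<And>e. e \<in> J \<Longrightarrow> e \<in> Idp S \<and> e \<odot> u = e" and uJ: "u \<notin> J"
    and Jdown: "\<And>e f. e \<in> J \<Longrightarrow> f \<in> Idp S \<Longrightarrow> e \<odot> f \<in> J"
    and Jjoin: "\<And>e f j. e \<in> J \<Longrightarrow> f \<in> J \<Longrightarrow> is_join e f j \<Longrightarrow> j \<in> J"
    using J unfolding \<J>_def by blast+
  have Jle: "f \<in> J" if "e \<in> J" "f \<in> Idp S" "f \<odot> e = f" for e f
    using Jdown[OF that(1,2)] that Ju Idp_commute by metis
  \<comment> \<open>maximality: the ideal generated by \<open>J\<close> and \<open>e\<close> contains \<open>u\<close>\<close>
  have comp: "c \<in> J" if e: "e \<in> Idp S" "e \<odot> u = e" "e \<notin> J" and c: "e \<odot> c = szero S" "is_join e c u" for e c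
  proof -
    define X where "X = {g \<in> Idp S. g \<odot> u = g \<and> (\<exists>a\<in>J. \<exists>b. is_join a e b \<and> g \<odot> b = g)}"
    have zJ: "szero S \<in> J" using JI I by blast
    have "J \<subseteq> X"
    proof
      fix a assume a: "a \<in> J"
      then have "is_join a e (a \<squnion>\<^bsub>Idp_order S\<^esub> e)" using is_join_join Ju e by blast
      then show "a \<in> X" using a Ju unfolding X_def is_join_def by blast
    qed
    have eX: "e \<in> X"
    proof -
      have "is_join (szero S) e (szero S \<squnion>\<^bsub>Idp_order S\<^esub> e)" using is_join_join zJ Ju e by blast
      then show "e \<in> X" using zJ e unfolding X_def is_join_def by blast
    qed
    have "u \<in> X"
    proof (rule ccontr)
      assume "u \<notin> X"
      have "X \<in> \<J>" unfolding \<J>_def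
      proof (intro CollectI conjI ballI allI impI)
        show "I \<subseteq> X" using JI \<open>J \<subseteq> X\<close> by blast
        show "X \<subseteq> {e \<in> Idp S. e \<odot> u = e}" by (auto simp: X_def)
        show "u \<notin> X" by fact
      next
        fix g f assume "g \<in> X" and f: "f \<in> Idp S"
        then obtain a b where g: "g \<in> Idp S" "g \<odot> u = g" "a \<in> J" "is_join a e b" "g \<odot> b = g"
          by (auto simp: X_def)
        have bI: "b \<in> Idp S" using g by (simp add: is_join_def)
        have "g \<odot> f \<odot> u = g \<odot> f" "g \<odot> f \<odot> b = g \<odot> f"
          using mult_absorb_commute g f u bI by (meson Idp_closed)+
        then show "g \<odot> f \<in> X" using g f unfolding X_def by (blast intro: Idp_mult)
      next
        fix g f j assume "g \<in> X" "f \<in> X" and j: "is_join g f j"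
        then obtain a b a' b' where g: "g \<in> Idp S" "g \<odot> u = g" "a \<in> J" "is_join a e b" "g \<odot> b = g"
          and f: "f \<in> Idp S" "f \<odot> u = f" "a' \<in> J" "is_join a' e b'" "f \<odot> b' = f"
          by (auto simp: X_def)
        define a2 where "a2 = a \<squnion>\<^bsub>Idp_order S\<^esub> a'"
        have a2: "is_join a a' a2" using is_join_join Ju g f by (simp add: a2_def)
        then have a2J: "a2 \<in> J" using g f Jjoin by blast
        define b2 where "b2 = a2 \<squnion>\<^bsub>Idp_order S\<^esub> e"
        have b2: "is_join a2 e b2" using is_join_join Ju a2J e by (simp add: b2_def)
        have I2: "a2 \<in> Idp S" "b2 \<in> Idp S" "b \<in> Idp S" "b' \<in> Idp S" "a \<in> Idp S" "a' \<in> Idp S" "j \<in> Idp S"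
          using b2 g f j a2 by (simp_all add: is_join_def)
        have "a \<odot> b2 = a" "a' \<odot> b2 = a'"
          using a2 b2 I2 unfolding is_join_def by (metis Idp_closed mult_absorb_trans)+
        then have "b \<odot> b2 = b" "b' \<odot> b2 = b'"
          using is_join_least[OF g(4)] is_join_least[OF f(4)] b2 I2 by (auto simp: is_join_def)
        then have "g \<odot> b2 = g" "f \<odot> b2 = f"
          using g f I2 by (metis Idp_closed mult_absorb_trans)+
        then have "j \<odot> b2 = j" "j \<odot> u = j" using is_join_least[OF j] I2 g f u by auto
        then show "j \<in> X" using a2J b2 I2 unfolding X_def by blast
      qed
      then have "X = J" using max \<open>J \<subseteq> X\<close> by blast
      then show False using eX e by blast
    qed
    then obtain a b where ab: "a \<in> J" "is_join a e b" "u \<odot> b = u" by (auto simp: X_def)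
    have cI: "c \<in> Idp S" "c \<odot> u = c" and aI: "a \<in> Idp S" and bI: "b \<in> Idp S"
      using c ab by (simp_all add: is_join_def)
    have "c \<odot> b \<odot> a = c \<odot> b"
    proof -
      have "c \<odot> a \<odot> a = c \<odot> a" "c \<odot> e \<odot> a = c \<odot> e"
        using cI aI e c Idp_commute[of c e] by simp_all
      then show ?thesis using ab(2) cI aI unfolding is_join_def by blast
    qed
    moreover have "c \<odot> b = c" using cI ab(3) bI u by (metis Idp_closed mult_absorb_trans)
    ultimately have "c \<odot> a = c" by simp
    then show "c \<in> J" using Jle ab(1) cI by blast
  qed
  define p where "p = {e \<in> Idp S. e \<odot> u \<notin> J}"
  have prime: "e \<odot> f \<in> p" if "e \<in> p" "f \<in> p" for e f
  proof (rule ccontr)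
    assume n: "e \<odot> f \<notin> p"
    have ef: "e \<in> Idp S" "f \<in> Idp S" "e \<odot> u \<notin> J" "f \<odot> u \<notin> J" using that by (auto simp: p_def)
    then have "e \<odot> f \<odot> u \<in> J" using n by (simp add: p_def)
    obtain c where c: "e \<odot> u \<odot> c = szero S" "is_join (e \<odot> u) c u"
      using is_join_complement[of "e \<odot> u" u] ef u by auto
    have cJ: "c \<in> J" using comp[of "e \<odot> u" c] ef u c by simp
    \<comment> \<open>\<open>f \<odot> u\<close> is the join of \<open>e \<odot> f \<odot> u\<close> and \<open>f \<odot> u \<odot> c\<close>, both in \<open>J\<close>\<close>
    have J2: "f \<odot> u \<odot> c \<in> J" using Jdown[OF cJ, of "f \<odot> u"] ef u Ju[OF cJ] Idp_commute[of c "f \<odot> u"] by simp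
    obtain k where k: "is_join (e \<odot> f \<odot> u) (f \<odot> u \<odot> c) k"
      using is_join_join[of "e \<odot> f \<odot> u" "f \<odot> u \<odot> c"] ef u Ju[OF cJ] by auto
    have kJ: "k \<in> J" using Jjoin[OF \<open>e \<odot> f \<odot> u \<in> J\<close> J2 k] .
    have kI: "k \<in> Idp S" using k by (simp add: is_join_def)
    have 1: "(f \<odot> u) \<odot> (e \<odot> u) \<odot> k = (f \<odot> u) \<odot> (e \<odot> u)"
    proof -
      have "(f \<odot> u) \<odot> (e \<odot> u) = e \<odot> f \<odot> u"
        using ef u Idp_commute_left[of u e u] Idp_commute_left[of f e u] by simp
      then show ?thesis using k by (simp add: is_join_def)
    qed
    have 2: "(f \<odot> u) \<odot> c \<odot> k = (f \<odot> u) \<odot> c" using k by (simp add: is_join_def)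
    have "(f \<odot> u) \<odot> u \<odot> k = (f \<odot> u) \<odot> u"
      by (rule is_join_distrib[OF c(2) _ kI 1 2]) (use ef u in simp)
    then have "(f \<odot> u) \<odot> k = f \<odot> u" using ef u kI by simp
    then show False using Jle[OF kJ, of "f \<odot> u"] ef u by simp
  qed
  have "prime_filter p" unfolding prime_filter_def
  proof (intro conjI ballI allI impI)
    show "p \<subseteq> Idp S" by (auto simp: p_def)
    show "szero S \<notin> p" using JI I(2) u by (auto simp: p_def)
    show "e \<odot> f \<in> p" if "e \<in> p" "f \<in> p" for e f using prime that .
  next
    fix e f assume e: "e \<in> p" and f: "f \<in> Idp S" "e \<odot> f = e"
    then have eI: "e \<in> Idp S" "e \<odot> u \<notin> J" by (auto simp: p_def)
    have "f \<odot> e = e" using f eI Idp_commute by metis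
    then have "f \<odot> u \<odot> e = e \<odot> u"
      using mult_eq_left[of f e e u] f eI u Idp_commute[of u e] by simp
    then have "f \<odot> u \<notin> J" using eI Jdown[of "f \<odot> u" e] by auto
    then show "f \<in> p" using f by (simp add: p_def)
  next
    fix e f j assume j: "is_join e f j" and "j \<in> p"
    then have jI: "j \<in> Idp S" "j \<odot> u \<notin> J" and ef: "e \<in> Idp S" "f \<in> Idp S" by (auto simp: p_def is_join_def)
    show "e \<in> p \<or> f \<in> p"
    proof (rule ccontr)
      assume "\<not> (e \<in> p \<or> f \<in> p)"
      then have J: "e \<odot> u \<in> J" "f \<odot> u \<in> J" using ef by (auto simp: p_def)
      obtain k where k: "is_join (e \<odot> u) (f \<odot> u) k" using is_join_join[of "e \<odot> u" "f \<odot> u"] ef u by auto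
      have kI: "k \<in> Idp S" using k by (simp add: is_join_def)
      have "u \<odot> e \<odot> k = u \<odot> e" "u \<odot> f \<odot> k = u \<odot> f"
        using k Idp_commute[of u e] Idp_commute[of u f] ef u by (simp_all add: is_join_def)
      then have "u \<odot> j \<odot> k = u \<odot> j" using j u kI unfolding is_join_def by blast
      then have "j \<odot> u \<odot> k = j \<odot> u" using Idp_commute[of u j] jI u by simp
      then have "j \<odot> u \<in> J" using Jle[OF Jjoin[OF J k], of "j \<odot> u"] jI u by simp
      then show False using jI by blast
    qed
  qed
  moreover have "u \<in> p" using u uJ by (simp add: p_def)
  moreover have "p \<inter> I = {}"
  proof -
    have "e \<notin> p" if "e \<in> I" for e
    proof -
      have "e \<odot> u = e" using I(1) that by blast
      then show ?thesis using JI that by (auto simp: p_def)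
    qed
    then show ?thesis by blast
  qed
  ultimately show ?thesis using that by blast
qed

text \<open>The idempotents below \<open>sdom S x\<close> on which \<open>x\<close> and
  \<open>y\<close> agree form an ideal \<open>I\<close>. If \<open>x\<close> were not below
  \<open>y\<close>, then \<open>sdom S x\<close> would lie outside \<open>I\<close>, and a prime
  filter that contains \<open>sdom S x\<close> and avoids \<open>I\<close> would carry a point at
  which \<open>germ_rep y\<close> does not follow \<open>germ_rep x\<close>.\<close>

lemma germ_rep_le:
  assumes x: "x \<in> carrier S" and y: "y \<in> carrier S" and le: "germ_rep x \<subseteq> germ_rep y"
  shows "x = y \<odot> sdom S x"
proof (rule ccontr)
  assume n: "x \<noteq> y \<odot> sdom S x"
  define I where "I = {e \<in> Idp S. e \<odot> sdom S x = e \<and> x \<odot> e = y \<odot> e}"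
  \<comment> \<open>Any \<open>w\<close> that agrees with \<open>x\<close> on orthogonal
    \<open>e\<close> and \<open>f\<close> restricts on \<open>j\<close> to the orthogonal join of
    \<open>x \<odot> e\<close> and \<open>x \<odot> f\<close>; both \<open>x\<close> and
    \<open>y\<close> are such \<open>w\<close>.\<close>
  have join1: "j \<in> I" if e: "e \<in> I" "f \<in> I" and j: "is_join e f j" and o: "e \<odot> f = szero S" for e f j
  proof -
    have ef: "e \<in> Idp S" "f \<in> Idp S" "j \<in> Idp S" "e \<odot> j = e" "f \<odot> j = f"
      and eq: "e \<odot> sdom S x = e" "x \<odot> e = y \<odot> e" "f \<odot> sdom S x = f" "x \<odot> f = y \<odot> f"
      using that by (auto simp: I_def is_join_def)
    have jd: "j \<odot> sdom S x = j" using is_join_least[OF j] x eq by simp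
    have "orthogonal S (x \<odot> e) (x \<odot> f)"
    proof -
      have "sinv S (x \<odot> e) \<odot> (x \<odot> f) = e \<odot> sdom S x \<odot> f"
        using ef x by (simp add: sinv_mult sdom_def)
      also have "\<dots> = szero S" using eq o by simp
      finally have 1: "sinv S (x \<odot> e) \<odot> (x \<odot> f) = szero S" .
      have "(x \<odot> e) \<odot> sinv S (x \<odot> f) = x \<odot> ((e \<odot> f) \<odot> sinv S x)"
        using ef x by (simp add: sinv_mult)
      also have "\<dots> = szero S" using o x by simp
      finally show ?thesis using 1 by (simp add: orthogonal_def)
    qed
    then obtain z where z: "z \<in> carrier S" "is_join (sdom S (x \<odot> e)) (sdom S (x \<odot> f)) (sdom S z)"
      and u: "\<And>w. w \<in> carrier S \<Longrightarrow> w \<odot> sdom S (x \<odot> e) = x \<odot> e \<Longrightarrow>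
        w \<odot> sdom S (x \<odot> f) = x \<odot> f \<Longrightarrow> w \<odot> sdom S z = z"
      using orthogonal_joinE[of "x \<odot> e" "x \<odot> f"] ef x by (metis Idp_closed smul_closed)
    have de: "sdom S (x \<odot> e) = e" "sdom S (x \<odot> f) = f"
      using ef x eq(1,3) Idp_commute[of "sdom S x" e] Idp_commute[of "sdom S x" f]
      by (simp_all add: sdom_mult_Idp)
    have *: "z = w \<odot> j" if w: "w \<in> carrier S" "w \<odot> e = x \<odot> e" "w \<odot> f = x \<odot> f" for w
    proof -
      have je: "j \<odot> e = e" "j \<odot> f = f" using ef Idp_commute by metis+
      have "j \<odot> sdom S z = j"
        using is_join_least[OF j, of "sdom S z"] z de by (simp add: is_join_def)
      have "(w \<odot> j) \<odot> sdom S z = z"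
        using w ef je by (intro u) (simp_all add: de)
      then show ?thesis using \<open>j \<odot> sdom S z = j\<close> w ef z by simp
    qed
    have "x \<odot> j = y \<odot> j" using *[of x] *[of y] x y eq by simp
    then show "j \<in> I" using ef jd by (simp add: I_def)
  qed
  have down: "e \<odot> f \<in> I" if "e \<in> I" "f \<in> Idp S" for e f
  proof -
    have e: "e \<in> Idp S" "e \<odot> sdom S x = e" "x \<odot> e = y \<odot> e" using that by (auto simp: I_def)
    have "e \<odot> f \<odot> sdom S x = e \<odot> f"
      using mult_absorb_commute e that x by (meson Idp_closed sdom_Idp)
    moreover have "x \<odot> (e \<odot> f) = y \<odot> (e \<odot> f)"
      using mult_eq_left[OF e(3), of f] e that x y by simp
    ultimately show ?thesis using e that by (simp add: I_def)
  qed
  have join: "j \<in> I" if e: "e \<in> I" "f \<in> I" and j: "is_join e f j" for e f j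
  proof -
    have ef: "e \<in> Idp S" "f \<in> Idp S" "j \<in> Idp S" using that by (auto simp: I_def is_join_def)
    \<comment> \<open>Replacing \<open>f\<close> by the complement \<open>c\<close> of
      \<open>e \<odot> f\<close> in \<open>f\<close> keeps the join with \<open>e\<close> and makes
      the two idempotents orthogonal.\<close>
    obtain c where c: "(e \<odot> f) \<odot> c = szero S" "is_join (e \<odot> f) c f"
      using is_join_complement[of "e \<odot> f" f] ef by auto
    have cI: "c \<in> Idp S" "c \<odot> f = c" using c by (simp_all add: is_join_def)
    have cI': "f \<odot> c = c" using cI ef Idp_commute by metis
    then have "c \<in> I" using down[OF e(2) cI(1)] by simp
    have o: "e \<odot> c = szero S" using c(1) cI' cI(1) ef(1,2) by simp
    have "is_join e c j" unfolding is_join_def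
    proof (intro conjI ballI impI)
      show "e \<odot> j = e" using j by (simp add: is_join_def)
      have "f \<odot> j = f" using j by (simp add: is_join_def)
      then show "c \<odot> j = c" using cI ef by (metis Idp_closed mult_absorb_trans)
    next
      fix g k assume gk: "g \<in> Idp S" "k \<in> Idp S" "g \<odot> e \<odot> k = g \<odot> e" "g \<odot> c \<odot> k = g \<odot> c"
      have "g \<odot> (e \<odot> f) \<odot> k = g \<odot> (e \<odot> f)"
      proof -
        have "g \<odot> (e \<odot> f) \<odot> k = g \<odot> e \<odot> k \<odot> f" using gk(1,2) ef Idp_commute[of f k] by simp
        also have "\<dots> = g \<odot> e \<odot> f" by (simp only: gk(3))
        also have "\<dots> = g \<odot> (e \<odot> f)" using gk(1) ef by simp
        finally show ?thesis .
      qed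
      then have "g \<odot> f \<odot> k = g \<odot> f" using c(2) gk unfolding is_join_def by blast
      then show "g \<odot> j \<odot> k = g \<odot> j" using gk j unfolding is_join_def by blast
    qed (use ef cI in auto)
    then show ?thesis using join1 e(1) \<open>c \<in> I\<close> o by blast
  qed
  have I: "szero S \<in> I" "sdom S x \<notin> I" "I \<subseteq> {e \<in> Idp S. e \<odot> sdom S x = e}"
    using n x y by (auto simp: I_def)
  obtain p where p: "prime_filter p" "sdom S x \<in> p" "p \<inter> I = {}"
    by (rule prime_filter_exists[OF sdom_Idp[OF x] I(3,1,2)]) (erule (1) down | erule (2) join | blast)+
  have "((p, germ p (sdom S x)), (p, germ p x)) \<in> germ_rep x"
    using germ_rep_at[of x "sdom S x" p] x p by simp
  then have "((p, germ p (sdom S x)), (p, germ p x)) \<in> germ_rep y" using le by blast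
  then have d: "sdom S (y \<odot> sdom S x) \<in> p" and "germ p x = germ p (y \<odot> sdom S x)"
    using germ_rep_at[of y "sdom S x" p] x y p by simp_all
  then obtain e where e: "e \<in> p" "x \<odot> e = y \<odot> sdom S x \<odot> e"
    using germ_eq_iff[of p x "y \<odot> sdom S x"] p x y by auto
  have eI: "e \<in> Idp S" using e p prime_filter_Idp by blast
  have "sdom S x \<odot> e \<in> I"
  proof -
    have "x \<odot> (sdom S x \<odot> e) = x \<odot> e"
      using mult_eq_left[OF mult_sdom[OF x], of e] x eI by simp
    moreover have "y \<odot> (sdom S x \<odot> e) = x \<odot> e" using e(2) x y eI by simp
    moreover have "sdom S x \<odot> e \<odot> sdom S x = sdom S x \<odot> e" using mult_absorb_commute[of "sdom S x" "sdom S x" e] x eI by simp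
    ultimately show ?thesis using x eI by (simp add: I_def)
  qed
  moreover have "sdom S x \<odot> e \<in> p" using p e prime_filter_mult by blast
  ultimately show False using p by blast
qed

lemma germ_rep_inj: "inj_on germ_rep (carrier S)"
proof (rule inj_onI)
  fix x y assume xy: "x \<in> carrier S" "y \<in> carrier S" "germ_rep x = germ_rep y"
  then have 1: "x = y \<odot> sdom S x" "y = x \<odot> sdom S y" using germ_rep_le by blast+
  have "sdom S x = sdom S y \<odot> sdom S x" "sdom S y = sdom S x \<odot> sdom S y"
    using sdom_mult_Idp[of y "sdom S x"] sdom_mult_Idp[of x "sdom S y"] 1 xy by simp_all
  then have "sdom S x = sdom S y" using Idp_commute[of "sdom S x" "sdom S y"] xy by simp
  then show "x = y" using 1 xy by simp
qed

lemma rel_bias_germ_rep: "rel_bias (germ_rep ` carrier S)"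
proof
  fix r assume "r \<in> germ_rep ` carrier S"
  then show "pbij r" "r\<inverse> \<in> germ_rep ` carrier S"
    by (auto simp: germ_rep_pbij germ_rep_sinv[symmetric])
next
  show "{} \<in> germ_rep ` carrier S" using germ_rep_zero szero_closed by (metis imageI)
next
  fix r s assume "r \<in> germ_rep ` carrier S" "s \<in> germ_rep ` carrier S"
  then obtain x y where x: "x \<in> carrier S" "r = germ_rep x" and y: "y \<in> carrier S" "s = germ_rep y" by blast
  show "r O s \<in> germ_rep ` carrier S" using x y germ_rep_mult[of y x] by (metis imageI smul_closed)
  \<comment> \<open>The complement of \<open>sdom S x \<odot> sdom S y\<close> in
    \<open>sdom S x\<close> represents the difference of the two domains:
    \<open>Domain_germ_rep_join\<close> turns the algebraic complement into the set-theoretic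
    one.\<close>
  obtain c where c: "sdom S x \<odot> sdom S y \<odot> c = szero S" "is_join (sdom S x \<odot> sdom S y) c (sdom S x)"
    using is_join_complement[of "sdom S x \<odot> sdom S y" "sdom S x"] x y Idp_commute[of "sdom S y" "sdom S x"]
    by auto
  have cI: "c \<in> Idp S" "c \<odot> sdom S x = c" using c by (simp_all add: is_join_def)
  have dx: "germ_rep (sdom S x) = Id_on (Domain r)" "germ_rep (sdom S y) = Id_on (Domain s)"
    using x y germ_rep_sdom by simp_all
  have "Domain (germ_rep (sdom S x)) = Domain (germ_rep (sdom S x \<odot> sdom S y)) \<union> Domain (germ_rep c)"
    by (rule Domain_germ_rep_join[OF c(2)])
  then have 1: "Domain r = Domain r \<inter> Domain s \<union> Domain (germ_rep c)"
  proof -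
    have "Id_on (Domain s) O Id_on (Domain r) = Id_on (Domain r \<inter> Domain s)" by auto
    then show ?thesis
      using x(1) y(1) \<open>Domain (germ_rep (sdom S x)) = _\<close> by (simp add: germ_rep_mult dx)
  qed
  obtain C where C: "germ_rep c = Id_on C" using germ_rep_Idp cI by blast
  have "germ_rep (sdom S x \<odot> sdom S y \<odot> c) = {}" unfolding c(1) by (rule germ_rep_zero)
  then have "Domain r \<inter> Domain s \<inter> C = {}"
  proof -
    have "Id_on C O Id_on (Domain s) O Id_on (Domain r) = Id_on (Domain r \<inter> Domain s \<inter> C)" by auto
    then have "Id_on (Domain r \<inter> Domain s \<inter> C) = {}"
      using x(1) y(1) cI \<open>germ_rep (sdom S x \<odot> sdom S y \<odot> c) = {}\<close>
      by (simp del: smul_assoc add: germ_rep_mult dx C O_assoc)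
    then show ?thesis by (metis Domain_Id_on Domain_empty)
  qed
  then have "C = Domain r - Domain s" using 1 unfolding C Domain_Id_on by blast
  then show "Id_on (Domain r - Domain s) \<in> germ_rep ` carrier S" using C cI by (metis Idp_closed imageI)
  assume d: "Domain r \<inter> Domain s = {}" "Range r \<inter> Range s = {}"
  have "germ_rep (sinv S x \<odot> y) = {}" "germ_rep (x \<odot> sinv S y) = {}"
    using x y d by (auto simp: germ_rep_mult germ_rep_sinv)
  then have "orthogonal S x y"
    using x y germ_rep_inj germ_rep_zero unfolding orthogonal_def inj_on_def by simp
  \<comment> \<open>\<open>z\<close> restricts to \<open>x\<close> and to \<open>y\<close> on their
    domains, and by \<open>Domain_germ_rep_join\<close> it is defined nowhere else, so its relation
    is the union.\<close>
  then obtain z where z: "z \<in> carrier S" "z \<odot> sdom S x = x" "z \<odot> sdom S y = y"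
    "is_join (sdom S x) (sdom S y) (sdom S z)"
    using orthogonal_joinE[OF x(1) y(1)] by blast
  have "Domain (germ_rep (sdom S z)) = Domain (germ_rep (sdom S x)) \<union> Domain (germ_rep (sdom S y))"
    by (rule Domain_germ_rep_join[OF z(4)])
  then have "Domain (germ_rep z) = Domain r \<union> Domain s"
    using z(1) by (simp add: dx germ_rep_sdom)
  moreover have "Id_on (Domain r) O germ_rep z = r" "Id_on (Domain s) O germ_rep z = s"
    using x y z germ_rep_mult[of z "sdom S x"] germ_rep_mult[of z "sdom S y"] by (simp_all add: dx)
  moreover have "Id_on D O germ_rep z = {(a, b). a \<in> D \<and> (a, b) \<in> germ_rep z}" for D by auto
  ultimately have "r = {(a, b). a \<in> Domain r \<and> (a, b) \<in> germ_rep z}"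
    "s = {(a, b). a \<in> Domain s \<and> (a, b) \<in> germ_rep z}"
    and dz: "Domain (germ_rep z) = Domain r \<union> Domain s" by simp_all
  then have "r \<union> s = {(a, b). a \<in> Domain r \<and> (a, b) \<in> germ_rep z} \<union>
    {(a, b). a \<in> Domain s \<and> (a, b) \<in> germ_rep z}" by argo
  also have "\<dots> = germ_rep z" using dz by blast
  finally have "r \<union> s = germ_rep z" .
  then show "r \<union> s \<in> germ_rep ` carrier S" using z by blast
qed

theorem rel_representation_germ_rep: "rel_representation S germ_rep (germ_rep ` carrier S)"
proof (intro rel_representation.intro rel_representation_axioms.intro rel_bias_germ_rep)
qed (simp_all add: germ_rep_inj germ_rep_mult germ_rep_zero)

end

section \<open>Homomorphisms between biases of partial bijections\<close>

text \<open>All operations of the similarity type are listed, so that such maps commute with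
  \<open>rel_eval\<close>; orthogonal unions are covered as values of
  \<open>rel_skew\<close>.\<close>

definition rel_hom :: "('x \<times> 'x) set set \<Rightarrow> (('x \<times> 'x) set \<Rightarrow> ('y \<times> 'y) set) \<Rightarrow> bool" where
  "rel_hom A \<Phi> \<longleftrightarrow> \<Phi> {} = {} \<and> (\<forall>r\<in>A. \<Phi> (r\<inverse>) = (\<Phi> r)\<inverse>) \<and>
     (\<forall>r\<in>A. \<forall>s\<in>A. \<Phi> (r O s) = \<Phi> r O \<Phi> s \<and> \<Phi> (rel_diff r s) = rel_diff (\<Phi> r) (\<Phi> s) \<and>
        \<Phi> (rel_skew r s) = rel_skew (\<Phi> r) (\<Phi> s))"

lemma rel_satI:
  assumes "\<And>l r v. (l, r) \<in> E \<Longrightarrow> range v \<subseteq> A \<Longrightarrow> rel_eval v l = rel_eval v r"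
  shows "rel_sat A E"
  using assms by (auto simp: rel_sat_def)

lemma rel_satD: "rel_sat A E \<Longrightarrow> (l, r) \<in> E \<Longrightarrow> range v \<subseteq> A \<Longrightarrow> rel_eval v l = rel_eval v r"
  by (auto simp: rel_sat_def)

lemma (in rel_bias) rel_hom_eval:
  assumes "rel_hom A \<Phi>" "range v \<subseteq> A"
  shows "rel_eval (\<lambda>i. \<Phi> (v i)) t = \<Phi> (rel_eval v t)"
  using assms(1) rel_eval_mem[OF assms(2)] by (induction t) (simp_all add: rel_hom_def)

lemma (in rel_bias) rel_hom_image_sat:
  assumes h: "rel_hom A \<Phi>" and s: "rel_sat A E" shows "rel_sat (\<Phi> ` A) E"
proof (rule rel_satI)
  fix l r and w :: "nat \<Rightarrow> _" assume 1: "(l, r) \<in> E" "range w \<subseteq> \<Phi> ` A"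
  then have "\<forall>i. \<exists>r\<in>A. w i = \<Phi> r" by blast
  then obtain v where v: "\<And>i. v i \<in> A" "\<And>i. w i = \<Phi> (v i)" by metis
  then have w: "w = (\<lambda>i. \<Phi> (v i))" and v': "range v \<subseteq> A" by auto
  have "rel_eval v l = rel_eval v r" by (rule rel_satD[OF s 1(1) v'])
  then show "rel_eval w l = rel_eval w r"
    unfolding w by (simp add: rel_hom_eval[OF h v'])
qed

lemma (in rel_bias) rel_hom_inj_sat:
  assumes h: "rel_hom A \<Phi>" and B: "\<Phi> ` A \<subseteq> B" "inj_on \<Phi> A" and s: "rel_sat B E"
  shows "rel_sat A E"
proof (rule rel_satI)
  fix l r and v :: "nat \<Rightarrow> _" assume 1: "(l, r) \<in> E" "range v \<subseteq> A"
  then have v': "range (\<lambda>i. \<Phi> (v i)) \<subseteq> B" using B by blast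
  have "rel_eval (\<lambda>i. \<Phi> (v i)) l = rel_eval (\<lambda>i. \<Phi> (v i)) r"
    by (rule rel_satD[OF s 1(1) v'])
  then show "rel_eval v l = rel_eval v r"
    using B(2) rel_eval_mem[OF 1(2)] by (simp add: rel_hom_eval[OF h 1(2)] inj_on_eq_iff)
qed

text \<open>
  Bijections \<open>s i\<close> from a common nonempty domain onto disjoint sets act as matrix units:
  \<open>(i, j)\<close> goes to \<open>s j \<circ> (s i)\<inverse>\<close>.
\<close>

lemma (in rel_bias) matrix_units_sat:
  assumes I: "finite I" "\<And>i. i \<in> I \<Longrightarrow> s i \<in> A" "\<And>i. i \<in> I \<Longrightarrow> Domain (s i) = D" and D: "D \<noteq> {}"
    and disj: "\<And>i j. i \<in> I \<Longrightarrow> j \<in> I \<Longrightarrow> i \<noteq> j \<Longrightarrow> Range (s i) \<inter> Range (s j) = {}"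
    and sat: "rel_sat A E"
  shows "rel_sat {r. pbij r \<and> r \<subseteq> I \<times> I} E"
proof -
  let ?P = "{r. pbij r \<and> r \<subseteq> I \<times> I}"
  interpret P: rel_bias ?P by (rule rel_bias_pbij)
  define \<Phi> where "\<Phi> r = {(y, z). \<exists>i j x. (i, j) \<in> r \<and> (x, y) \<in> s i \<and> (x, z) \<in> s j}" for r
  have pb: "pbij (s i)" if "i \<in> I" for i using that I elem_pbij by blast
  have dom: "\<exists>y. (x, y) \<in> s j" if "(x, z) \<in> s i" "i \<in> I" "j \<in> I" for i j x z
    using I(3)[OF that(2)] I(3)[OF that(3)] that(1) by blast
  have same: "i = j \<and> x = x'" if "(x, y) \<in> s i" "(x', y) \<in> s j" "i \<in> I" "j \<in> I" for i j x x' y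
  proof -
    have "i = j" using disj[of i j] that by blast
    then show ?thesis using that pb[of i] pbij_inj by metis
  qed
  have mem: "(y, z) \<in> \<Phi> r \<longleftrightarrow> (i, j) \<in> r"
    if "(x, y) \<in> s i" "(x, z) \<in> s j" "i \<in> I" "j \<in> I" "r \<in> ?P" for x y z i j r
  proof
    assume "(y, z) \<in> \<Phi> r"
    then obtain i' j' x' where *: "(i', j') \<in> r" "(x', y) \<in> s i'" "(x', z) \<in> s j'" by (auto simp: \<Phi>_def)
    then have "i' \<in> I" "j' \<in> I" using that(5) by auto
    then show "(i, j) \<in> r" using same[OF that(1) *(2)] same[OF that(2) *(3)] that * by auto
  qed (use that in \<open>auto simp: \<Phi>_def\<close>)
  have \<Phi>E: "\<exists>x i j. (x, y) \<in> s i \<and> (x, z) \<in> s j \<and> i \<in> I \<and> j \<in> I \<and> (i, j) \<in> r"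
    if "(y, z) \<in> \<Phi> r" "r \<in> ?P" for y z r
    using that unfolding \<Phi>_def by blast
  have Dom: "y \<in> Domain (\<Phi> r) \<longleftrightarrow> i \<in> Domain r" if xy: "(x, y) \<in> s i" and i: "i \<in> I" and r: "r \<in> ?P" for x y i r
  proof
    assume "y \<in> Domain (\<Phi> r)"
    then obtain z where "(y, z) \<in> \<Phi> r" by blast
    then obtain x' i' j where "(x', y) \<in> s i'" "i' \<in> I" "(i', j) \<in> r" using \<Phi>E r by blast
    then show "i \<in> Domain r" using same xy i by blast
  next
    assume "i \<in> Domain r"
    then obtain j where j: "(i, j) \<in> r" by blast
    then have "j \<in> I" using r by blast
    then obtain z where "(x, z) \<in> s j" using dom xy i by blast
    then show "y \<in> Domain (\<Phi> r)" using j xy by (auto simp: \<Phi>_def)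
  qed
  have conv: "\<Phi> (r\<inverse>) = (\<Phi> r)\<inverse>" for r by (auto simp: \<Phi>_def)
  have Ran: "y \<in> Range (\<Phi> r) \<longleftrightarrow> i \<in> Range r" if "(x, y) \<in> s i" "i \<in> I" "r \<in> ?P" for x y i r
    using Dom[OF that(1,2), of "r\<inverse>"] that(3) conv[of r] by auto
  have comp: "\<Phi> (r O q) = \<Phi> r O \<Phi> q" if r: "r \<in> ?P" and q: "q \<in> ?P" for r q
  proof (intro equalityI subrelI)
    fix y z assume "(y, z) \<in> \<Phi> (r O q)"
    then obtain i j k x where *: "(i, j) \<in> r" "(j, k) \<in> q" "(x, y) \<in> s i" "(x, z) \<in> s k"
      by (auto simp: \<Phi>_def)
    then have "i \<in> I" "j \<in> I" using r by auto
    then obtain w where "(x, w) \<in> s j" using dom * by blast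
    then show "(y, z) \<in> \<Phi> r O \<Phi> q" using * unfolding \<Phi>_def by blast
  next
    fix y z assume "(y, z) \<in> \<Phi> r O \<Phi> q"
    then obtain w where "(y, w) \<in> \<Phi> r" "(w, z) \<in> \<Phi> q" by blast
    then obtain x i j x' j' k where *: "(x, y) \<in> s i" "(x, w) \<in> s j" "i \<in> I" "j \<in> I" "(i, j) \<in> r"
      "(x', w) \<in> s j'" "(x', z) \<in> s k" "j' \<in> I" "k \<in> I" "(j', k) \<in> q"
      using \<Phi>E r q by meson
    then have "j = j' \<and> x = x'" using same by blast
    then show "(y, z) \<in> \<Phi> (r O q)" using * unfolding \<Phi>_def by blast
  qed
  have diff: "\<Phi> (rel_diff r q) = rel_diff (\<Phi> r) (\<Phi> q)" if r: "r \<in> ?P" and q: "q \<in> ?P" for r q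
  proof (intro equalityI subrelI)
    fix y z assume "(y, z) \<in> \<Phi> (rel_diff r q)"
    then obtain i j x where *: "(i, j) \<in> r" "i \<notin> Domain q" "j \<notin> Range q" "(x, y) \<in> s i" "(x, z) \<in> s j"
      by (auto simp: \<Phi>_def rel_diff_def)
    then have "i \<in> I" "j \<in> I" using r by auto
    then show "(y, z) \<in> rel_diff (\<Phi> r) (\<Phi> q)"
      using * Dom[OF *(4) _ q] Ran[OF *(5) _ q] by (auto simp: rel_diff_def \<Phi>_def)
  next
    fix y z assume *: "(y, z) \<in> rel_diff (\<Phi> r) (\<Phi> q)"
    then obtain x i j where 1: "(x, y) \<in> s i" "(x, z) \<in> s j" "i \<in> I" "j \<in> I" "(i, j) \<in> r"
      using \<Phi>E[OF _ r] unfolding rel_diff_def by blast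
    then have "i \<notin> Domain q" "j \<notin> Range q"
      using * Dom[OF 1(1,3) q] Ran[OF 1(2,4) q] by (auto simp: rel_diff_def)
    then show "(y, z) \<in> \<Phi> (rel_diff r q)" using 1 by (auto simp: \<Phi>_def rel_diff_def)
  qed
  have Un: "\<Phi> (r \<union> q) = \<Phi> r \<union> \<Phi> q" for r q unfolding \<Phi>_def by blast
  have hom: "rel_hom ?P \<Phi>"
    unfolding rel_hom_def
    using conv comp diff by (simp add: rel_skew_def Un) (simp add: \<Phi>_def)
  have "\<Phi> r \<in> A" if r: "r \<in> ?P" for r
  proof -
    \<comment> \<open>\<open>A\<close> is closed only under finite orthogonal unions; the finiteness
      of \<open>I\<close> leaves finitely many pieces.\<close>
    have fin: "finite r" using r I(1) by (auto intro: finite_subset)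
    have "\<Phi> r = (\<Union>(i, j)\<in>r. (s i)\<inverse> O s j)" unfolding \<Phi>_def by blast
    also have "\<dots> \<in> A"
    proof (rule finite_Un_mem[OF fin])
      show "(case a of (i, j) \<Rightarrow> (s i)\<inverse> O s j) \<in> A" if "a \<in> r" for a
        using r I(2) that by (auto intro!: comp_mem converse_mem)
      fix a b assume ab: "a \<in> r" "b \<in> r" "a \<noteq> b"
      obtain i j k l where [simp]: "a = (i, j)" "b = (k, l)" by (cases a, cases b)
      have "i \<noteq> k" "j \<noteq> l" using ab r pbij_fun[of r i j l] pbij_inj[of r i j k] by auto
      moreover have "i \<in> I" "j \<in> I" "k \<in> I" "l \<in> I" using ab r by auto
      ultimately have "Range (s i) \<inter> Range (s k) = {}" "Range (s j) \<inter> Range (s l) = {}"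
        using disj by blast+
      then show "Domain (case a of (i, j) \<Rightarrow> (s i)\<inverse> O s j) \<inter> Domain (case b of (i, j) \<Rightarrow> (s i)\<inverse> O s j) = {} \<and>
        Range (case a of (i, j) \<Rightarrow> (s i)\<inverse> O s j) \<inter> Range (case b of (i, j) \<Rightarrow> (s i)\<inverse> O s j) = {}"
        by auto
    qed
    finally show ?thesis .
  qed
  then have sub: "\<Phi> ` ?P \<subseteq> A" by blast
  have "inj_on \<Phi> ?P"
  proof (rule inj_onI)
    have le: "r \<subseteq> q" if r: "r \<in> ?P" and q: "q \<in> ?P" and eq: "\<Phi> r = \<Phi> q" for r q
    proof (rule subrelI)
      fix i j assume ij: "(i, j) \<in> r"
      then have "i \<in> I" "j \<in> I" using r by auto
      moreover obtain x where "x \<in> D" using D by blast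
      ultimately obtain y z where "(x, y) \<in> s i" "(x, z) \<in> s j" using I(3) by blast
      then show "(i, j) \<in> q" using mem[of x y i z j] \<open>i \<in> I\<close> \<open>j \<in> I\<close> r q eq ij by blast
    qed
    fix r q assume "r \<in> ?P" "q \<in> ?P" "\<Phi> r = \<Phi> q"
    then show "r = q" using le[of r q] le[of q r] by simp
  qed
  then show ?thesis by (rule P.rel_hom_inj_sat[OF hom sub _ sat])
qed

text \<open>Fix \<open>u\<close> in \<open>Z\<close> and inject \<open>Y\<close> into
  \<open>Z\<close> by \<open>c\<close>: the one-point maps from \<open>u\<close> to
  \<open>c i\<close> are matrix units indexed by \<open>Y\<close>. For empty \<open>Z\<close> there
  is no \<open>u\<close>, but then all relations in question are empty.\<close>

lemma rel_sat_pbij_card_le: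
  assumes fin: "finite Y" "finite Z" "card Y \<le> card Z" and sat: "rel_sat {r. pbij r \<and> r \<subseteq> Z \<times> Z} E"
  shows "rel_sat {r. pbij r \<and> r \<subseteq> Y \<times> Y} E"
proof (cases "Z = {}")
  case True
  then have "Y = {}" using fin by simp
  then have "rel_eval v l = rel_eval v r" if "range v \<subseteq> {r. pbij r \<and> r \<subseteq> Y \<times> Y}" for v l r
    using rel_bias.rel_eval_mem[OF rel_bias_pbij that, of l]
      rel_bias.rel_eval_mem[OF rel_bias_pbij that, of r] by simp
  then show ?thesis by (auto simp: rel_sat_def)
next
  case False
  then obtain u where u: "u \<in> Z" by blast
  obtain c where c: "inj_on c Y" "c ` Y \<subseteq> Z" using card_le_inj[OF fin] by blast
  interpret Z: rel_bias "{r. pbij r \<and> r \<subseteq> Z \<times> Z}" by (rule rel_bias_pbij)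
  show ?thesis
  proof (rule Z.matrix_units_sat[where s = "\<lambda>i. {(u, c i)}" and D = "{u}", OF fin(1) _ _ _ _ sat])
    show "{(u, c i)} \<in> {r. pbij r \<and> r \<subseteq> Z \<times> Z}" if "i \<in> Y" for i
      using c u that by (auto simp: pbij_def single_valued_def)
    show "Range {(u, c i)} \<inter> Range {(u, c j)} = {}" if "i \<in> Y" "j \<in> Y" "i \<noteq> j" for i j
      using c that by (auto simp: inj_on_eq_iff)
  qed auto
qed

section \<open>Symmetric inverse semigroups\<close>

abbreviation pbij_upto :: "nat \<Rightarrow> (nat \<times> nat) set set" where
  "pbij_upto n \<equiv> {r. pbij r \<and> r \<subseteq> {1..n} \<times> {1..n}}"

lemma rel_representation_symmetric_inverse:
  "rel_representation (symmetric_inverse n) (\<lambda>f. {(i, j). f i = Some j}) (pbij_upto n)"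
proof (intro rel_representation.intro rel_representation_axioms.intro rel_bias_pbij)
  let ?\<rho> = "\<lambda>f :: nat \<rightharpoonup> nat. {(i, j). f i = Some j}"
  show "?\<rho> (szero (symmetric_inverse n)) = {}" by (simp add: symmetric_inverse_def)
  show "szero (symmetric_inverse n) \<in> carrier (symmetric_inverse n)" by (simp add: symmetric_inverse_def)
  show "inj_on ?\<rho> (carrier (symmetric_inverse n))"
  proof (rule inj_onI)
    fix f g :: "nat \<rightharpoonup> nat" assume "?\<rho> f = ?\<rho> g"
    then have "f i = Some j \<longleftrightarrow> g i = Some j" for i j by blast
    then show "f = g" by (metis option.exhaust ext)
  qed
  show "?\<rho> ` carrier (symmetric_inverse n) = pbij_upto n"
  proof (intro equalityI subsetI)
    fix r assume "r \<in> ?\<rho> ` carrier (symmetric_inverse n)"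
    then obtain f where f: "r = ?\<rho> f" "dom f \<subseteq> {1..n}" "ran f \<subseteq> {1..n}" "inj_on f (dom f)"
      by (auto simp: symmetric_inverse_def)
    have "pbij r" unfolding f(1) using f(4) by (intro pbijI) (auto simp: inj_on_def dom_def)
    then show "r \<in> pbij_upto n" using f by (auto simp: dom_def ran_def)
  next
    fix r assume r: "r \<in> pbij_upto n"
    define f where "f i = (if i \<in> Domain r then Some (THE j. (i, j) \<in> r) else None)" for i
    have f: "f i = Some j \<longleftrightarrow> (i, j) \<in> r" for i j
    proof (cases "i \<in> Domain r")
      case True
      then obtain k where k: "(i, k) \<in> r" by blast
      then have "(THE j. (i, j) \<in> r) = k" using r pbij_fun by (intro the_equality) auto
      then show ?thesis using True k r pbij_fun[of r i] by (auto simp: f_def)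
    qed (auto simp: f_def)
    have "inj_on f (dom f)"
    proof (rule inj_onI)
      fix i k assume "i \<in> dom f" "f i = f k"
      then obtain j where "f i = Some j" "f k = Some j" by (metis domD)
      then show "i = k" using f r pbij_inj[of r i j k] by auto
    qed
    then have "f \<in> carrier (symmetric_inverse n)"
      using r by (auto simp: symmetric_inverse_def dom_def ran_def f)
    moreover have "r = ?\<rho> f" using f by auto
    ultimately show "r \<in> ?\<rho> ` carrier (symmetric_inverse n)" by blast
  qed
  fix f g assume fg: "f \<in> carrier (symmetric_inverse n)" "g \<in> carrier (symmetric_inverse n)"
  have mult: "smul (symmetric_inverse n) f g = f \<circ>\<^sub>m g" by (simp add: symmetric_inverse_def)
  show "?\<rho> (smul (symmetric_inverse n) f g) = ?\<rho> g O ?\<rho> f"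
    unfolding mult by (auto simp: map_comp_Some_iff)
  have "inj_on (f \<circ>\<^sub>m g) (dom (f \<circ>\<^sub>m g))"
  proof (rule inj_onI)
    fix i j assume "i \<in> dom (f \<circ>\<^sub>m g)" "(f \<circ>\<^sub>m g) i = (f \<circ>\<^sub>m g) j"
    then obtain c where "(f \<circ>\<^sub>m g) i = Some c" "(f \<circ>\<^sub>m g) j = Some c" by (metis domD)
    then obtain a b where *: "g i = Some a" "f a = Some c" "g j = Some b" "f b = Some c"
      unfolding map_comp_Some_iff by blast
    have "inj_on f (dom f)" "inj_on g (dom g)" using fg by (simp_all add: symmetric_inverse_def)
    then have "a = b" "g i = g j \<Longrightarrow> i = j" using * by (auto simp: inj_on_def dom_def)
    then show "i = j" using * by simp
  qed
  moreover have "dom (f \<circ>\<^sub>m g) \<subseteq> {1..n}" "ran (f \<circ>\<^sub>m g) \<subseteq> {1..n}"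
  proof -
    have "dom (f \<circ>\<^sub>m g) \<subseteq> dom g" "ran (f \<circ>\<^sub>m g) \<subseteq> ran f"
      by (auto simp: map_comp_def ran_def split: option.splits)
    moreover have "dom g \<subseteq> {1..n}" "ran f \<subseteq> {1..n}" using fg by (simp_all add: symmetric_inverse_def)
    ultimately show "dom (f \<circ>\<^sub>m g) \<subseteq> {1..n}" "ran (f \<circ>\<^sub>m g) \<subseteq> {1..n}" by blast+
  qed
  ultimately show "smul (symmetric_inverse n) f g \<in> carrier (symmetric_inverse n)"
    unfolding mult by (simp add: symmetric_inverse_def)
qed

lemma symmetric_inverse_in_variety_iff: "symmetric_inverse n \<in> bias_variety E \<longleftrightarrow> rel_sat (pbij_upto n) E"
  by (rule rel_representation.bias_variety_iff[OF rel_representation_symmetric_inverse])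

lemma symmetric_inverse_in_variety_mono:
  "symmetric_inverse n \<in> bias_variety E \<Longrightarrow> m \<le> n \<Longrightarrow> symmetric_inverse m \<in> bias_variety E"
  using rel_sat_pbij_card_le[of "{1..m}" "{1..n}" E] by (simp add: symmetric_inverse_in_variety_iff)

lemma symmetric_inverse_0_in_variety: "symmetric_inverse 0 \<in> bias_variety E"
  unfolding symmetric_inverse_in_variety_iff
proof (rule rel_satI)
  fix l r and v :: "nat \<Rightarrow> _" assume 1: "(l, r) \<in> E" "range v \<subseteq> pbij_upto 0"
  show "rel_eval v l = rel_eval v r"
    using rel_bias.rel_eval_mem[OF rel_bias_pbij 1(2), of l]
      rel_bias.rel_eval_mem[OF rel_bias_pbij 1(2), of r] by simp
qed

text \<open>Agreement at the single point \<open>x\<close> after restricting the valuation to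
  \<open>Z\<close>. Both directions are recorded since \<open>BInv\<close> exchanges them.\<close>

definition eval_agree :: "(nat \<Rightarrow> ('x \<times> 'x) set) \<Rightarrow> bias_term \<Rightarrow> 'x \<Rightarrow> 'x set \<Rightarrow> bool" where
  "eval_agree v t x Z \<longleftrightarrow> (\<forall>y.
    ((x, y) \<in> rel_eval (\<lambda>i. v i \<inter> Z \<times> Z) t \<longleftrightarrow> (x, y) \<in> rel_eval v t) \<and>
    ((y, x) \<in> rel_eval (\<lambda>i. v i \<inter> Z \<times> Z) t \<longleftrightarrow> (y, x) \<in> rel_eval v t))"

lemma eval_agreeD:
  assumes "eval_agree v t x Z"
  shows "(x, y) \<in> rel_eval (\<lambda>i. v i \<inter> Z \<times> Z) t \<longleftrightarrow> (x, y) \<in> rel_eval v t"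
    and "(y, x) \<in> rel_eval (\<lambda>i. v i \<inter> Z \<times> Z) t \<longleftrightarrow> (y, x) \<in> rel_eval v t"
  using assms by (simp_all add: eval_agree_def)

text \<open>A partial bijection relates a point to at most one point in each direction, so only
  finitely many points are reached along the subterms. Agreement is claimed for every larger
  \<open>Z\<close> because the induction steps unite the sets found for several points and
  subterms.\<close>

lemma rel_eval_local:
  assumes v: "\<And>i. pbij (v i)"
  shows "\<exists>Y. finite Y \<and> (\<forall>Z. Y \<subseteq> Z \<longrightarrow> eval_agree v t x Z)"
proof (induction t arbitrary: x)
  have pb: "pbij (rel_eval v t)" for t
    using rel_bias.rel_eval_mem[OF rel_bias_pbij[of UNIV], of v t] v by auto
  have fin: "finite {y. (x, y) \<in> rel_eval v t}" "finite {y. (y, x) \<in> rel_eval v t}" for x t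
  proof -
    have sub: "finite R" if "\<And>y z. y \<in> R \<Longrightarrow> z \<in> R \<Longrightarrow> y = z" for R :: "'a set"
    proof (cases "R = {}")
      case False
      then obtain y where "y \<in> R" by blast
      then have "R \<subseteq> {y}" using that by blast
      then show ?thesis by (rule finite_subset) simp
    qed simp
    show "finite {y. (x, y) \<in> rel_eval v t}"
      by (rule sub) (use pbij_fun[OF pb] in blast)
    show "finite {y. (y, x) \<in> rel_eval v t}"
      by (rule sub) (use pbij_inj[OF pb] in blast)
  qed
  {
    case (BVar i)
    let ?Y = "{x} \<union> {y. (x, y) \<in> rel_eval v (BVar i)} \<union> {y. (y, x) \<in> rel_eval v (BVar i)}"
    have "finite ?Y" using fin by blast
    then show ?case by (intro exI[of _ ?Y]) (auto simp: eval_agree_def)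
  next
    case BZero
    then show ?case by (auto simp: eval_agree_def)
  next
    case (BInv t)
    from BInv[of x] show ?case by (simp add: eval_agree_def conj_commute)
  next
    case (BMul s t)
    then obtain S T where ST: "\<And>x. finite (S x)" "\<And>x. finite (T x)"
      "\<And>x Z. S x \<subseteq> Z \<Longrightarrow> eval_agree v s x Z" "\<And>x Z. T x \<subseteq> Z \<Longrightarrow> eval_agree v t x Z"
      by metis
    \<comment> \<open>Besides \<open>x\<close> itself, \<open>s\<close> is consulted at the image of
      \<open>x\<close> under \<open>t\<close>, and, for pairs ending in \<open>x\<close>,
      \<open>t\<close> is consulted at the preimage of \<open>x\<close> under
      \<open>s\<close>.\<close>
    let ?Y = "T x \<union> S x \<union> (\<Union>z\<in>{z. (x, z) \<in> rel_eval v t}. S z) \<union> (\<Union>z\<in>{z. (z, x) \<in> rel_eval v s}. T z)"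
    have A: "finite ?Y" using fin ST by blast
    have B: "eval_agree v (BMul s t) x Z" if Z: "?Y \<subseteq> Z" for Z
    proof -
      have st: "eval_agree v s x Z" "eval_agree v t x Z" using ST(3)[of x Z] ST(4)[of x Z] Z by blast+
      have *:
        "\<And>y. (x, y) \<in> rel_eval (\<lambda>i. v i \<inter> Z \<times> Z) s \<longleftrightarrow> (x, y) \<in> rel_eval v s"
        "\<And>y. (y, x) \<in> rel_eval (\<lambda>i. v i \<inter> Z \<times> Z) s \<longleftrightarrow> (y, x) \<in> rel_eval v s"
        "\<And>y. (x, y) \<in> rel_eval (\<lambda>i. v i \<inter> Z \<times> Z) t \<longleftrightarrow> (x, y) \<in> rel_eval v t"
        "\<And>y. (y, x) \<in> rel_eval (\<lambda>i. v i \<inter> Z \<times> Z) t \<longleftrightarrow> (y, x) \<in> rel_eval v t"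
        by (simp_all only: st[THEN eval_agreeD(1)] st[THEN eval_agreeD(2)])
      have **: "eval_agree v s z Z" if "(x, z) \<in> rel_eval v t" for z
        using ST(3)[of z Z] Z that by blast
      have ***: "eval_agree v t z Z" if "(z, x) \<in> rel_eval v s" for z
        using ST(4)[of z Z] Z that by blast
      show ?thesis
        unfolding eval_agree_def
      proof (intro allI conjI)
        fix y
        show "(x, y) \<in> rel_eval (\<lambda>i. v i \<inter> Z \<times> Z) (BMul s t) \<longleftrightarrow> (x, y) \<in> rel_eval v (BMul s t)"
          unfolding rel_eval.simps relcomp_unfold mem_Collect_eq prod.case *
          by (intro ex_cong1 conj_cong refl) (rule eval_agreeD(1)[OF **])
        show "(y, x) \<in> rel_eval (\<lambda>i. v i \<inter> Z \<times> Z) (BMul s t) \<longleftrightarrow> (y, x) \<in> rel_eval v (BMul s t)"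
          unfolding rel_eval.simps relcomp_unfold mem_Collect_eq prod.case *
          using eval_agreeD(2)[OF ***] by blast
      qed
    qed
    show ?case by (intro exI[of _ ?Y] conjI allI impI A B)
  next
    case (BDiff s t)
    then obtain S T where ST: "\<And>x. finite (S x)" "\<And>x. finite (T x)"
      "\<And>x Z. S x \<subseteq> Z \<Longrightarrow> eval_agree v s x Z" "\<And>x Z. T x \<subseteq> Z \<Longrightarrow> eval_agree v t x Z"
      by metis
    \<comment> \<open>A pair of \<open>s\<close> survives only if its ends avoid the domain and the
      range of \<open>t\<close>, so \<open>t\<close> is consulted at both neighbours of
      \<open>x\<close> under \<open>s\<close> as well.\<close>
    let ?Y = "T x \<union> S x \<union> (\<Union>z\<in>{z. (x, z) \<in> rel_eval v s}. T z) \<union> (\<Union>z\<in>{z. (z, x) \<in> rel_eval v s}. T z)"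
    have A: "finite ?Y" using fin ST by blast
    have B: "eval_agree v (BDiff s t) x Z" if Z: "?Y \<subseteq> Z" for Z
    proof -
      have st: "eval_agree v s x Z" "eval_agree v t x Z" using ST(3)[of x Z] ST(4)[of x Z] Z by blast+
      have *:
        "\<And>y. (x, y) \<in> rel_eval (\<lambda>i. v i \<inter> Z \<times> Z) s \<longleftrightarrow> (x, y) \<in> rel_eval v s"
        "\<And>y. (y, x) \<in> rel_eval (\<lambda>i. v i \<inter> Z \<times> Z) s \<longleftrightarrow> (y, x) \<in> rel_eval v s"
        "\<And>y. (x, y) \<in> rel_eval (\<lambda>i. v i \<inter> Z \<times> Z) t \<longleftrightarrow> (x, y) \<in> rel_eval v t"
        "\<And>y. (y, x) \<in> rel_eval (\<lambda>i. v i \<inter> Z \<times> Z) t \<longleftrightarrow> (y, x) \<in> rel_eval v t"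
        by (simp_all only: st[THEN eval_agreeD(1)] st[THEN eval_agreeD(2)])
      have **: "eval_agree v t z Z" if "(x, z) \<in> rel_eval v s \<or> (z, x) \<in> rel_eval v s" for z
        using ST(4)[of z Z] Z that by blast
      have D: "x \<in> Domain (rel_eval (\<lambda>i. v i \<inter> Z \<times> Z) t) \<longleftrightarrow> x \<in> Domain (rel_eval v t)"
        "x \<in> Range (rel_eval (\<lambda>i. v i \<inter> Z \<times> Z) t) \<longleftrightarrow> x \<in> Range (rel_eval v t)"
        by (simp_all add: Domain_iff Range_iff *)
      have R: "(x, z) \<in> rel_eval v s \<Longrightarrow>
          z \<in> Range (rel_eval (\<lambda>i. v i \<inter> Z \<times> Z) t) \<longleftrightarrow> z \<in> Range (rel_eval v t)"
        "(z, x) \<in> rel_eval v s \<Longrightarrow>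
          z \<in> Domain (rel_eval (\<lambda>i. v i \<inter> Z \<times> Z) t) \<longleftrightarrow> z \<in> Domain (rel_eval v t)" for z
        using **[of z, THEN eval_agreeD(1)] **[of z, THEN eval_agreeD(2)]
        by (simp_all add: Domain_iff Range_iff)
      show ?thesis
        by (simp add: eval_agree_def rel_diff_def * D R cong: conj_cong)
    qed
    show ?case by (intro exI[of _ ?Y] conjI allI impI A B)
  next
    case (BSkew s t)
    then obtain S T where ST: "\<And>x. finite (S x)" "\<And>x. finite (T x)"
      "\<And>x Z. S x \<subseteq> Z \<Longrightarrow> eval_agree v s x Z" "\<And>x Z. T x \<subseteq> Z \<Longrightarrow> eval_agree v t x Z"
      by metis
    let ?Y = "T x \<union> S x \<union> (\<Union>z\<in>{z. (x, z) \<in> rel_eval v s}. T z) \<union> (\<Union>z\<in>{z. (z, x) \<in> rel_eval v s}. T z)"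
    have A: "finite ?Y" using fin ST by blast
    have B: "eval_agree v (BSkew s t) x Z" if Z: "?Y \<subseteq> Z" for Z
    proof -
      have st: "eval_agree v s x Z" "eval_agree v t x Z" using ST(3)[of x Z] ST(4)[of x Z] Z by blast+
      have *:
        "\<And>y. (x, y) \<in> rel_eval (\<lambda>i. v i \<inter> Z \<times> Z) s \<longleftrightarrow> (x, y) \<in> rel_eval v s"
        "\<And>y. (y, x) \<in> rel_eval (\<lambda>i. v i \<inter> Z \<times> Z) s \<longleftrightarrow> (y, x) \<in> rel_eval v s"
        "\<And>y. (x, y) \<in> rel_eval (\<lambda>i. v i \<inter> Z \<times> Z) t \<longleftrightarrow> (x, y) \<in> rel_eval v t"
        "\<And>y. (y, x) \<in> rel_eval (\<lambda>i. v i \<inter> Z \<times> Z) t \<longleftrightarrow> (y, x) \<in> rel_eval v t"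
        by (simp_all only: st[THEN eval_agreeD(1)] st[THEN eval_agreeD(2)])
      have **: "eval_agree v t z Z" if "(x, z) \<in> rel_eval v s \<or> (z, x) \<in> rel_eval v s" for z
        using ST(4)[of z Z] Z that by blast
      have D: "x \<in> Domain (rel_eval (\<lambda>i. v i \<inter> Z \<times> Z) t) \<longleftrightarrow> x \<in> Domain (rel_eval v t)"
        "x \<in> Range (rel_eval (\<lambda>i. v i \<inter> Z \<times> Z) t) \<longleftrightarrow> x \<in> Range (rel_eval v t)"
        by (simp_all add: Domain_iff Range_iff *)
      have R: "(x, z) \<in> rel_eval v s \<Longrightarrow>
          z \<in> Range (rel_eval (\<lambda>i. v i \<inter> Z \<times> Z) t) \<longleftrightarrow> z \<in> Range (rel_eval v t)"
        "(z, x) \<in> rel_eval v s \<Longrightarrow>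
          z \<in> Domain (rel_eval (\<lambda>i. v i \<inter> Z \<times> Z) t) \<longleftrightarrow> z \<in> Domain (rel_eval v t)" for z
        using **[of z, THEN eval_agreeD(1)] **[of z, THEN eval_agreeD(2)]
        by (simp_all add: Domain_iff Range_iff)
      show ?thesis
        by (simp add: eval_agree_def rel_skew_def rel_diff_def * D R cong: conj_cong)
    qed
    show ?case by (intro exI[of _ ?Y] conjI allI impI A B)
  }
qed

lemma rel_sat_if_symmetric_inverses:
  assumes pb: "\<And>r. r \<in> A \<Longrightarrow> pbij r" and I: "\<And>n. symmetric_inverse n \<in> bias_variety E"
  shows "rel_sat A E"
proof (rule rel_satI)
  fix l r and v :: "nat \<Rightarrow> _" assume 1: "(l, r) \<in> E" "range v \<subseteq> A"
  have v: "pbij (v i)" for i using pb 1 by blast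
  have *: "((x, y) \<in> rel_eval v l) = ((x, y) \<in> rel_eval v r)" for x y
  proof -
    obtain Y1 where Y1: "finite Y1" "\<And>Z. Y1 \<subseteq> Z \<Longrightarrow> eval_agree v l x Z"
      using rel_eval_local[where v = v and x = x and t = l, OF v] by blast
    obtain Y2 where Y2: "finite Y2" "\<And>Z. Y2 \<subseteq> Z \<Longrightarrow> eval_agree v r x Z"
      using rel_eval_local[where v = v and x = x and t = r, OF v] by blast
    let ?Y = "Y1 \<union> Y2"
    have sat: "rel_sat {r. pbij r \<and> r \<subseteq> ?Y \<times> ?Y} E"
      using I[of "card ?Y"] Y1(1) Y2(1) unfolding symmetric_inverse_in_variety_iff
      by (intro rel_sat_pbij_card_le[of ?Y "{1..card ?Y}"]) simp_all
    have "range (\<lambda>i. v i \<inter> ?Y \<times> ?Y) \<subseteq> {r. pbij r \<and> r \<subseteq> ?Y \<times> ?Y}"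
      using v pbij_subset by blast
    then have "rel_eval (\<lambda>i. v i \<inter> ?Y \<times> ?Y) l = rel_eval (\<lambda>i. v i \<inter> ?Y \<times> ?Y) r"
      by (rule rel_satD[OF sat 1(1)])
    then show ?thesis
      using eval_agreeD(1)[OF Y1(2)[of ?Y], of y] eval_agreeD(1)[OF Y2(2)[of ?Y], of y] by simp
  qed
  show "rel_eval v l = rel_eval v r"
    using * by (intro equalityI subrelI) simp_all
qed

text \<open>If all symmetric inverse semigroups satisfied \<open>E\<close>, so would every bias over
  \<open>'p\<close>, against properness. As membership is inherited by smaller sets, one of them
  outside the variety bounds all those inside.\<close>

lemma proper_variety_largest_symmetric_inverse:
  assumes "proper_bias_variety TYPE('p) E"
  obtains h where "symmetric_inverse h \<in> bias_variety E"
    "\<And>m. symmetric_inverse m \<in> bias_variety E \<Longrightarrow> m \<le> h"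
proof -
  have "\<exists>n. symmetric_inverse n \<notin> bias_variety E"
  proof (rule ccontr)
    assume "\<not> ?thesis"
    then have I: "\<And>n. symmetric_inverse n \<in> bias_variety E" by blast
    have "S \<in> bias_variety E" if "boolean_inverse_semigroup S" for S :: "'p semigroup0"
    proof -
      interpret R: rel_representation S "inverse_semigroup0.germ_rep S"
        "inverse_semigroup0.germ_rep S ` carrier S"
        by (rule boolean_inverse_semigroup.rel_representation_germ_rep[OF that])
      show ?thesis
        unfolding R.bias_variety_iff by (rule rel_sat_if_symmetric_inverses[OF R.elem_pbij I])
    qed
    then have "bias_variety E = {S :: 'p semigroup0. boolean_inverse_semigroup S}"
      by (auto simp: bias_variety_def)
    then show False using assms by (simp add: proper_bias_variety_def)
  qed
  then obtain n where n: "symmetric_inverse n \<notin> bias_variety E" ..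
  have bound: "m \<le> n" if "symmetric_inverse m \<in> bias_variety E" for m
    using symmetric_inverse_in_variety_mono[OF that, of n] n by linarith
  obtain h where "symmetric_inverse h \<in> bias_variety E"
    "\<And>m. symmetric_inverse m \<in> bias_variety E \<Longrightarrow> m \<le> h"
    using GreatestI_nat[of "\<lambda>m. symmetric_inverse m \<in> bias_variety E" 0 n]
      Greatest_le_nat[of "\<lambda>m. symmetric_inverse m \<in> bias_variety E" _ n]
      symmetric_inverse_0_in_variety bound by blast
  then show ?thesis using that by blast
qed

section \<open>Passing to countable transitive biases\<close>

text \<open>The subbias generated by the values of a valuation is indexed by terms, hence
  countable.\<close>

instance bias_term :: countable
  by countable_datatype

text \<open>Preservation is known for the basic operations only: in the image, an orthogonal union
  is recovered as a \<open>rel_skew\<close>, and a difference of domains as \<open>rel_diff\<close>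
  of the idempotents \<open>r O r\<inverse>\<close>.\<close>

lemma (in rel_bias) rel_bias_hom_image:
  assumes h: "rel_hom A \<Phi>" and pb: "\<And>r. r \<in> A \<Longrightarrow> pbij (\<Phi> r)" shows "rel_bias (\<Phi> ` A)"
proof
  show "pbij r" if "r \<in> \<Phi> ` A" for r using that pb by blast
  show "{} \<in> \<Phi> ` A" using h empty_mem by (metis imageI rel_hom_def)
  fix r assume "r \<in> \<Phi> ` A"
  then obtain r' where r: "r' \<in> A" "r = \<Phi> r'" by blast
  have conv: "r\<inverse> = \<Phi> (r'\<inverse>)" if "r' \<in> A" "r = \<Phi> r'" for r r' using h that by (simp add: rel_hom_def)
  show "r\<inverse> \<in> \<Phi> ` A" using conv[OF r] converse_mem[OF r(1)] by blast
  fix s assume "s \<in> \<Phi> ` A"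
  then obtain s' where s: "s' \<in> A" "s = \<Phi> s'" by blast
  have hom: "\<Phi> (r O s) = \<Phi> r O \<Phi> s" "\<Phi> (rel_diff r s) = rel_diff (\<Phi> r) (\<Phi> s)"
    "\<Phi> (rel_skew r s) = rel_skew (\<Phi> r) (\<Phi> s)" if "r \<in> A" "s \<in> A" for r s
    using h that by (auto simp: rel_hom_def)
  have "r O s = \<Phi> (r' O s')" using hom r s by simp
  then show "r O s \<in> \<Phi> ` A" using comp_mem[OF r(1) s(1)] by blast
  let ?e = "r' O r'\<inverse>" and ?f = "s' O s'\<inverse>"
  have ef: "?e \<in> A" "?f \<in> A" using r s comp_mem converse_mem by blast+
  have "\<Phi> ?e = Id_on (Domain r)" "\<Phi> ?f = Id_on (Domain s)"
    using hom(1)[OF r(1) converse_mem[OF r(1)]] hom(1)[OF s(1) converse_mem[OF s(1)]]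
      conv[OF r] conv[OF s] r s pb pbij_comp_converse by metis+
  then have "\<Phi> (rel_diff ?e ?f) = rel_diff (Id_on (Domain r)) (Id_on (Domain s))"
    using hom(2)[OF ef] by simp
  also have "\<dots> = Id_on (Domain r - Domain s)" by (auto simp: rel_diff_def)
  finally show "Id_on (Domain r - Domain s) \<in> \<Phi> ` A" using rel_diff_mem[OF ef] by (metis imageI)
  assume "Domain r \<inter> Domain s = {}" "Range r \<inter> Range s = {}"
  then have "r \<union> s = rel_skew r s" by (auto simp: rel_skew_def rel_diff_def)
  also have "\<dots> = \<Phi> (rel_skew r' s')" using hom(3) r s by simp
  finally show "r \<union> s \<in> \<Phi> ` A" using rel_skew_mem[OF r(1) s(1)] by blast
qed

text \<open>On an invariant set every pair has both ends inside or both outside, so restriction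
  truncates neither composites nor the domains and ranges tested by \<open>rel_diff\<close>.\<close>

lemma (in rel_bias) rel_hom_restrict:
  assumes inv: "\<And>r x y. r \<in> A \<Longrightarrow> (x, y) \<in> r \<Longrightarrow> x \<in> X \<longleftrightarrow> y \<in> X"
  shows "rel_hom A (\<lambda>r. r \<inter> X \<times> X)"
proof -
  have comp: "(r O s) \<inter> X \<times> X = (r \<inter> X \<times> X) O (s \<inter> X \<times> X)" if "r \<in> A" "s \<in> A" for r s
    using inv[OF that(1)] by blast
  have diff: "rel_diff r s \<inter> X \<times> X = rel_diff (r \<inter> X \<times> X) (s \<inter> X \<times> X)" if "r \<in> A" "s \<in> A" for r s
  proof -
    have "x \<in> X \<Longrightarrow> x \<in> Domain s \<longleftrightarrow> x \<in> Domain (s \<inter> X \<times> X)"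
      "x \<in> X \<Longrightarrow> x \<in> Range s \<longleftrightarrow> x \<in> Range (s \<inter> X \<times> X)" for x
      using inv[OF that(2)] by blast+
    then show ?thesis unfolding rel_diff_def by blast
  qed
  have skew: "rel_skew r s \<inter> X \<times> X = rel_skew (r \<inter> X \<times> X) (s \<inter> X \<times> X)" if "r \<in> A" "s \<in> A" for r s
    using diff[OF that] unfolding rel_skew_def by blast
  show ?thesis unfolding rel_hom_def
    by (intro conjI ballI comp diff skew) auto
qed

lemma rel_bias_range_rel_eval:
  assumes v: "\<And>i. pbij (v i)" shows "rel_bias (range (rel_eval v))"
proof
  have pb: "pbij (rel_eval v t)" for t
    using rel_bias.rel_eval_mem[OF rel_bias_pbij[of UNIV], of v t] v by auto
  show "pbij r" if "r \<in> range (rel_eval v)" for r using that pb by blast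
  show "{} \<in> range (rel_eval v)" by (rule range_eqI[of _ _ BZero]) simp
  fix r assume "r \<in> range (rel_eval v)"
  then obtain a where a: "r = rel_eval v a" by blast
  show "r\<inverse> \<in> range (rel_eval v)" by (rule range_eqI[of _ _ "BInv a"]) (simp add: a)
  fix s assume "s \<in> range (rel_eval v)"
  then obtain b where b: "s = rel_eval v b" by blast
  show "r O s \<in> range (rel_eval v)" by (rule range_eqI[of _ _ "BMul b a"]) (simp add: a b)
  have "Id_on (Domain r - Domain s) = rel_diff (Id_on (Domain r)) (Id_on (Domain s))"
    by (auto simp: rel_diff_def)
  also have "\<dots> = rel_eval v (BDiff (BMul (BInv a) a) (BMul (BInv b) b))"
    by (simp add: pbij_comp_converse pb a b)
  finally show "Id_on (Domain r - Domain s) \<in> range (rel_eval v)" by blast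
  assume "Domain r \<inter> Domain s = {}" "Range r \<inter> Range s = {}"
  then have "r \<union> s = rel_skew r s" by (auto simp: rel_skew_def rel_diff_def)
  then show "r \<union> s \<in> range (rel_eval v)"
    by (intro range_eqI[of _ _ "BSkew a b"]) (simp add: a b)
qed

lemma (in rel_bias) countable_transitive_image:
  assumes sat: "rel_sat A E" and v: "range v \<subseteq> A" and neq: "rel_eval v l \<noteq> rel_eval v r"
  obtains C :: "('x \<times> 'x) set set" and w where "rel_bias C" "countable C" "rel_sat C E"
    "range w \<subseteq> C" "rel_eval w l \<noteq> rel_eval w r"
    "\<And>p q a b. p \<in> C \<Longrightarrow> q \<in> C \<Longrightarrow> a \<in> Domain p \<Longrightarrow> b \<in> Domain q \<Longrightarrow> \<exists>s\<in>C. (a, b) \<in> s"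
    "\<exists>p\<in>C. p \<noteq> {}"
proof -
  have pb: "pbij (v i)" for i using v elem_pbij by blast
  define B where "B = range (rel_eval v)"
  interpret B: rel_bias B unfolding B_def by (rule rel_bias_range_rel_eval[OF pb])
  have "B \<subseteq> A" using rel_eval_mem[OF v] by (auto simp: B_def)
  then have satB: "rel_sat B E" using rel_sat_subset[OF sat] by blast
  obtain x y where xy: "((x, y) \<in> rel_eval v l) \<noteq> ((x, y) \<in> rel_eval v r)"
    using neq by (metis equalityI subrelI)
  then obtain b where b: "b \<in> B" "(x, y) \<in> b" unfolding B_def by blast
  \<comment> \<open>The orbit of \<open>x\<close>. Since \<open>(x, y)\<close> belongs to some
    member \<open>b\<close> of \<open>B\<close>, the orbit contains both \<open>x\<close> and
    \<open>y\<close>, so the pair on which the two values differ survives the restriction.\<close>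
  define X where "X = {z. \<exists>r\<in>B. (x, z) \<in> r}"
  have XI: "z \<in> X" if "t \<in> B" "(x, z) \<in> t" for t z using that unfolding X_def by blast
  have XE: "\<exists>t\<in>B. (x, z) \<in> t" if "z \<in> X" for z using that unfolding X_def by blast
  have x: "x \<in> X" by (rule XI[OF B.comp_mem[OF b(1) B.converse_mem[OF b(1)]]]) (use b(2) in blast)
  have y: "y \<in> X" by (rule XI[OF b])
  have fwd: "q \<in> X" if s: "s \<in> B" "(p, q) \<in> s" "p \<in> X" for s p q
  proof -
    obtain t where t: "t \<in> B" "(x, p) \<in> t" using XE[OF s(3)] by blast
    show ?thesis by (rule XI[OF B.comp_mem[OF t(1) s(1)]]) (use t(2) s(2) in blast)
  qed
  have inv: "p \<in> X \<longleftrightarrow> q \<in> X" if s: "s \<in> B" "(p, q) \<in> s" for s p q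
    using fwd[OF s] fwd[OF B.converse_mem[OF s(1)], of q p] s(2) by blast
  let ?\<Phi> = "\<lambda>r. r \<inter> X \<times> X"
  have hom: "rel_hom B ?\<Phi>" by (rule B.rel_hom_restrict) (rule inv)
  show ?thesis
  proof (rule that[of "?\<Phi> ` B" "\<lambda>i. v i \<inter> X \<times> X"])
    show "rel_bias (?\<Phi> ` B)"
      by (rule B.rel_bias_hom_image[OF hom]) (rule pbij_subset[OF B.elem_pbij], auto)
    show "countable (?\<Phi> ` B)" by (intro countable_image) (simp add: B_def)
    show "rel_sat (?\<Phi> ` B) E" by (rule B.rel_hom_image_sat[OF hom satB])
    have vB: "v i \<in> B" for i unfolding B_def by (rule range_eqI[of _ _ "BVar i"]) simp
    then show "range (\<lambda>i. v i \<inter> X \<times> X) \<subseteq> ?\<Phi> ` B" by blast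
    have "range v \<subseteq> B" using vB by blast
    then have ev: "rel_eval (\<lambda>i. v i \<inter> X \<times> X) t = rel_eval v t \<inter> X \<times> X" for t
      by (rule B.rel_hom_eval[OF hom])
    show "rel_eval (\<lambda>i. v i \<inter> X \<times> X) l \<noteq> rel_eval (\<lambda>i. v i \<inter> X \<times> X) r"
      unfolding ev using xy x y by blast
    show "\<exists>p\<in>?\<Phi> ` B. p \<noteq> {}"
      by (rule bexI[OF _ imageI[OF b(1)]]) (use b(2) x y in blast)
    show "\<exists>s\<in>?\<Phi> ` B. (a, c) \<in> s"
      if p: "p \<in> ?\<Phi> ` B" and q: "q \<in> ?\<Phi> ` B" and a: "a \<in> Domain p" and c: "c \<in> Domain q" for p q a c
    proof -
      have "a \<in> X" "c \<in> X" using p q a c by auto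
      then obtain t u where t: "t \<in> B" "(x, a) \<in> t" "u \<in> B" "(x, c) \<in> u" using XE by meson
      have tu: "t\<inverse> O u \<in> B" by (rule B.comp_mem[OF B.converse_mem[OF t(1)] t(3)])
      have "(a, c) \<in> (t\<inverse> O u) \<inter> X \<times> X" using t(2,4) \<open>a \<in> X\<close> \<open>c \<in> X\<close> by blast
      then show ?thesis using imageI[OF tu, of ?\<Phi>] by (rule bexI)
    qed
  qed
qed

section \<open>Transitive biases with finitely many idempotents\<close>

lemma (in rel_bias) finite_Inter_supports:
  "finite F \<Longrightarrow> F \<noteq> {} \<Longrightarrow> F \<subseteq> supports \<Longrightarrow> \<Inter>F \<in> supports"
  by (induction rule: finite_ne_induct) (auto intro: Int_supports)

text \<open>Transitivity concerns only the points that occur in some domain; other points of the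
  type are not touched by \<open>A\<close>.\<close>

locale transitive_rel_bias = rel_bias A for A :: "('x \<times> 'x) set set" +
  assumes trans: "p \<in> A \<Longrightarrow> q \<in> A \<Longrightarrow> a \<in> Domain p \<Longrightarrow> b \<in> Domain q \<Longrightarrow> \<exists>s\<in>A. (a, b) \<in> s"
    and nontrivial: "\<exists>p\<in>A. p \<noteq> {}"
begin

lemma trans_supports: "D \<in> supports \<Longrightarrow> E \<in> supports \<Longrightarrow> a \<in> D \<Longrightarrow> b \<in> E \<Longrightarrow> \<exists>s\<in>A. (a, b) \<in> s"
  using trans unfolding supports_def by blast

definition disjoint_supports :: "'x set set \<Rightarrow> bool" where
  "disjoint_supports F \<longleftrightarrow> finite F \<and> F \<subseteq> supports \<and> {} \<notin> F \<and> (\<forall>D\<in>F. \<forall>E\<in>F. D \<noteq> E \<longrightarrow> D \<inter> E = {})"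

lemma disjoint_supports_insert:
  assumes F: "disjoint_supports F" and K: "K \<in> supports" "K \<noteq> {}" and o: "\<And>D. D \<in> F \<Longrightarrow> K \<inter> D = {}"
  shows "disjoint_supports (insert K F)"
  unfolding disjoint_supports_def
proof (intro conjI ballI impI)
  show "finite (insert K F)" "insert K F \<subseteq> supports" "{} \<notin> insert K F"
    using F K by (auto simp: disjoint_supports_def)
  fix D1 D2 assume "D1 \<in> insert K F" "D2 \<in> insert K F" "D1 \<noteq> D2"
  then consider "D1 = K" "D2 \<in> F" | "D1 \<in> F" "D2 = K" | "D1 \<in> F" "D2 \<in> F" by blast
  then show "D1 \<inter> D2 = {}"
  proof cases
    case 2
    then show ?thesis using o[of D1] by (simp add: Int_commute)
  next
    case 3
    then show ?thesis using F \<open>D1 \<noteq> D2\<close> by (simp add: disjoint_supports_def)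
  qed (use o in simp)
qed

text \<open>Transitivity moves one point \<open>x\<close> into every member of \<open>F\<close>.
  Intersecting the finitely many domains gives a common domain \<open>D\<close> around
  \<open>x\<close>, and the restrictions to \<open>D\<close> are matrix units indexed by
  \<open>F\<close>.\<close>

lemma card_disjoint_supports:
  assumes sat: "rel_sat A E" and h: "symmetric_inverse (Suc h) \<notin> bias_variety E" and F: "disjoint_supports F"
  shows "card F \<le> h"
proof (rule ccontr)
  assume "\<not> card F \<le> h"
  then have card: "Suc h \<le> card F" by simp
  have fin: "finite F" and Fs: "F \<subseteq> supports" and ne: "\<And>D. D \<in> F \<Longrightarrow> D \<noteq> {}"
    and disj: "\<And>D E. D \<in> F \<Longrightarrow> E \<in> F \<Longrightarrow> D \<noteq> E \<Longrightarrow> D \<inter> E = {}"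
    using F unfolding disjoint_supports_def by blast+
  obtain D0 where D0: "D0 \<in> F" using card by (cases "F = {}") auto
  obtain x where x: "x \<in> D0" using ne D0 by blast
  have "\<forall>D\<in>F. \<exists>s\<in>A. \<exists>y\<in>D. (x, y) \<in> s"
  proof
    fix D assume D: "D \<in> F"
    then obtain y where "y \<in> D" using ne by blast
    then show "\<exists>s\<in>A. \<exists>y\<in>D. (x, y) \<in> s" using trans_supports[of D0 D x y] D0 D Fs x by blast
  qed
  then obtain t where t: "\<And>D. D \<in> F \<Longrightarrow> t D \<in> A" "\<And>D. D \<in> F \<Longrightarrow> \<exists>y\<in>D. (x, y) \<in> t D" by metis
  define u where "u D = t D \<inter> Domain (t D) \<times> D" for D
  have u: "u D \<in> A" "x \<in> Domain (u D)" if "D \<in> F" for D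
    using t[OF that] that Fs restrict_mem[OF t(1)[OF that] Domain_supports[OF t(1)[OF that]], of D]
    by (auto simp: u_def)
  define D where "D = \<Inter>((\<lambda>D. Domain (u D)) ` F)"
  have D: "D \<in> supports" unfolding D_def
    using fin D0 u by (intro finite_Inter_supports) (auto intro: Domain_supports)
  have "x \<in> D" using u by (auto simp: D_def)
  have satF: "rel_sat {r. pbij r \<and> r \<subseteq> F \<times> F} E"
  proof (rule matrix_units_sat[where s = "\<lambda>E. u E \<inter> D \<times> E" and D = D, OF fin _ _ _ _ sat])
    show "u E \<inter> D \<times> E \<in> A" if "E \<in> F" for E
      using restrict_mem[OF u(1)[OF that] D] that Fs by blast
    show "Domain (u E \<inter> D \<times> E) = D" if "E \<in> F" for E
    proof
      show "D \<subseteq> Domain (u E \<inter> D \<times> E)"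
      proof
        fix a assume a: "a \<in> D"
        then have "a \<in> Domain (u E)" using that by (auto simp: D_def)
        then obtain b where "(a, b) \<in> u E" by blast
        then have "(a, b) \<in> u E \<inter> D \<times> E" using a by (simp add: u_def)
        then show "a \<in> Domain (u E \<inter> D \<times> E)" by (rule DomainI)
      qed
    qed blast
    show "D \<noteq> {}" using \<open>x \<in> D\<close> by blast
    show "Range (u E \<inter> D \<times> E) \<inter> Range (u E' \<inter> D \<times> E') = {}" if "E \<in> F" "E' \<in> F" "E \<noteq> E'" for E E'
      using disj[OF that] by blast
  qed
  have "rel_sat (pbij_upto (Suc h)) E"
    by (rule rel_sat_pbij_card_le[OF _ fin _ satF]) (simp_all add: card)
  then show False using h by (simp add: symmetric_inverse_in_variety_iff)
qed

text \<open>Take a disjoint family of maximal size. A member that properly meets a support could be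
  split in two, and a support not covered would contribute a new member; either would enlarge the
  family.\<close>

lemma atomic_supports:
  assumes bound: "\<And>F. disjoint_supports F \<Longrightarrow> card F \<le> h"
  obtains F where "disjoint_supports F" "F \<noteq> {}"
    "\<And>D E. D \<in> F \<Longrightarrow> E \<in> supports \<Longrightarrow> E \<inter> D \<noteq> {} \<Longrightarrow> D \<subseteq> E"
    "\<And>E. E \<in> supports \<Longrightarrow> E \<subseteq> \<Union>F"
proof -
  have "disjoint_supports {}" by (simp add: disjoint_supports_def)
  then obtain F where F: "disjoint_supports F" and max: "\<And>G. disjoint_supports G \<Longrightarrow> card G \<le> card F"
    using ex_has_greatest_nat[of disjoint_supports "{}" card "Suc h"] bound by (metis le_imp_less_Suc)
  have fin: "finite F" and Fs: "F \<subseteq> supports" and ne: "{} \<notin> F"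
    and disj: "\<And>D E. D \<in> F \<Longrightarrow> E \<in> F \<Longrightarrow> D \<noteq> E \<Longrightarrow> D \<inter> E = {}"
    using F unfolding disjoint_supports_def by blast+
  have cover: "E \<subseteq> \<Union>F" if E: "E \<in> supports" for E
  proof (rule ccontr)
    assume n: "\<not> E \<subseteq> \<Union>F"
    have "\<Union>F \<in> supports" by (rule finite_Union_supports[OF fin Fs])
    then have "E - \<Union>F \<in> supports" using E Diff_supports by blast
    then have "disjoint_supports (insert (E - \<Union>F) F)"
      by (intro disjoint_supports_insert F) (use n in auto)
    then have "card (insert (E - \<Union>F) F) \<le> card F" by (rule max)
    moreover have "E - \<Union>F \<notin> F" using n by blast
    ultimately show False using fin by simp
  qed
  have atom: "D \<subseteq> E" if D: "D \<in> F" and E: "E \<in> supports" and i: "E \<inter> D \<noteq> {}" for D E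
  proof (rule ccontr)
    assume n: "\<not> D \<subseteq> E"
    let ?G = "insert (D \<inter> E) (insert (D - E) (F - {D}))"
    have s: "D \<inter> E \<in> supports" "D - E \<in> supports" using D E Fs Int_supports Diff_supports by blast+
    have o: "D \<inter> D' = {}" if "D' \<in> F - {D}" for D' using disj[OF D, of D'] that by blast
    have d: "D - E \<noteq> {}" "D \<inter> E \<noteq> {}" using n i by auto
    have "disjoint_supports (F - {D})" using F unfolding disjoint_supports_def by auto
    then have "disjoint_supports (insert (D - E) (F - {D}))"
      by (rule disjoint_supports_insert[OF _ s(2) d(1)]) (use o in blast)
    then have "disjoint_supports ?G"
      by (rule disjoint_supports_insert[OF _ s(1) d(2)]) (use o in blast)
    then have "card ?G \<le> card F" by (rule max)
    moreover have nin: "D \<inter> E \<notin> insert (D - E) (F - {D})" "D - E \<notin> F - {D}"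
      using o[of "D \<inter> E"] o[of "D - E"] d by blast+
    have "card ?G = Suc (Suc (card (F - {D})))" using fin nin by simp
    moreover have "card F = Suc (card (F - {D}))" using card.remove[OF fin D] by simp
    ultimately show False by simp
  qed
  have "F \<noteq> {}"
  proof
    assume "F = {}"
    obtain p where "p \<in> A" "p \<noteq> {}" using nontrivial by blast
    then have "Domain p \<subseteq> {}" using cover[OF Domain_supports, of p] \<open>F = {}\<close> by simp
    then show False using \<open>p \<noteq> {}\<close> by auto
  qed
  then show ?thesis using that F atom cover by blast
qed

end

section \<open>Generalized rook matrices over a group with zero\<close>

locale group_with_zero = group G for G :: "'g monoid" (structure)
begin

lemma carrier_group_adjoin_zero: "carrier (group_adjoin_zero G) = insert None (Some ` carrier G)"
  and szero_group_adjoin_zero: "szero (group_adjoin_zero G) = None"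
  by (simp_all add: group_adjoin_zero_def)

lemma smul_group_adjoin_zero:
  "smul (group_adjoin_zero G) (Some a) (Some b) = Some (a \<otimes> b)"
  "smul (group_adjoin_zero G) None y = None"
  "smul (group_adjoin_zero G) x None = None"
  by (simp_all add: group_adjoin_zero_def split: option.splits)

lemma sinv_group_adjoin_zero_None: "sinv (group_adjoin_zero G) None = None"
  unfolding sinv_def
  by (rule the_equality) (auto simp: is_sinv_def carrier_group_adjoin_zero smul_group_adjoin_zero)

lemma sinv_group_adjoin_zero_Some:
  assumes "a \<in> carrier G" shows "sinv (group_adjoin_zero G) (Some a) = Some (inv a)"
  unfolding sinv_def
proof (rule the_equality)
  show "is_sinv (group_adjoin_zero G) (Some a) (Some (inv a))"
    using assms by (simp add: is_sinv_def carrier_group_adjoin_zero smul_group_adjoin_zero)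
next
  fix y assume "is_sinv (group_adjoin_zero G) (Some a) y"
  then obtain b where b: "y = Some b" "b \<in> carrier G" "a = a \<otimes> b \<otimes> a"
    by (auto simp: is_sinv_def carrier_group_adjoin_zero smul_group_adjoin_zero)
  then have "a \<otimes> b = \<one>" using assms by (metis m_closed r_cancel_one')
  then show "y = Some (inv a)" using b(1,2) assms inv_comm inv_equality by metis
qed

lemma le_group_adjoin_zero:
  assumes "x \<in> carrier (group_adjoin_zero G)" "y \<in> carrier (group_adjoin_zero G)"
  shows "le (natural_order (group_adjoin_zero G)) x y \<longleftrightarrow> x = None \<or> x = y"
  using assms
  by (auto simp: natural_order_def sdom_def carrier_group_adjoin_zero smul_group_adjoin_zero
      sinv_group_adjoin_zero_None sinv_group_adjoin_zero_Some)

text \<open>The natural order of a group with zero is flat. In an entry of a product of rook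
  matrices all nonzero terms coincide, so the defining joins are of this form.\<close>

lemma Sup_group_adjoin_zero:
  assumes Z: "Z \<subseteq> carrier (group_adjoin_zero G)" and w: "w \<in> Z" "\<And>z. z \<in> Z \<Longrightarrow> z = None \<or> z = w"
  shows "\<Squnion>\<^bsub>natural_order (group_adjoin_zero G)\<^esub> Z = w"
proof -
  let ?L = "natural_order (group_adjoin_zero G)"
  have c: "carrier ?L = carrier (group_adjoin_zero G)" by (simp add: natural_order_def)
  have U: "Upper ?L Z = {u \<in> carrier (group_adjoin_zero G). w = None \<or> w = u}"
    using Z w le_group_adjoin_zero unfolding Upper_def c by blast
  have "least ?L z (Upper ?L Z) \<longleftrightarrow> z = w" for z
    unfolding least_def U c using Z w(1) le_group_adjoin_zero by blast
  then show ?thesis by (simp add: Lattice.sup_def)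
qed

text \<open>In a group with zero a product vanishes only if a factor does; so the condition on rook
  matrices says that each row and each column has at most one nonzero entry.\<close>

lemma sinv_mult_group_adjoin_zero:
  assumes "x \<in> carrier (group_adjoin_zero G)" "y \<in> carrier (group_adjoin_zero G)"
  shows "smul (group_adjoin_zero G) (sinv (group_adjoin_zero G) x) y = None \<longleftrightarrow> x = None \<or> y = None"
    and "smul (group_adjoin_zero G) x (sinv (group_adjoin_zero G) y) = None \<longleftrightarrow> x = None \<or> y = None"
  using assms
  by (auto simp: carrier_group_adjoin_zero smul_group_adjoin_zero sinv_group_adjoin_zero_None
      sinv_group_adjoin_zero_Some)

end

lemma relcomp_Id_on: "Range r \<subseteq> X \<Longrightarrow> r O Id_on X = r"
proof (intro equalityI subrelI)
  fix a b assume "Range r \<subseteq> X" "(a, b) \<in> r"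
  then have "b \<in> X" by blast
  then show "(a, b) \<in> r O Id_on X" using \<open>(a, b) \<in> r\<close> by blast
qed auto

lemma relcomp_Id_on_left: "Domain r \<subseteq> X \<Longrightarrow> Id_on X O r = r"
proof (intro equalityI subrelI)
  fix a b assume "Domain r \<subseteq> X" "(a, b) \<in> r"
  then have "a \<in> X" by blast
  then show "(a, b) \<in> Id_on X O r" using \<open>(a, b) \<in> r\<close> by blast
qed auto

lemma bias_isomorphic_if_same_representation:
  assumes "rel_representation S \<rho> A" "rel_representation T \<rho>' A" shows "bias_isomorphic S T"
proof -
  interpret S: rel_representation S \<rho> A by fact
  interpret T: rel_representation T \<rho>' A by fact
  define f where "f x = T.of_rel (\<rho> x)" for x
  have f: "f x \<in> carrier T" "\<rho>' (f x) = \<rho> x" if "x \<in> carrier S" for x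
    using that by (simp_all add: f_def T.of_rel_closed T.rep_of_rel S.rep_mem)
  have eqI: "f x = y" if "x \<in> carrier S" "y \<in> carrier T" "\<rho>' y = \<rho> x" for x y
    using T.of_rel_unique[OF that(2)] that(3) by (simp add: f_def)
  have "f \<in> bias_hom S T" unfolding bias_hom_def
  proof (intro CollectI conjI ballI impI)
    show "f \<in> carrier S \<rightarrow> carrier T" using f by blast
    show "f (szero S) = szero T" by (rule eqI) (simp_all add: S.zero_closed T.zero_closed S.rep_zero T.rep_zero)
    fix x y assume xy: "x \<in> carrier S" "y \<in> carrier S"
    show "f (x \<odot>\<^bsub>S\<^esub> y) = f x \<odot>\<^bsub>T\<^esub> f y"
      using xy f by (intro eqI) (simp_all add: S.mult_closed T.mult_closed S.rep_mult T.rep_mult)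
    assume o: "orthogonal S x y"
    then have o': "orthogonal T (f x) (f y)" using xy f by (simp add: S.orthogonal_iff T.orthogonal_iff)
    show "f (oplus S x y) = oplus T (f x) (f y)"
      using xy f o o' by (intro eqI) (simp_all add: S.rep_oplus T.rep_oplus)
  qed
  moreover have "bij_betw f (carrier S) (carrier T)"
  proof (rule bij_betwI[where g = "\<lambda>y. S.of_rel (\<rho>' y)"])
    show "f \<in> carrier S \<rightarrow> carrier T" using f by blast
    show "(\<lambda>y. S.of_rel (\<rho>' y)) \<in> carrier T \<rightarrow> carrier S" by (simp add: S.of_rel_closed T.rep_mem)
    show "S.of_rel (\<rho>' (f x)) = x" if "x \<in> carrier S" for x
      using S.of_rel_unique[OF that] f that by simp
    show "f (S.of_rel (\<rho>' y)) = y" if "y \<in> carrier T" for y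
      using that by (intro eqI) (simp_all add: S.of_rel_closed T.rep_mem S.rep_of_rel)
  qed
  ultimately show ?thesis unfolding bias_isomorphic_def by blast
qed

text \<open>
  The assumptions below say that the idempotents of \<open>S\<close> form a finite Boolean algebra with atoms
  \<open>D i\<close>, and that bijections \<open>s i\<close> in \<open>A\<close> map \<open>D 0\<close> onto \<open>D i\<close>. The group is the one of all
  bijections of \<open>D 0\<close> in \<open>A\<close>, and \<open>x\<close> has the matrix entries \<open>(s i)\<inverse> \<circ> x \<circ> s j\<close>.
\<close>

locale atomic_representation = rel_representation S \<rho> A
  for S :: "'a semigroup0" (structure) and \<rho> :: "'a \<Rightarrow> ('x \<times> 'x) set" and A +
  fixes n :: nat and D :: "nat \<Rightarrow> 'x set" and s :: "nat \<Rightarrow> ('x \<times> 'x) set"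
  assumes pos: "0 < n"
    and D_supports: "i < n \<Longrightarrow> D i \<in> supports"
    and D_nonempty: "i < n \<Longrightarrow> D i \<noteq> {}"
    and D_disjoint: "i < n \<Longrightarrow> j < n \<Longrightarrow> i \<noteq> j \<Longrightarrow> D i \<inter> D j = {}"
    and D_atom: "i < n \<Longrightarrow> E \<in> supports \<Longrightarrow> E \<inter> D i \<noteq> {} \<Longrightarrow> D i \<subseteq> E"
    and D_cover: "E \<in> supports \<Longrightarrow> E \<subseteq> (\<Union>i<n. D i)"
    and s_mem: "i < n \<Longrightarrow> s i \<in> A"
    and s_Domain: "i < n \<Longrightarrow> Domain (s i) = D 0"
    and s_Range: "i < n \<Longrightarrow> Range (s i) = D i"
begin

definition H :: "('x \<times> 'x) set set" where
  "H = {r \<in> A. Domain r = D 0 \<and> Range r = D 0}"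

text \<open>Transported from relations to elements of \<open>S\<close>, since
  \<open>fully_group_matricial\<close> asks for a group over the type of \<open>S\<close>.\<close>

definition grp :: "'a monoid" where
  "grp = \<lparr>carrier = of_rel ` H, monoid.mult = smul S, one = of_rel (Id_on (D 0))\<rparr>"

lemma H_mem: "r \<in> H \<Longrightarrow> r \<in> A"
  by (simp add: H_def)

lemma H_nonempty: "r \<in> H \<Longrightarrow> r \<noteq> {}"
  using D_nonempty[OF pos] by (auto simp: H_def)

lemma H_comp: "r \<in> H \<Longrightarrow> q \<in> H \<Longrightarrow> r O q \<in> H"
  unfolding H_def by (auto intro: comp_mem) blast+

lemma H_converse: "r \<in> H \<Longrightarrow> r\<inverse> \<in> H"
  unfolding H_def by (auto intro: converse_mem)

lemma H_one: "Id_on (D 0) \<in> H"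
  using D_supports[OF pos] by (auto simp: H_def supports_iff)

text \<open>The domain and the range are nonempty supports inside the atom \<open>D 0\<close>, so
  both are all of it. This is why each matrix entry is a group element or zero.\<close>

lemma atom_mem_H:
  assumes "r \<in> A" "r \<noteq> {}" "Domain r \<subseteq> D 0" "Range r \<subseteq> D 0" shows "r \<in> H"
proof -
  have "Domain r \<inter> D 0 \<noteq> {}" "Range r \<inter> D 0 \<noteq> {}" using assms by auto
  then have "D 0 \<subseteq> Domain r" "D 0 \<subseteq> Range r"
    using D_atom[OF pos Domain_supports] D_atom[OF pos Range_supports] assms(1) by blast+
  then show ?thesis using assms by (auto simp: H_def)
qed

lemma H_subset_eq: "r \<in> H \<Longrightarrow> q \<in> H \<Longrightarrow> r \<subseteq> q \<Longrightarrow> r = q"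
proof (rule subset_antisym)
  assume r: "r \<in> H" "q \<in> H" "r \<subseteq> q"
  show "q \<subseteq> r"
  proof (rule subrelI)
    fix a b assume ab: "(a, b) \<in> q"
    then have "a \<in> Domain r" using r unfolding H_def by blast
    then obtain c where "(a, c) \<in> r" by blast
    then show "(a, b) \<in> r" using ab r pbij_fun[OF elem_pbij[OF H_mem[OF r(2)]]] by blast
  qed
qed simp

lemma of_rel_mult: "r \<in> A \<Longrightarrow> q \<in> A \<Longrightarrow> of_rel r \<odot> of_rel q = of_rel (q O r)"
  by (rule of_rel_unique) (simp_all add: mult_closed of_rel_closed rep_mult rep_of_rel)

lemma of_rel_eq_iff: "r \<in> A \<Longrightarrow> q \<in> A \<Longrightarrow> of_rel r = of_rel q \<longleftrightarrow> r = q"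
  by (metis rep_of_rel)

lemma group_grp: "group grp"
proof (rule groupI)
  show "x \<otimes>\<^bsub>grp\<^esub> y \<in> carrier grp" if "x \<in> carrier grp" "y \<in> carrier grp" for x y
    using that by (auto simp: grp_def of_rel_mult H_mem H_comp)
  show "\<one>\<^bsub>grp\<^esub> \<in> carrier grp" using H_one by (simp add: grp_def)
  show "x \<otimes>\<^bsub>grp\<^esub> y \<otimes>\<^bsub>grp\<^esub> z = x \<otimes>\<^bsub>grp\<^esub> (y \<otimes>\<^bsub>grp\<^esub> z)"
    if "x \<in> carrier grp" "y \<in> carrier grp" "z \<in> carrier grp" for x y z
    using that by (auto simp: grp_def of_rel_mult H_mem comp_mem O_assoc)
  show "\<one>\<^bsub>grp\<^esub> \<otimes>\<^bsub>grp\<^esub> x = x" if x: "x \<in> carrier grp" for x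
  proof -
    obtain r where r: "r \<in> H" "x = of_rel r" using x by (auto simp: grp_def)
    have "r O Id_on (D 0) = r" using r(1) by (auto simp: H_def)
    then show ?thesis using r H_mem H_one by (simp add: grp_def of_rel_mult)
  qed
  show "\<exists>y\<in>carrier grp. y \<otimes>\<^bsub>grp\<^esub> x = \<one>\<^bsub>grp\<^esub>" if x: "x \<in> carrier grp" for x
  proof -
    obtain r where r: "r \<in> H" "x = of_rel r" using x by (auto simp: grp_def)
    have "r O r\<inverse> = Id_on (D 0)" using pbij_comp_converse[OF elem_pbij[OF H_mem[OF r(1)]]] r(1) by (simp add: H_def)
    then have "of_rel (r\<inverse>) \<otimes>\<^bsub>grp\<^esub> x = \<one>\<^bsub>grp\<^esub>"
      using r H_mem H_converse by (simp add: grp_def of_rel_mult)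
    then show ?thesis using H_converse[OF r(1)] by (auto simp: grp_def)
  qed
qed

definition enc :: "('x \<times> 'x) set \<Rightarrow> 'a option" where
  "enc r = (if r = {} then None else Some (of_rel r))"

abbreviation G0 :: "'a option semigroup0" where
  "G0 \<equiv> group_adjoin_zero grp"

lemma carrier_G0: "carrier G0 = enc ` insert {} H"
  using H_nonempty by (auto simp: group_adjoin_zero_def grp_def enc_def image_iff)

lemma enc_mult:
  assumes "r \<in> insert {} H" "q \<in> insert {} H" shows "enc r \<odot>\<^bsub>G0\<^esub> enc q = enc (q O r)"
proof (cases "r = {} \<or> q = {}")
  case True
  then show ?thesis by (auto simp: enc_def group_adjoin_zero_def split: option.splits)
next
  case False
  then have "r \<in> H" "q \<in> H" using assms by auto
  then have "q O r \<noteq> {}" using H_comp H_nonempty by blast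
  then show ?thesis using False \<open>r \<in> H\<close> \<open>q \<in> H\<close>
    by (simp add: enc_def group_adjoin_zero_def grp_def of_rel_mult H_mem)
qed

lemma enc_inj: "r \<in> insert {} H \<Longrightarrow> q \<in> insert {} H \<Longrightarrow> enc r = enc q \<Longrightarrow> r = q"
  using H_mem of_rel_eq_iff by (auto simp: enc_def split: if_splits)

definition entry :: "('x \<times> 'x) set \<Rightarrow> nat \<Rightarrow> nat \<Rightarrow> ('x \<times> 'x) set" where
  "entry r i j = s j O r O (s i)\<inverse>"

lemma entry_mem:
  assumes "r \<in> A" "i < n" "j < n" shows "entry r i j \<in> insert {} H"
proof (cases "entry r i j = {}")
  case False
  have "entry r i j \<in> A" using assms by (simp add: entry_def comp_mem converse_mem s_mem)
  moreover have "Domain (entry r i j) \<subseteq> D 0" "Range (entry r i j) \<subseteq> D 0"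
    using s_Domain[OF assms(2)] s_Domain[OF assms(3)] unfolding entry_def by blast+
  ultimately show ?thesis using False atom_mem_H by blast
qed simp

lemma s_pbij: "i < n \<Longrightarrow> pbij (s i)"
  by (simp add: s_mem elem_pbij)

lemma D_unique: "i < n \<Longrightarrow> j < n \<Longrightarrow> a \<in> D i \<Longrightarrow> a \<in> D j \<Longrightarrow> i = j"
  using D_disjoint by blast

lemma entryE:
  assumes "(a, b) \<in> entry r i j" "i < n" "j < n"
  obtains c d where "(a, c) \<in> s j" "(c, d) \<in> r" "(b, d) \<in> s i" "c \<in> D j" "d \<in> D i"
  using assms s_Range[OF assms(2)] s_Range[OF assms(3)] unfolding entry_def by blast

lemma entry_comp:
  assumes r: "r \<in> A" and q: "q \<in> A" and ij: "i < n" "j < n"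
  shows "entry (q O r) i j = (\<Union>k<n. entry q k j O entry r i k)"
proof (intro equalityI subrelI)
  fix a b assume "(a, b) \<in> entry (q O r) i j"
  then obtain c d e where *: "(a, c) \<in> s j" "(c, e) \<in> q" "(e, d) \<in> r" "(b, d) \<in> s i"
    unfolding entry_def by blast
  have "e \<in> Domain r" using * by blast
  then obtain k where k: "k < n" "e \<in> D k" using D_cover[OF Domain_supports[OF r]] by blast
  then obtain f where "(f, e) \<in> s k" using s_Range by blast
  then have "(a, f) \<in> entry q k j" "(f, b) \<in> entry r i k" using * unfolding entry_def by blast+
  then show "(a, b) \<in> (\<Union>k<n. entry q k j O entry r i k)" using k by blast
next
  fix a b assume "(a, b) \<in> (\<Union>k<n. entry q k j O entry r i k)"
  then obtain k f where k: "k < n" "(a, f) \<in> entry q k j" "(f, b) \<in> entry r i k" by blast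
  obtain c e where 1: "(a, c) \<in> s j" "(c, e) \<in> q" "(f, e) \<in> s k" using k ij by (elim entryE) blast+
  obtain e' d where 2: "(f, e') \<in> s k" "(e', d) \<in> r" "(b, d) \<in> s i" using k ij by (elim entryE) blast+
  have "e = e'" using pbij_fun[OF s_pbij[OF k(1)] 1(3) 2(1)] .
  then show "(a, b) \<in> entry (q O r) i j" using 1 2 unfolding entry_def by blast
qed

lemma sum_entries:
  assumes r: "r \<in> A" shows "r = (\<Union>i<n. \<Union>j<n. (s j)\<inverse> O entry r i j O s i)"
proof (intro equalityI subrelI)
  fix c d assume cd: "(c, d) \<in> r"
  obtain j where j: "j < n" "c \<in> D j" using D_cover[OF Domain_supports[OF r]] cd by blast
  obtain i where i: "i < n" "d \<in> D i" using D_cover[OF Range_supports[OF r]] cd by blast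
  obtain a where a: "(a, c) \<in> s j" using j s_Range by blast
  obtain b where b: "(b, d) \<in> s i" using i s_Range by blast
  have "(a, b) \<in> entry r i j" using a b cd unfolding entry_def by blast
  then show "(c, d) \<in> (\<Union>i<n. \<Union>j<n. (s j)\<inverse> O entry r i j O s i)" using i j a b by blast
next
  fix c d assume "(c, d) \<in> (\<Union>i<n. \<Union>j<n. (s j)\<inverse> O entry r i j O s i)"
  then obtain i j a b where ij: "i < n" "j < n" "(a, c) \<in> s j" "(a, b) \<in> entry r i j" "(b, d) \<in> s i" by blast
  then obtain c' d' where "(a, c') \<in> s j" "(c', d') \<in> r" "(b, d') \<in> s i" by (elim entryE)
  then show "(c, d) \<in> r" using ij pbij_fun[OF s_pbij] by metis
qed

text \<open>Nonempty entries have full range, so two of them in row \<open>i\<close> share a value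
  \<open>b\<close>. The point to which \<open>s i\<close> sends \<open>b\<close> has one preimage
  under \<open>r\<close>, and it lies in \<open>D j\<close> as well as in
  \<open>D k\<close>.\<close>

lemma entry_row:
  assumes r: "r \<in> A" and i: "i < n" "j < n" "k < n" and ne: "entry r i j \<noteq> {}" "entry r i k \<noteq> {}"
  shows "j = k"
proof -
  have "entry r i j \<in> H" "entry r i k \<in> H" using entry_mem[OF r] i ne by blast+
  then have "Range (entry r i j) = D 0" "Range (entry r i k) = D 0" by (simp_all add: H_def)
  moreover obtain b where "b \<in> D 0" using D_nonempty[OF pos] by blast
  ultimately obtain a a' where "(a, b) \<in> entry r i j" "(a', b) \<in> entry r i k" by blast
  then obtain c d c' d' where "(c, d) \<in> r" "(b, d) \<in> s i" "c \<in> D j" "(c', d') \<in> r" "(b, d') \<in> s i" "c' \<in> D k"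
    using i by (metis entryE)
  then show ?thesis using pbij_fun[OF s_pbij[OF i(1)]] pbij_inj[OF elem_pbij[OF r]] D_unique i by metis
qed

lemma entry_column:
  assumes r: "r \<in> A" and i: "i < n" "j < n" "k < n" and ne: "entry r j i \<noteq> {}" "entry r k i \<noteq> {}"
  shows "j = k"
proof -
  have "entry r j i \<in> H" "entry r k i \<in> H" using entry_mem[OF r] i ne by blast+
  then have "Domain (entry r j i) = D 0" "Domain (entry r k i) = D 0" by (simp_all add: H_def)
  moreover obtain a where "a \<in> D 0" using D_nonempty[OF pos] by blast
  ultimately obtain b b' where "(a, b) \<in> entry r j i" "(a, b') \<in> entry r k i" by blast
  then obtain c d c' d' where "(a, c) \<in> s i" "(c, d) \<in> r" "d \<in> D j" "(a, c') \<in> s i" "(c', d') \<in> r" "d' \<in> D k"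
    using i by (metis entryE)
  then show ?thesis using pbij_fun[OF s_pbij[OF i(1)]] pbij_fun[OF elem_pbij[OF r]] D_unique i by metis
qed

definition to_matrix :: "('x \<times> 'x) set \<Rightarrow> 'a option mat" where
  "to_matrix r = mat n n (\<lambda>(i, j). enc (entry r i j))"

abbreviation rooks :: "'a option mat semigroup0" where
  "rooks \<equiv> rook_matrices n G0"

lemma carrier_rooks:
  "m \<in> carrier rooks \<longleftrightarrow> m \<in> carrier_mat n n \<and> (\<forall>i<n. \<forall>j<n. m $$ (i, j) \<in> carrier G0) \<and>
     (\<forall>i<n. \<forall>j<n. \<forall>k<n. j \<noteq> k \<longrightarrow> (m $$ (i, j) = None \<or> m $$ (i, k) = None) \<and>
        (m $$ (j, i) = None \<or> m $$ (k, i) = None))"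
proof -
  interpret G: group_with_zero grp by (intro group_with_zero.intro group_grp)
  show ?thesis
  proof (cases "\<forall>i<n. \<forall>j<n. m $$ (i, j) \<in> carrier G0")
    case True
    then have "smul G0 (sinv G0 (m $$ (i, j))) (m $$ (i, k)) = None \<longleftrightarrow> m $$ (i, j) = None \<or> m $$ (i, k) = None"
      "smul G0 (m $$ (j, i)) (sinv G0 (m $$ (k, i))) = None \<longleftrightarrow> m $$ (j, i) = None \<or> m $$ (k, i) = None"
      if "i < n" "j < n" "k < n" for i j k
      using that by (simp_all add: G.sinv_mult_group_adjoin_zero)
    then show ?thesis using True by (simp add: rook_matrices_def G.szero_group_adjoin_zero)
  next
    case False
    then show ?thesis unfolding rook_matrices_def by auto
  qed
qed

lemma to_matrix_closed:
  assumes r: "r \<in> A" shows "to_matrix r \<in> carrier rooks"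
  unfolding carrier_rooks
proof (intro conjI allI impI)
  show "to_matrix r \<in> carrier_mat n n" by (simp add: to_matrix_def)
  fix i j assume "i < n" "j < n"
  then show "to_matrix r $$ (i, j) \<in> carrier G0"
    using imageI[OF entry_mem[OF r], of i j enc] by (simp add: to_matrix_def carrier_G0)
next
  fix i j k assume i: "i < n" "j < n" "k < n" "j \<noteq> k"
  show "to_matrix r $$ (i, j) = None \<or> to_matrix r $$ (i, k) = None"
    using entry_row[OF r i(1-3)] i by (auto simp: to_matrix_def enc_def)
  show "to_matrix r $$ (j, i) = None \<or> to_matrix r $$ (k, i) = None"
    using entry_column[OF r i(1-3)] i by (auto simp: to_matrix_def enc_def)
qed

lemma to_matrix_mult:
  assumes r: "r \<in> A" and q: "q \<in> A"
  shows "to_matrix r \<odot>\<^bsub>rooks\<^esub> to_matrix q = to_matrix (q O r)"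
proof (rule eq_matI)
  interpret G: group_with_zero grp by (intro group_with_zero.intro group_grp)
  have rq: "q O r \<in> A" using r q comp_mem by blast
  fix i j assume "i < dim_row (to_matrix (q O r))" "j < dim_col (to_matrix (q O r))"
  then have ij: "i < n" "j < n" by (simp_all add: to_matrix_def)
  let ?t = "\<lambda>k. entry q k j O entry r i k"
  have t: "?t k \<in> insert {} H" if "k < n" for k
    using entry_mem[OF q that ij(2)] entry_mem[OF r ij(1) that] H_comp by auto
  have tot: "entry (q O r) i j = (\<Union>k<n. ?t k)" by (rule entry_comp[OF r q ij])
  have tm: "to_matrix r $$ (i, k) \<odot>\<^bsub>G0\<^esub> to_matrix q $$ (k, j) = enc (?t k)" if "k < n" for k
    using enc_mult[OF entry_mem[OF r ij(1) that] entry_mem[OF q that ij(2)]] that ij by (simp add: to_matrix_def)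
  \<comment> \<open>A nonempty term already lies in \<open>H\<close>, and so does the union that
    contains it; members of \<open>H\<close> have the same domain, so inclusion between them is
    equality.\<close>
  have each: "?t k = {} \<or> ?t k = entry (q O r) i j" if "k < n" for k
  proof (cases "?t k = {}")
    case False
    then have "?t k \<in> H" using t[OF that] by blast
    moreover have "?t k \<subseteq> entry (q O r) i j" unfolding tot using that by blast
    moreover have "entry (q O r) i j \<in> H" using entry_mem[OF rq ij] False \<open>?t k \<subseteq> _\<close> by blast
    ultimately show ?thesis using H_subset_eq by blast
  qed simp
  have "\<Squnion>\<^bsub>natural_order G0\<^esub> ((\<lambda>k. enc (?t k)) ` {..<n}) = enc (entry (q O r) i j)"
  proof (rule G.Sup_group_adjoin_zero)
    show "(\<lambda>k. enc (?t k)) ` {..<n} \<subseteq> carrier G0" using t unfolding carrier_G0 by blast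
    have "\<exists>k<n. ?t k = entry (q O r) i j"
    proof (cases "entry (q O r) i j = {}")
      case True
      then show ?thesis using each[OF pos] pos by auto
    next
      case False
      then obtain k where "k < n" "?t k \<noteq> {}" unfolding tot by blast
      then show ?thesis using each by blast
    qed
    then obtain k where "k < n" "?t k = entry (q O r) i j" by blast
    then show "enc (entry (q O r) i j) \<in> (\<lambda>k. enc (?t k)) ` {..<n}" by (intro image_eqI[of _ _ k]) simp_all
    fix z assume "z \<in> (\<lambda>k. enc (?t k)) ` {..<n}"
    then obtain k where "k < n" "z = enc (?t k)" by blast
    then show "z = None \<or> z = enc (entry (q O r) i j)" using each[of k] by (auto simp: enc_def)
  qed
  moreover have "(\<lambda>k. to_matrix r $$ (i, k) \<odot>\<^bsub>G0\<^esub> to_matrix q $$ (k, j)) ` {..<n} = (\<lambda>k. enc (?t k)) ` {..<n}"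
    by (rule image_cong) (simp_all add: tm)
  ultimately have "\<Squnion>\<^bsub>natural_order G0\<^esub> ((\<lambda>k. to_matrix r $$ (i, k) \<odot>\<^bsub>G0\<^esub> to_matrix q $$ (k, j)) ` {..<n}) =
    enc (entry (q O r) i j)" by simp
  then show "(to_matrix r \<odot>\<^bsub>rooks\<^esub> to_matrix q) $$ (i, j) = to_matrix (q O r) $$ (i, j)"
    using ij by (simp add: rook_matrices_def) (simp add: to_matrix_def)
qed (simp_all add: rook_matrices_def to_matrix_def)

lemma to_matrix_inj: "inj_on to_matrix A"
proof (rule inj_onI)
  fix r q assume r: "r \<in> A" and q: "q \<in> A" and eq: "to_matrix r = to_matrix q"
  have "entry r i j = entry q i j" if "i < n" "j < n" for i j
  proof (rule enc_inj[OF entry_mem[OF r that] entry_mem[OF q that]])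
    have "to_matrix r $$ (i, j) = to_matrix q $$ (i, j)" using eq by simp
    then show "enc (entry r i j) = enc (entry q i j)" using that by (simp add: to_matrix_def)
  qed
  then have "(\<Union>i<n. \<Union>j<n. (s j)\<inverse> O entry r i j O s i) = (\<Union>i<n. \<Union>j<n. (s j)\<inverse> O entry q i j O s i)" by simp
  then show "r = q" using sum_entries[OF r] sum_entries[OF q] by metis
qed

lemma to_matrix_surj:
  assumes m: "m \<in> carrier rooks" shows "m \<in> to_matrix ` A"
proof -
  have dim: "m \<in> carrier_mat n n" and ent': "\<forall>i<n. \<forall>j<n. m $$ (i, j) \<in> carrier G0"
    and rc: "\<forall>i<n. \<forall>j<n. \<forall>k<n. j \<noteq> k \<longrightarrow> (m $$ (i, j) = None \<or> m $$ (i, k) = None) \<and>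
        (m $$ (j, i) = None \<or> m $$ (k, i) = None)"
    by (rule m[unfolded carrier_rooks, THEN conjunct1] m[unfolded carrier_rooks, THEN conjunct2, THEN conjunct1]
        m[unfolded carrier_rooks, THEN conjunct2, THEN conjunct2])+
  have row: "m $$ (i, j) = None \<or> m $$ (i, k) = None" if "i < n" "j < n" "k < n" "j \<noteq> k" for i j k
    using rc that by simp
  have col: "m $$ (j, i) = None \<or> m $$ (k, i) = None" if "i < n" "j < n" "k < n" "j \<noteq> k" for i j k
    using rc that by simp
  define g where "g i j = (SOME r. r \<in> insert {} H \<and> m $$ (i, j) = enc r)" for i j
  have g: "g i j \<in> insert {} H" "m $$ (i, j) = enc (g i j)" if ij: "i < n" "j < n" for i j
  proof -
    have "m $$ (i, j) \<in> enc ` insert {} H" using ent' ij unfolding carrier_G0 by simp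
    then obtain r where "r \<in> insert {} H \<and> m $$ (i, j) = enc r" by (elim imageE) simp
    then have "g i j \<in> insert {} H \<and> m $$ (i, j) = enc (g i j)" unfolding g_def by (rule someI)
    then show "g i j \<in> insert {} H" "m $$ (i, j) = enc (g i j)" by simp_all
  qed
  have none: "m $$ (i, j) = None \<longleftrightarrow> g i j = {}" if "i < n" "j < n" for i j
    using g(2)[OF that] by (simp add: enc_def)
  have gA: "g i j \<in> A" "Domain (g i j) \<subseteq> D 0" "Range (g i j) \<subseteq> D 0" if "i < n" "j < n" for i j
    using g(1)[OF that] empty_mem by (auto simp: H_def)
  let ?u = "\<lambda>(i, j). (s j)\<inverse> O g i j O s i"
  \<comment> \<open>The partial bijection is reassembled from the entries. The pieces are orthogonal
    because two nonzero entries never share a row or a column.\<close>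
  define r where "r = (\<Union>p\<in>{..<n} \<times> {..<n}. ?u p)"
  have rA: "r \<in> A" unfolding r_def
  proof (rule finite_Un_mem)
    show "finite ({..<n} \<times> {..<n})" by simp
    show "?u p \<in> A" if "p \<in> {..<n} \<times> {..<n}" for p
      using that gA s_mem comp_mem converse_mem by auto
    fix p p' assume p: "p \<in> {..<n} \<times> {..<n}" and p': "p' \<in> {..<n} \<times> {..<n}" and neq: "p \<noteq> p'"
    obtain i j i' j' where [simp]: "p = (i, j)" "p' = (i', j')" by (cases p, cases p')
    have lt: "i < n" "j < n" "i' < n" "j' < n" using p p' by auto
    have sub: "Domain (?u p) \<subseteq> D j" "Range (?u p) \<subseteq> D i" "Domain (?u p') \<subseteq> D j'" "Range (?u p') \<subseteq> D i'"
      using s_Range[OF lt(1)] s_Range[OF lt(2)] s_Range[OF lt(3)] s_Range[OF lt(4)] by auto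
    show "Domain (?u p) \<inter> Domain (?u p') = {} \<and> Range (?u p) \<inter> Range (?u p') = {}"
    proof (cases "?u p = {} \<or> ?u p' = {}")
      case False
      then have "g i j \<noteq> {}" "g i' j' \<noteq> {}" by auto
      then have "m $$ (i, j) \<noteq> None" "m $$ (i', j') \<noteq> None" using none lt by blast+
      then have "i \<noteq> i'" "j \<noteq> j'" using row[of i j j'] col[of j i i'] neq lt by auto
      then have "D i \<inter> D i' = {}" "D j \<inter> D j' = {}" using D_disjoint lt by blast+
      then show ?thesis using sub by blast
    qed auto
  qed
  have ent_r: "entry r i j = g i j" if ij: "i < n" "j < n" for i j
  proof (intro equalityI subrelI)
    fix a b assume "(a, b) \<in> entry r i j"
    then obtain c d where *: "(a, c) \<in> s j" "(c, d) \<in> r" "(b, d) \<in> s i" "c \<in> D j" "d \<in> D i" using ij by (elim entryE)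
    from *(2) obtain i' j' a' b' where 1: "i' < n" "j' < n" "(a', c) \<in> s j'" "(a', b') \<in> g i' j'" "(b', d) \<in> s i'"
      unfolding r_def by auto
    have "c \<in> D j'" "d \<in> D i'" using 1 s_Range by blast+
    then have "j' = j" "i' = i" using D_unique 1 ij * by blast+
    then have "a' = a" "b' = b" using pbij_inj[OF s_pbij] 1 * by blast+
    then show "(a, b) \<in> g i j" using 1 \<open>j' = j\<close> \<open>i' = i\<close> by simp
  next
    fix a b assume ab: "(a, b) \<in> g i j"
    then have "a \<in> D 0" "b \<in> D 0" using gA[OF ij] by blast+
    then obtain c d where cd: "(a, c) \<in> s j" "(b, d) \<in> s i" using s_Domain ij by blast
    then have "(c, d) \<in> ?u (i, j)" using ab by auto
    then have "(c, d) \<in> r" unfolding r_def using ij by blast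
    then show "(a, b) \<in> entry r i j" unfolding entry_def using cd by blast
  qed
  have "m = to_matrix r"
    by (rule eq_matI) (use dim in \<open>auto simp: to_matrix_def ent_r g(2)\<close>)
  then show ?thesis using rA by blast
qed

text \<open>The inverse of \<open>to_matrix\<close> represents the rook matrices by the same
  relations as \<open>S\<close>. This makes them a bias and yields the isomorphism at once.\<close>

lemma rel_representation_rooks: "rel_representation rooks (inv_into A to_matrix) A"
proof -
  have bij: "to_matrix ` A = carrier rooks" using to_matrix_closed to_matrix_surj by blast
  have inv: "inv_into A to_matrix (to_matrix r) = r" if "r \<in> A" for r
    using that to_matrix_inj by simp
  have zero: "szero rooks = to_matrix {}"
    by (rule eq_matI) (auto simp: rook_matrices_def to_matrix_def entry_def enc_def group_adjoin_zero_def)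
  show ?thesis
  proof (intro rel_representation.intro rel_representation_axioms.intro rel_bias_axioms)
    show "szero rooks \<in> carrier rooks" using zero to_matrix_closed[OF empty_mem] by simp
    show "inv_into A to_matrix (szero rooks) = {}" using zero inv[OF empty_mem] by simp
    show "inj_on (inv_into A to_matrix) (carrier rooks)"
      by (rule inj_on_inv_into) (simp add: bij)
    show "inv_into A to_matrix ` carrier rooks = A"
      unfolding bij[symmetric] using inv by (simp add: image_image)
    fix x y assume "x \<in> carrier rooks" "y \<in> carrier rooks"
    then obtain r q where "r \<in> A" "x = to_matrix r" "q \<in> A" "y = to_matrix q" using to_matrix_surj by blast
    then show "x \<odot>\<^bsub>rooks\<^esub> y \<in> carrier rooks"
      "inv_into A to_matrix (x \<odot>\<^bsub>rooks\<^esub> y) = inv_into A to_matrix y O inv_into A to_matrix x"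
      by (simp_all add: to_matrix_mult to_matrix_closed comp_mem inv)
  qed
qed

theorem fully_group_matricial: "fully_group_matricial S"
proof -
  have "(\<Union>i<n. D i) \<in> supports" using D_supports by (intro finite_Union_supports) auto
  then have u: "of_rel (Id_on (\<Union>i<n. D i)) \<in> carrier S" "\<rho> (of_rel (Id_on (\<Union>i<n. D i))) = Id_on (\<Union>i<n. D i)"
    by (simp_all add: supports_iff of_rel_closed rep_of_rel)
  have "of_rel (Id_on (\<Union>i<n. D i)) \<odot> x = x" "x \<odot> of_rel (Id_on (\<Union>i<n. D i)) = x" if x: "x \<in> carrier S" for x
  proof -
    have "Domain (\<rho> x) \<subseteq> (\<Union>i<n. D i)" "Range (\<rho> x) \<subseteq> (\<Union>i<n. D i)"
      by (rule D_cover Domain_supports Range_supports rep_mem x)+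
    note eqs = relcomp_Id_on[OF this(2)] relcomp_Id_on_left[OF this(1)]
    show "of_rel (Id_on (\<Union>i<n. D i)) \<odot> x = x" "x \<odot> of_rel (Id_on (\<Union>i<n. D i)) = x"
      using u x eqs by (simp_all add: rep_eq_iff[symmetric] mult_closed rep_mult)
  qed
  moreover have "bias_isomorphic S rooks"
    by (rule bias_isomorphic_if_same_representation[OF rel_representation_axioms rel_representation_rooks])
  ultimately show ?thesis
    unfolding fully_group_matricial_def using boolean_inverse_semigroup group_grp pos u(1) by blast
qed

end

lemma (in transitive_rel_bias) fully_group_matricial:
  assumes rep: "rel_representation S \<rho> A" and bound: "\<And>F. disjoint_supports F \<Longrightarrow> card F \<le> h"
  shows "fully_group_matricial S"
proof -
  interpret R: rel_representation S \<rho> A by (rule rep)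
  obtain F where F: "disjoint_supports F" "F \<noteq> {}"
    and atom: "\<And>D E. D \<in> F \<Longrightarrow> E \<in> supports \<Longrightarrow> E \<inter> D \<noteq> {} \<Longrightarrow> D \<subseteq> E"
    and cover: "\<And>E. E \<in> supports \<Longrightarrow> E \<subseteq> \<Union>F"
    using atomic_supports[OF bound] by blast
  have fin: "finite F" and Fs: "F \<subseteq> supports" and ne: "{} \<notin> F"
    and disj: "\<And>D E. D \<in> F \<Longrightarrow> E \<in> F \<Longrightarrow> D \<noteq> E \<Longrightarrow> D \<inter> E = {}"
    using F unfolding disjoint_supports_def by blast+
  obtain D where D: "bij_betw D {0..<card F} F" using ex_bij_betw_nat_finite[OF fin] by blast
  define n where "n = card F"
  have pos: "0 < n" using F(2) fin by (simp add: n_def card_gt_0_iff)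
  have DF: "D i \<in> F" if "i < n" for i using D that by (auto simp: bij_betw_def n_def)
  have Dinj: "D i \<noteq> D j" if "i < n" "j < n" "i \<noteq> j" for i j
    using D that by (auto simp: bij_betw_def inj_on_def n_def)
  have "D ` {..<n} = F" using D by (simp add: bij_betw_def n_def atLeast0LessThan)
  then have DU: "\<Union>F = (\<Union>i<n. D i)" by simp
  have "\<forall>i\<in>{..<n}. \<exists>t\<in>A. Domain t = D 0 \<and> Range t = D i"
  proof
    fix i assume "i \<in> {..<n}"
    then have i: "i < n" by simp
    have supp: "D 0 \<in> supports" "D i \<in> supports" using DF[OF pos] DF[OF i] Fs by blast+
    have "D 0 \<noteq> {}" "D i \<noteq> {}" using DF[OF pos] DF[OF i] ne by metis+
    then obtain x y where xy: "x \<in> D 0" "y \<in> D i" by blast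
    obtain t where t: "t \<in> A" "(x, y) \<in> t" using trans_supports[OF supp xy] by blast
    \<comment> \<open>Cut down to two atoms, a relation that connects a point of one to a point of
      the other is a bijection between them, because its domain and range are nonempty supports
      inside atoms.\<close>
    let ?t = "t \<inter> D 0 \<times> D i"
    have tA: "?t \<in> A" using restrict_mem[OF t(1)] DF[OF pos] DF[OF i] Fs by blast
    have "Domain ?t \<inter> D 0 \<noteq> {}" "Range ?t \<inter> D i \<noteq> {}" using t xy by blast+
    then have "D 0 \<subseteq> Domain ?t" "D i \<subseteq> Range ?t"
      using atom[OF DF[OF pos] Domain_supports[OF tA]] atom[OF DF[OF i] Range_supports[OF tA]] by blast+
    then have "Domain ?t = D 0 \<and> Range ?t = D i" by blast
    then show "\<exists>t\<in>A. Domain t = D 0 \<and> Range t = D i" using tA by blast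
  qed
  then obtain s where s: "\<And>i. i < n \<Longrightarrow> s i \<in> A \<and> Domain (s i) = D 0 \<and> Range (s i) = D i"
    by (metis lessThan_iff)
  interpret atomic_representation S \<rho> A n D s
  proof
    show "0 < n" by (rule pos)
    show "D i \<in> supports" if "i < n" for i using DF[OF that] Fs by blast
    show "D i \<noteq> {}" if "i < n" for i
    proof
      assume "D i = {}"
      then show False using DF[OF that] ne by simp
    qed
    show "D i \<inter> D j = {}" if "i < n" "j < n" "i \<noteq> j" for i j
      using disj[OF DF[OF that(1)] DF[OF that(2)] Dinj[OF that]] .
    show "D i \<subseteq> E" if "i < n" "E \<in> supports" "E \<inter> D i \<noteq> {}" for i E
      using atom[OF DF[OF that(1)] that(2,3)] .
    show "E \<subseteq> (\<Union>i<n. D i)" if "E \<in> supports" for E using cover[OF that] DU by simp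
    show "s i \<in> A" "Domain (s i) = D 0" "Range (s i) = D i" if "i < n" for i using s[OF that] by simp_all
  qed
  show ?thesis by (rule fully_group_matricial)
qed

text \<open>Transport of structure along an enumeration of \<open>A\<close>; it brings the countable
  subbias into the type over which the generating members are taken.\<close>

lemma (in rel_bias) rel_representation_nat:
  assumes "countable A"
  shows "\<exists>(T :: nat semigroup0) \<rho>. rel_representation T \<rho> A"
proof -
  define c where "c = to_nat_on A"
  have inj: "inj_on c A" unfolding c_def by (rule inj_on_to_nat_on[OF assms])
  have inv: "inv_into A c (c r) = r" if "r \<in> A" for r using inj that by simp
  let ?T = "\<lparr>carrier = c ` A, smul = (\<lambda>a b. c (inv_into A c b O inv_into A c a)), szero = c {}\<rparr>"
  have "rel_representation ?T (inv_into A c) A"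
  proof (intro rel_representation.intro rel_representation_axioms.intro rel_bias_axioms)
    show "inj_on (inv_into A c) (carrier ?T)" by (simp add: inj_on_inv_into)
    show "inv_into A c ` carrier ?T = A" using inv by (simp add: image_image)
    show "inv_into A c (szero ?T) = {}" using inv[OF empty_mem] by simp
    fix x y assume "x \<in> carrier ?T" "y \<in> carrier ?T"
    then show "x \<odot>\<^bsub>?T\<^esub> y \<in> carrier ?T" "inv_into A c (x \<odot>\<^bsub>?T\<^esub> y) = inv_into A c y O inv_into A c x"
      using inv comp_mem by auto
  qed (simp add: empty_mem)
  then show ?thesis by blast
qed

text \<open>Generation is read through identities: whatever holds in all fully group-matricial
  members over \<open>nat\<close> has to hold in every member over \<open>'a\<close>. An identity
  violated over \<open>'a\<close> is violated in such a member.\<close>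

theorem variety_generated_by_fully_group_matricial:
  assumes h: "symmetric_inverse (Suc h) \<notin> bias_variety E"
    and F: "{T \<in> (bias_variety E :: nat semigroup0 set). fully_group_matricial T} \<subseteq> bias_variety F"
  shows "(bias_variety E :: 'a semigroup0 set) \<subseteq> bias_variety F"
proof
  fix S :: "'a semigroup0" assume S: "S \<in> bias_variety E"
  then have "boolean_inverse_semigroup S" by (simp add: bias_variety_def)
  then interpret R: rel_representation S "inverse_semigroup0.germ_rep S"
    "inverse_semigroup0.germ_rep S ` carrier S"
    by (rule boolean_inverse_semigroup.rel_representation_germ_rep)
  let ?A = "inverse_semigroup0.germ_rep S ` carrier S"
  have sat: "rel_sat ?A E" using S R.bias_variety_iff by blast
  show "S \<in> bias_variety F"
  proof (rule ccontr)
    assume "S \<notin> bias_variety F"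
    then have "\<not> rel_sat ?A F" using R.bias_variety_iff by blast
    then obtain l r v where lr: "(l, r) \<in> F" "range v \<subseteq> ?A" "rel_eval v l \<noteq> rel_eval v r"
      unfolding rel_sat_def by blast
    obtain C :: "(('a set \<times> 'a set) \<times> 'a set \<times> 'a set) set set" and w where C: "rel_bias C" "countable C" "rel_sat C E"
      and w: "range w \<subseteq> C" "rel_eval w l \<noteq> rel_eval w r"
      and tr: "\<And>p q a b. p \<in> C \<Longrightarrow> q \<in> C \<Longrightarrow> a \<in> Domain p \<Longrightarrow> b \<in> Domain q \<Longrightarrow> \<exists>s\<in>C. (a, b) \<in> s"
      and nt: "\<exists>p\<in>C. p \<noteq> {}"
      by (rule R.countable_transitive_image[OF sat lr(2,3)]) (rule that; assumption)
    interpret C: transitive_rel_bias C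
      by (intro transitive_rel_bias.intro transitive_rel_bias_axioms.intro C(1) tr nt)
    obtain T :: "nat semigroup0" and \<rho> where T: "rel_representation T \<rho> C"
      using C.rel_representation_nat[OF C(2)] by blast
    interpret T: rel_representation T \<rho> C by (rule T)
    have "fully_group_matricial T"
      by (rule C.fully_group_matricial[OF T]) (rule C.card_disjoint_supports[OF C(3) h])
    moreover have "T \<in> bias_variety E" using T.bias_variety_iff C(3) by blast
    ultimately have "T \<in> bias_variety F" using F by blast
    then have "rel_sat C F" using T.bias_variety_iff by blast
    then have "rel_eval w l = rel_eval w r" by (rule rel_satD[OF _ lr(1) w(1)])
    then show False using w(2) by blast
  qed
qed

section \<open>The universal monoid of a partial refinement monoid\<close>

text \<open>The properties of a type interval that make its universal monoid a conical refinement
  monoid. Associativity in the other direction follows from \<open>psum_comm\<close>.\<close>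

locale partial_refinement_monoid =
  fixes P :: "'a partial_monoid"
  assumes psum_closed: "psum P a b c \<Longrightarrow> a \<in> carrier P \<and> b \<in> carrier P \<and> c \<in> carrier P"
    and psum_fun: "psum P a b c \<Longrightarrow> psum P a b d \<Longrightarrow> c = d"
    and psum_comm: "psum P a b c \<Longrightarrow> psum P b a c"
    and psum_assoc: "psum P a b d \<Longrightarrow> psum P d c e \<Longrightarrow> \<exists>f. psum P b c f \<and> psum P a f e"
    and pzero_closed: "pzero P \<in> carrier P"
    and psum_zero: "a \<in> carrier P \<Longrightarrow> psum P (pzero P) a a"
    and psum_conical: "psum P a b (pzero P) \<Longrightarrow> a = pzero P"
    and psum_refine: "psum P a0 a1 c \<Longrightarrow> psum P b0 b1 c \<Longrightarrow> \<exists>c00 c01 c10 c11.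
      psum P c00 c01 a0 \<and> psum P c10 c11 a1 \<and> psum P c00 c10 b0 \<and> psum P c01 c11 b1"
begin

abbreviation ucong :: "'a multiset \<Rightarrow> 'a multiset \<Rightarrow> bool" where
  "ucong \<equiv> universal_cong P"

abbreviation ucls :: "'a multiset \<Rightarrow> 'a multiset set" where
  "ucls \<equiv> universal_class P"

abbreviation over :: "'a multiset \<Rightarrow> bool" where
  "over u \<equiv> set_mset u \<subseteq> carrier P"

lemma psum_zero_right: "a \<in> carrier P \<Longrightarrow> psum P a (pzero P) a"
  using psum_zero psum_comm by blast

lemma psum_conical2: "psum P a b (pzero P) \<Longrightarrow> a = pzero P \<and> b = pzero P"
  using psum_conical psum_comm by blast

lemma ucong_over: "ucong u v \<Longrightarrow> over u \<and> over v"
  by (induction rule: universal_cong.induct) (auto simp: pzero_closed dest: psum_closed)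

lemma ucong_add2:
  assumes "ucong u v" "ucong u' v'" shows "ucong (u + u') (v + v')"
proof -
  have "ucong (u + u') (v + u')" using assms ucong_over by (blast intro: ucong_add)
  moreover have "ucong (v + u') (v + v')"
    using ucong_add[OF assms(2), of v] assms(1) ucong_over by (simp add: add.commute)
  ultimately show ?thesis by (rule ucong_trans)
qed

text \<open>Leaving \<open>c\<close> unchanged is permitted, which makes \<open>psplit\<close>
  reflexive, and so is erasing the zero element, the counterpart of
  \<open>ucong_zero\<close>.\<close>

definition split1 :: "'a \<Rightarrow> 'a multiset \<Rightarrow> bool" where
  "split1 c p \<longleftrightarrow> c \<in> carrier P \<and>
     (p = {#c#} \<or> c = pzero P \<and> p = {#} \<or> (\<exists>a b. p = {#a, b#} \<and> psum P a b c))"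

text \<open>
  All members of a multiset are split simultaneously, each into at most two parts; this makes the
  relation satisfy the diamond property, by refinement.
\<close>

inductive psplit :: "'a multiset \<Rightarrow> 'a multiset \<Rightarrow> bool" where
  psplit_empty: "psplit {#} {#}"
| psplit_add_mset: "split1 c p \<Longrightarrow> psplit u v \<Longrightarrow> psplit (add_mset c u) (p + v)"

lemma psplit_add: "psplit u v \<Longrightarrow> psplit u' v' \<Longrightarrow> psplit (u + u') (v + v')"
proof (induction rule: psplit.induct)
  case (psplit_add_mset c p u v)
  then show ?case using psplit.psplit_add_mset[of c p "u + u'" "v + v'"] by (simp add: add.assoc)
qed simp

lemma psplit_refl: "over u \<Longrightarrow> psplit u u"
proof (induction u)
  case (add c u)
  then show ?case using psplit_add_mset[of c "{#c#}" u u] by (simp add: split1_def)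
qed (simp add: psplit_empty)

lemma psplit_single: "psplit {#c#} p \<longleftrightarrow> split1 c p"
proof
  assume "psplit {#c#} p"
  then show "split1 c p" by (cases rule: psplit.cases) (auto elim: psplit.cases)
next
  assume "split1 c p"
  then show "psplit {#c#} p" using psplit_add_mset[OF _ psplit_empty] by simp
qed

text \<open>Members are split independently of each other. Later this distributes a common splitting
  over the summands of a refinement problem.\<close>

lemma psplit_unionD:
  "psplit (u0 + u1) v \<Longrightarrow> \<exists>v0 v1. v = v0 + v1 \<and> psplit u0 v0 \<and> psplit u1 v1"
proof (induction "u0 + u1" v arbitrary: u0 u1 rule: psplit.induct)
  case psplit_empty
  then show ?case using psplit.psplit_empty by auto
next
  case (psplit_add_mset c p u v)
  have "c \<in># u0 + u1" using psplit_add_mset.hyps(4) by (metis union_single_eq_member add_mset_add_single union_commute)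
  then consider "c \<in># u0" | "c \<in># u1" by auto
  then show ?case
  proof cases
    case 1
    then obtain w where w: "u0 = add_mset c w" by (meson multi_member_split)
    then have "u = w + u1" using psplit_add_mset.hyps(4) by simp
    from psplit_add_mset.hyps(3)[OF this] obtain v0 v1 where
      "v = v0 + v1" "psplit w v0" "psplit u1 v1" by blast
    then show ?thesis using w psplit.psplit_add_mset[OF psplit_add_mset.hyps(1), of w v0]
      by (metis add.assoc)
  next
    case 2
    then obtain w where w: "u1 = add_mset c w" by (meson multi_member_split)
    then have "u = u0 + w" using psplit_add_mset.hyps(4) by simp
    from psplit_add_mset.hyps(3)[OF this] obtain v0 v1 where
      "v = v0 + v1" "psplit u0 v0" "psplit w v1" by blast
    then show ?thesis using w psplit.psplit_add_mset[OF psplit_add_mset.hyps(1), of w v1]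
      by (metis add.left_commute)
  qed
qed

text \<open>Two binary splittings of \<open>c\<close> have a common refinement by
  \<open>psum_refine\<close>. If \<open>c\<close> is zero, conicality leaves only zeros as its
  parts, and all of them can be erased.\<close>

lemma split1_diamond:
  assumes "split1 c p" "split1 c q" shows "\<exists>z. psplit p z \<and> psplit q z"
proof -
  have c: "c \<in> carrier P" using assms(1) by (simp add: split1_def)
  have zero: "psplit p {#}" if "split1 (pzero P) p" for p
  proof -
    have z: "psplit {#pzero P#} {#}" by (simp add: psplit_single split1_def pzero_closed)
    have "psplit ({#pzero P#} + {#pzero P#}) ({#} + {#})" by (rule psplit_add[OF z z])
    then show ?thesis using that z psplit_empty psum_conical2 by (auto simp: split1_def)
  qed
  have refl: "psplit p p" if "split1 c p" for p
    using that c psum_closed by (intro psplit_refl) (auto simp: split1_def)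
  consider "p = {#c#}" | "q = {#c#}" | "c = pzero P" | a0 a1 b0 b1 where
    "p = {#a0, a1#}" "psum P a0 a1 c" "q = {#b0, b1#}" "psum P b0 b1 c"
    using assms by (auto simp: split1_def)
  then show ?thesis
  proof cases
    case 1
    then show ?thesis using refl[OF assms(2)] assms(2) psplit_single by auto
  next
    case 2
    then show ?thesis using refl[OF assms(1)] assms(1) psplit_single by auto
  next
    case 3
    then show ?thesis using zero assms by blast
  next
    case 4
    obtain c00 c01 c10 c11 where *:
      "psum P c00 c01 a0" "psum P c10 c11 a1" "psum P c00 c10 b0" "psum P c01 c11 b1"
      using psum_refine[OF 4(2,4)] by blast
    have s: "psplit {#c#} {#a, b#}" if "psum P a b c" for a b c
      using that psum_closed by (auto simp: psplit_single split1_def)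
    have "psplit p ({#c00, c01#} + {#c10, c11#})"
      using psplit_add[OF s[OF *(1)] s[OF *(2)]] 4(1) by (simp add: add_mset_commute)
    moreover have "psplit q ({#c00, c10#} + {#c01, c11#})"
      using psplit_add[OF s[OF *(3)] s[OF *(4)]] 4(3) by (simp add: add_mset_commute)
    ultimately show ?thesis by (auto simp: add_mset_commute)
  qed
qed

lemma psplit_diamond: "psplit u v \<Longrightarrow> psplit u w \<Longrightarrow> \<exists>z. psplit v z \<and> psplit w z"
proof (induction arbitrary: w rule: psplit.induct)
  case psplit_empty
  then show ?case using psplit.psplit_empty by (auto elim: psplit.cases)
next
  case (psplit_add_mset c p u v)
  then have "psplit ({#c#} + u) w" by simp
  then obtain q w' where q: "w = q + w'" "split1 c q" "psplit u w'"
    using psplit_unionD psplit_single by blast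
  obtain z z' where "psplit p z" "psplit q z" "psplit v z'" "psplit w' z'"
    using split1_diamond psplit_add_mset q by meson
  then show ?case using q psplit_add by blast
qed

lemma psplits_strip: "psplit\<^sup>*\<^sup>* u v \<Longrightarrow> psplit u w \<Longrightarrow> \<exists>z. psplit v z \<and> psplit\<^sup>*\<^sup>* w z"
proof (induction rule: rtranclp_induct)
  case (step v v')
  then show ?case using psplit_diamond by (meson rtranclp.rtrancl_into_rtrancl)
qed blast

lemma psplits_confluent: "psplit\<^sup>*\<^sup>* u w \<Longrightarrow> psplit\<^sup>*\<^sup>* u v \<Longrightarrow> \<exists>z. psplit\<^sup>*\<^sup>* v z \<and> psplit\<^sup>*\<^sup>* w z"
proof (induction rule: rtranclp_induct)
  case (step w w')
  then show ?case using psplits_strip by (meson rtranclp.rtrancl_into_rtrancl)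
qed blast

lemma psplits_add:
  assumes "psplit\<^sup>*\<^sup>* u v" "over w" shows "psplit\<^sup>*\<^sup>* (u + w) (v + w)"
  using assms(1)
proof (induction rule: rtranclp_induct)
  case (step v v')
  then show ?case using psplit_add[OF _ psplit_refl[OF assms(2)]] by (meson rtranclp.rtrancl_into_rtrancl)
qed simp

lemma psplits_unionD:
  "psplit\<^sup>*\<^sup>* (u0 + u1) v \<Longrightarrow> \<exists>v0 v1. v = v0 + v1 \<and> psplit\<^sup>*\<^sup>* u0 v0 \<and> psplit\<^sup>*\<^sup>* u1 v1"
proof (induction rule: rtranclp_induct)
  case (step v v')
  then show ?case using psplit_unionD by (meson rtranclp.rtrancl_into_rtrancl)
qed blast

text \<open>Church-Rosser property: the rules for zero and for sums are splitting steps read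
  forwards and backwards, and confluence carries common splittings across transitivity.\<close>

lemma ucong_joinable: "ucong u v \<Longrightarrow> \<exists>w. psplit\<^sup>*\<^sup>* u w \<and> psplit\<^sup>*\<^sup>* v w"
proof (induction rule: universal_cong.induct)
  case (ucong_trans u v w)
  then obtain x y where "psplit\<^sup>*\<^sup>* u x" "psplit\<^sup>*\<^sup>* v x" "psplit\<^sup>*\<^sup>* v y" "psplit\<^sup>*\<^sup>* w y" by blast
  then show ?case using psplits_confluent by (meson rtranclp_trans)
next
  case (ucong_add u v w)
  then show ?case using psplits_add by blast
next
  case ucong_zero
  have "psplit {#pzero P#} {#}" by (simp add: psplit_single split1_def pzero_closed)
  then show ?case by blast
next
  case (ucong_sum a b c)
  then have "psplit {#c#} {#a, b#}" using psum_closed by (auto simp: psplit_single split1_def)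
  then show ?case by blast
qed blast+

lemma psplit_ucong: "psplit u v \<Longrightarrow> ucong u v"
proof (induction rule: psplit.induct)
  case (psplit_add_mset c p u v)
  have "ucong {#c#} p"
    using psplit_add_mset(1) by (auto simp: split1_def intro: ucong_refl ucong_zero ucong_sym[OF ucong_sum])
  then show ?case using ucong_add2[OF _ psplit_add_mset.IH] by fastforce
qed (simp add: ucong_refl)

lemma psplits_ucong: "psplit\<^sup>*\<^sup>* u v \<Longrightarrow> over u \<Longrightarrow> ucong u v"
proof (induction rule: rtranclp_induct)
  case (step v v')
  then show ?case using psplit_ucong ucong_trans by blast
qed (simp add: ucong_refl)

lemma over_repeat: "over u \<Longrightarrow> over (repeat_mset n u)"
  by (induction n) auto

lemma mem_ucls: "over u \<Longrightarrow> u \<in> ucls u"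
  by (simp add: universal_class_def ucong_refl)

lemma ucls_eq_iff:
  assumes "over u" shows "ucls u = ucls v \<longleftrightarrow> ucong u v"
proof
  assume "ucls u = ucls v"
  then have "u \<in> ucls v" using mem_ucls[OF assms] by simp
  then show "ucong u v" by (simp add: universal_class_def ucong_sym)
next
  assume uv: "ucong u v"
  have "ucong u w \<longleftrightarrow> ucong v w" for w
    using ucong_trans[OF uv] ucong_trans[OF ucong_sym[OF uv]] by metis
  then show "ucls u = ucls v" by (simp add: universal_class_def)
qed

section \<open>The universal monoid as the quotient by the congruence\<close>

abbreviation M :: "'a multiset set monoid" where
  "M \<equiv> universal_monoid P"

lemma carrierE:
  assumes "X \<in> carrier M" obtains u where "over u" "X = ucls u"
  using assms by (auto simp: universal_monoid_def)

lemma ucls_closed: "over u \<Longrightarrow> ucls u \<in> carrier M"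
  by (auto simp: universal_monoid_def)

lemma one_M: "\<one>\<^bsub>M\<^esub> = ucls {#}"
  by (simp add: universal_monoid_def)

lemma mult_M:
  assumes "over u" "over v" shows "ucls u \<otimes>\<^bsub>M\<^esub> ucls v = ucls (u + v)"
proof -
  have "ucls (u' + v') = ucls (u + v)" if "u' \<in> ucls u" "v' \<in> ucls v" for u' v'
  proof -
    have "ucong (u + v) (u' + v')" using that ucong_add2 by (simp add: universal_class_def)
    then show ?thesis using assms ucls_eq_iff[of "u + v" "u' + v'"] by simp
  qed
  then have "ucls u \<otimes>\<^bsub>M\<^esub> ucls v = (\<Union>u'\<in>ucls u. \<Union>v'\<in>ucls v. ucls (u + v))"
    by (simp add: universal_monoid_def)
  then show ?thesis using mem_ucls[OF assms(1)] mem_ucls[OF assms(2)] by auto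
qed

lemma comm_monoid_M: "comm_monoid M"
proof (rule comm_monoidI)
  show "X \<otimes>\<^bsub>M\<^esub> Y \<in> carrier M" if "X \<in> carrier M" "Y \<in> carrier M" for X Y
    using that by (auto elim!: carrierE simp: mult_M ucls_closed)
  show "X \<otimes>\<^bsub>M\<^esub> Y = Y \<otimes>\<^bsub>M\<^esub> X" if "X \<in> carrier M" "Y \<in> carrier M" for X Y
    using that by (auto elim!: carrierE simp: mult_M add.commute)
  show "X \<otimes>\<^bsub>M\<^esub> Y \<otimes>\<^bsub>M\<^esub> Z = X \<otimes>\<^bsub>M\<^esub> (Y \<otimes>\<^bsub>M\<^esub> Z)"
    if "X \<in> carrier M" "Y \<in> carrier M" "Z \<in> carrier M" for X Y Z
    using that by (auto elim!: carrierE simp: mult_M add.assoc)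
  show "\<one>\<^bsub>M\<^esub> \<otimes>\<^bsub>M\<^esub> X = X" if "X \<in> carrier M" for X
    using that by (auto elim!: carrierE simp: one_M mult_M)
qed (simp add: one_M ucls_closed)

lemma pow_M:
  assumes "over u" shows "ucls u [^]\<^bsub>M\<^esub> (n :: nat) = ucls (repeat_mset n u)"
proof -
  interpret comm_monoid M by (rule comm_monoid_M)
  show ?thesis
  proof (induction n)
    case (Suc n)
    have "over (repeat_mset n u)" by (rule over_repeat[OF assms])
    then show ?case using Suc assms by (simp add: mult_M add.commute)
  qed (simp add: one_M)
qed

text \<open>The two formal sums have a common splitting \<open>w\<close>, which is cut in two ways,
  along \<open>a0 + a1\<close> and along \<open>b0 + b1\<close>. Finite multisets themselves have
  refinement, with the intersection as upper left entry.\<close>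

lemma refinement_monoid_M: "refinement_monoid M"
proof -
  interpret comm_monoid M by (rule comm_monoid_M)
  show ?thesis
  proof
    fix A0 A1 B0 B1
    assume "A0 \<in> carrier M" "A1 \<in> carrier M" "B0 \<in> carrier M" "B1 \<in> carrier M"
      and eq: "A0 \<otimes>\<^bsub>M\<^esub> A1 = B0 \<otimes>\<^bsub>M\<^esub> B1"
    then obtain a0 a1 b0 b1 where o: "over a0" "over a1" "over b0" "over b1"
      and A: "A0 = ucls a0" "A1 = ucls a1" "B0 = ucls b0" "B1 = ucls b1" by (metis carrierE)
    then have "ucong (a0 + a1) (b0 + b1)" using eq ucls_eq_iff[of "a0 + a1"] by (simp add: mult_M)
    then obtain w where w: "psplit\<^sup>*\<^sup>* (a0 + a1) w" "psplit\<^sup>*\<^sup>* (b0 + b1) w"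
      using ucong_joinable by blast
    obtain u0 u1 where u: "w = u0 + u1" "psplit\<^sup>*\<^sup>* a0 u0" "psplit\<^sup>*\<^sup>* a1 u1"
      using psplits_unionD[OF w(1)] by blast
    obtain v0 v1 where v: "w = v0 + v1" "psplit\<^sup>*\<^sup>* b0 v0" "psplit\<^sup>*\<^sup>* b1 v1"
      using psplits_unionD[OF w(2)] by blast
    define c00 where "c00 = u0 \<inter># v0"
    define c01 where "c01 = u0 - c00"
    define c10 where "c10 = v0 - c00"
    define c11 where "c11 = u1 - c10"
    have c: "u0 = c00 + c01" "u1 = c10 + c11" "v0 = c00 + c10" "v1 = c01 + c11"
    proof -
      have cnt: "count u0 x + count u1 x = count v0 x + count v1 x" for x
        using u(1) v(1) by (metis count_union)
      show "u0 = c00 + c01" "v0 = c00 + c10"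
        by (auto simp: c00_def c01_def c10_def multiset_eq_iff)
      have "count u1 x = count (c10 + c11) x" "count v1 x = count (c01 + c11) x" for x
        using cnt[of x] by (auto simp: c00_def c01_def c10_def c11_def min_def)
      then show "u1 = c10 + c11" "v1 = c01 + c11" by (simp_all add: multiset_eq_iff)
    qed
    have eqs: "A0 = ucls u0" "A1 = ucls u1" "B0 = ucls v0" "B1 = ucls v1"
      using psplits_ucong u v o A ucls_eq_iff by metis+
    have ov: "over u0" "over u1" "over v0" "over v1"
      using psplits_ucong u v o ucong_over by metis+
    then have co: "over c00" "over c01" "over c10" "over c11" using c by auto
    have "A0 = ucls c00 \<otimes>\<^bsub>M\<^esub> ucls c01" "A1 = ucls c10 \<otimes>\<^bsub>M\<^esub> ucls c11"
      "B0 = ucls c00 \<otimes>\<^bsub>M\<^esub> ucls c10" "B1 = ucls c01 \<otimes>\<^bsub>M\<^esub> ucls c11"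
      using co by (simp_all only: mult_M eqs c)
    then show "\<exists>c00\<in>carrier M. \<exists>c01\<in>carrier M. \<exists>c10\<in>carrier M. \<exists>c11\<in>carrier M.
       A0 = c00 \<otimes>\<^bsub>M\<^esub> c01 \<and> A1 = c10 \<otimes>\<^bsub>M\<^esub> c11 \<and> B0 = c00 \<otimes>\<^bsub>M\<^esub> c10 \<and> B1 = c01 \<otimes>\<^bsub>M\<^esub> c11"
      using co ucls_closed by blast
  qed
qed

text \<open>The value of a formal sum computed within the partial monoid, as far as the partial sums
  are defined. It links equations of the universal monoid back to the interval.\<close>

inductive msum :: "'a multiset \<Rightarrow> 'a \<Rightarrow> bool" where
  msum_empty: "msum {#} (pzero P)"
| msum_step: "msum w b \<Longrightarrow> psum P a b c \<Longrightarrow> msum (add_mset a w) c"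

lemma msum_empty_iff: "msum {#} c \<longleftrightarrow> c = pzero P"
  by (auto intro: msum_empty elim: msum.cases)

lemma msum_closed: "msum w c \<Longrightarrow> over w \<and> c \<in> carrier P"
  by (induction rule: msum.induct) (auto simp: pzero_closed dest: psum_closed)

text \<open>The value does not depend on the order of summation: by partial associativity any member
  may be the one that is added last.\<close>

lemma msum_add_msetD: "msum (add_mset a w) c \<Longrightarrow> \<exists>b. msum w b \<and> psum P a b c"
proof (induction "add_mset a w" c arbitrary: a w rule: msum.induct)
  case (msum_step w' b' a' c)
  show ?case
  proof (cases "a = a'")
    case True
    then show ?thesis using msum_step by auto
  next
    case False
    then obtain k where k: "w' = add_mset a k" "w = add_mset a' k"
      using msum_step.hyps(4) by (metis add_eq_conv_ex)
    obtain b where b: "msum k b" "psum P a b b'" using msum_step.hyps(2)[OF k(1)] by blast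
    obtain f where "psum P b a' f" "psum P a f c"
      using psum_assoc[OF b(2) psum_comm[OF msum_step.hyps(3)]] by blast
    then show ?thesis using msum.msum_step[OF b(1) psum_comm] k(2) by blast
  qed
qed simp

lemma msum_add_mset_iff: "msum (add_mset a w) c \<longleftrightarrow> (\<exists>b. msum w b \<and> psum P a b c)"
  using msum_add_msetD msum_step by blast

lemma msum_union: "msum (u + v) c \<longleftrightarrow> (\<exists>a b. msum u a \<and> msum v b \<and> psum P a b c)"
proof (induction u arbitrary: c)
  case empty
  have "psum P (pzero P) b c \<longleftrightarrow> b = c" if "b \<in> carrier P" for b
    using psum_zero[OF that] psum_fun by blast
  then show ?case by (auto simp: msum_empty_iff dest: msum_closed)
next
  case (add x u)
  have "msum (add_mset x u + v) c \<longleftrightarrow> (\<exists>a b d. msum u a \<and> msum v b \<and> psum P a b d \<and> psum P x d c)"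
    using add by (auto simp: msum_add_mset_iff)
  also have "\<dots> \<longleftrightarrow> (\<exists>a b e. msum u a \<and> msum v b \<and> psum P x a e \<and> psum P e b c)"
    using psum_assoc psum_comm by meson
  also have "\<dots> \<longleftrightarrow> (\<exists>a b. msum (add_mset x u) a \<and> msum v b \<and> psum P a b c)"
    by (auto simp: msum_add_mset_iff)
  finally show ?case .
qed

lemma msum_single: "msum {#a#} c \<longleftrightarrow> a = c \<and> a \<in> carrier P"
proof
  assume "msum {#a#} c"
  then have *: "psum P a (pzero P) c" by (simp add: msum_add_mset_iff msum_empty_iff)
  then have a: "a \<in> carrier P" using psum_closed by blast
  then show "a = c \<and> a \<in> carrier P" using psum_fun[OF * psum_zero_right] by simp
next
  assume "a = c \<and> a \<in> carrier P"
  then show "msum {#a#} c" using psum_zero_right by (auto simp: msum_add_mset_iff msum_empty_iff)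
qed

text \<open>Every rule generating the congruence preserves the values of formal sums. Hence an
  equation of the universal monoid with a single element on one side is an equation between defined
  partial sums.\<close>

lemma msum_ucong: "ucong u v \<Longrightarrow> msum u c \<longleftrightarrow> msum v c"
proof (induction arbitrary: c rule: universal_cong.induct)
  case ucong_zero
  then show ?case by (auto simp: msum_single msum_empty_iff pzero_closed)
next
  case (ucong_sum a b d)
  have "msum {#a, b#} c \<longleftrightarrow> psum P a b c"
    using psum_closed by (auto simp: msum_add_mset_iff[of a] msum_single)
  then show ?case using ucong_sum psum_fun psum_closed by (auto simp: msum_single)
qed (auto simp: msum_union)

lemma ucong_msum: "msum w c \<Longrightarrow> ucong w {#c#}"
proof (induction rule: msum.induct)
  case msum_empty
  then show ?case by (simp add: ucong_zero ucong_sym)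
next
  case (msum_step w b a c)
  have "ucong ({#a#} + w) ({#a#} + {#b#})"
    using msum_step psum_closed by (intro ucong_add2 ucong_refl) auto
  then have "ucong (add_mset a w) {#a, b#}" by (simp add: add_mset_commute)
  then show ?case using ucong_sum[OF msum_step(2)] by (rule ucong_trans)
qed

lemma ucong_empty_iff: "ucong u {#} \<longleftrightarrow> over u \<and> set_mset u \<subseteq> {pzero P}"
proof
  assume "ucong u {#}"
  then have "msum u (pzero P)" using msum_ucong msum_empty by blast
  moreover have "set_mset u \<subseteq> {pzero P}" if "msum u (pzero P)" for u
    using that
  proof (induction u)
    case (add a u)
    then obtain b where "msum u b" "psum P a b (pzero P)" unfolding msum_add_mset_iff by blast
    then show ?case using add.IH psum_conical2 by auto
  qed simp
  ultimately show "over u \<and> set_mset u \<subseteq> {pzero P}" using \<open>ucong u {#}\<close> ucong_over by blast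
next
  assume "over u \<and> set_mset u \<subseteq> {pzero P}"
  then show "ucong u {#}"
  proof (induction u)
    case (add a u)
    then have "ucong ({#pzero P#} + u) ({#} + {#})" by (intro ucong_add2 ucong_zero) auto
    then show ?case using add by simp
  qed (simp add: ucong_refl)
qed

lemma conical_M:
  assumes X: "X \<in> carrier M" and Y: "Y \<in> carrier M" and "X \<otimes>\<^bsub>M\<^esub> Y = \<one>\<^bsub>M\<^esub>"
  shows "X = \<one>\<^bsub>M\<^esub>"
proof -
  obtain u v where u: "over u" "X = ucls u" and v: "over v" "Y = ucls v" using X Y by (metis carrierE)
  then have "ucong (u + v) {#}" using assms(3) ucls_eq_iff[of "u + v"] by (simp add: mult_M one_M)
  then have "ucong u {#}" by (auto simp: ucong_empty_iff)
  then show ?thesis using u by (simp add: one_M ucls_eq_iff)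
qed

lemma ucls_single_eq_one_iff: "a \<in> carrier P \<Longrightarrow> ucls {#a#} = \<one>\<^bsub>M\<^esub> \<longleftrightarrow> a = pzero P"
  by (auto simp: one_M ucls_eq_iff ucong_empty_iff)

text \<open>\<open>X\<close> is only a formal sum, but it has a nonzero member \<open>a\<close>, and
  \<open>n\<close> copies of \<open>X\<close> contain \<open>n\<close> copies of \<open>a\<close>.
  By \<open>msum_ucong\<close> their sum is defined inside \<open>c\<close>.\<close>

lemma multiple_le_msum:
  assumes c: "c \<in> carrier P" and X: "X \<in> carrier M" "X \<noteq> \<one>\<^bsub>M\<^esub>"
    and le: "monoid_le M (X [^]\<^bsub>M\<^esub> (n :: nat)) (ucls {#c#})"
  obtains a w where "a \<in> carrier P" "a \<noteq> pzero P" "msum (replicate_mset n a + w) c"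
proof -
  obtain u where u: "over u" "X = ucls u" using X by (metis carrierE)
  have "\<not> ucong u {#}" using X(2) u ucls_eq_iff[of u] by (simp add: one_M)
  then obtain a where a: "a \<in># u" "a \<noteq> pzero P" using u by (auto simp: ucong_empty_iff)
  obtain Z where "Z \<in> carrier M" "X [^]\<^bsub>M\<^esub> n \<otimes>\<^bsub>M\<^esub> Z = ucls {#c#}" using le by (auto simp: monoid_le_def)
  then obtain z where z: "over z" "ucls u [^]\<^bsub>M\<^esub> n \<otimes>\<^bsub>M\<^esub> ucls z = ucls {#c#}" using u by (metis carrierE)
  have o: "over (repeat_mset n u)" by (rule over_repeat[OF u(1)])
  have "ucong (repeat_mset n u + z) {#c#}"
    using z o u ucls_eq_iff[of "repeat_mset n u + z"] by (simp add: pow_M mult_M)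
  then have "msum (repeat_mset n u + z) c" using msum_ucong c by (auto simp: msum_single)
  moreover obtain u' where "u = add_mset a u'" using a by (meson multi_member_split)
  then have "repeat_mset n u = replicate_mset n a + repeat_mset n u'"
    by (intro multiset_eqI) (simp add: algebra_simps)
  ultimately have "msum (replicate_mset n a + (repeat_mset n u' + z)) c" by (simp add: add.assoc)
  then show ?thesis using that a u by blast
qed

lemma msum_multiple_le:
  assumes "msum (replicate_mset n a + w) c" "a \<in> carrier P"
  shows "monoid_le M (ucls {#a#} [^]\<^bsub>M\<^esub> n) (ucls {#c#})"
proof -
  have o: "over (replicate_mset n a)" "over w" using msum_closed[OF assms(1)] by auto
  have "ucong (replicate_mset n a + w) {#c#}" by (rule ucong_msum[OF assms(1)])
  then have "ucls (replicate_mset n a + w) = ucls {#c#}" using ucls_eq_iff o by simp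
  moreover have "repeat_mset n {#a#} = replicate_mset n a" by (intro multiset_eqI) simp
  ultimately have "ucls {#a#} [^]\<^bsub>M\<^esub> n \<otimes>\<^bsub>M\<^esub> ucls w = ucls {#c#}"
    using o assms(2) by (simp add: pow_M mult_M)
  then show ?thesis using o ucls_closed by (auto simp: monoid_le_def)
qed

end

section \<open>Refinement monoids in which every element has finite index\<close>

locale conical_refinement_monoid = refinement_monoid M for M :: "'m monoid" (structure) +
  assumes conical: "x \<in> carrier M \<Longrightarrow> y \<in> carrier M \<Longrightarrow> x \<otimes> y = \<one> \<Longrightarrow> x = \<one>"
begin

section \<open>The algebraic order of a conical refinement monoid\<close>

abbreviation mle (infix \<open>\<preceq>\<close> 50) where "x \<preceq> y \<equiv> monoid_le M x y"

lemma mleI: "z \<in> carrier M \<Longrightarrow> x \<otimes> z = y \<Longrightarrow> x \<preceq> y"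
  by (auto simp: monoid_le_def)

lemma mleE: assumes "x \<preceq> y" obtains z where "z \<in> carrier M" "y = x \<otimes> z"
  using assms by (auto simp: monoid_le_def)

lemma mle_refl: "x \<in> carrier M \<Longrightarrow> x \<preceq> x"
  by (rule mleI[of \<one>]) simp_all

lemma one_mle: "x \<in> carrier M \<Longrightarrow> \<one> \<preceq> x"
  by (rule mleI[of x]) simp_all

lemma mle_mult: "x \<in> carrier M \<Longrightarrow> y \<in> carrier M \<Longrightarrow> x \<preceq> x \<otimes> y"
  by (rule mleI[of y]) simp_all

lemma mle_mult2: "x \<in> carrier M \<Longrightarrow> y \<in> carrier M \<Longrightarrow> y \<preceq> x \<otimes> y"
  by (rule mleI[of x]) (simp_all add: m_comm)

lemma mle_trans: "x \<preceq> y \<Longrightarrow> y \<preceq> z \<Longrightarrow> x \<in> carrier M \<Longrightarrow> x \<preceq> z"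
  by (elim mleE) (auto simp: m_assoc intro: mleI)

lemma mle_mono:
  assumes "x \<preceq> y" "z \<preceq> w" "x \<in> carrier M" "z \<in> carrier M" shows "x \<otimes> z \<preceq> y \<otimes> w"
proof -
  obtain a b where "a \<in> carrier M" "b \<in> carrier M" "y = x \<otimes> a" "w = z \<otimes> b"
    using assms by (metis mleE)
  then show ?thesis using assms by (intro mleI[of "a \<otimes> b"]) (simp_all add: m_ac)
qed

lemma mle_one: "x \<preceq> \<one> \<Longrightarrow> x \<in> carrier M \<Longrightarrow> x = \<one>"
  by (elim mleE) (metis conical)

lemma pow_mono: "x \<preceq> y \<Longrightarrow> x \<in> carrier M \<Longrightarrow> y \<in> carrier M \<Longrightarrow> x [^] (n :: nat) \<preceq> y [^] n"
  by (induction n) (simp_all add: mle_refl mle_mono)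

lemma pow_mle:
  assumes "x \<in> carrier M" "n \<le> m" shows "x [^] (n :: nat) \<preceq> x [^] m"
  using assms nat_pow_mult[of x n "m - n"] by (intro mleI[of "x [^] (m - n)"]) simp_all

lemma mult_pow: "x \<in> carrier M \<Longrightarrow> y \<in> carrier M \<Longrightarrow> (x \<otimes> y) [^] (n :: nat) = x [^] n \<otimes> y [^] n"
  by (simp add: pow_mult_distrib m_comm)

lemma riesz:
  assumes "x \<preceq> y \<otimes> z" "x \<in> carrier M" "y \<in> carrier M" "z \<in> carrier M"
  obtains u v where "u \<in> carrier M" "v \<in> carrier M" "x = u \<otimes> v" "u \<preceq> y" "v \<preceq> z"
proof -
  obtain w where w: "w \<in> carrier M" "x \<otimes> w = y \<otimes> z" using assms(1) by (metis mleE)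
  obtain c00 c01 c10 c11 where "c00 \<in> carrier M" "c01 \<in> carrier M" "c10 \<in> carrier M" "c11 \<in> carrier M"
    "x = c00 \<otimes> c01" "w = c10 \<otimes> c11" "y = c00 \<otimes> c10" "z = c01 \<otimes> c11"
    using refinement[OF assms(2) w(1) assms(3,4) w(2)] by blast
  then show ?thesis using that[of c00 c01] mle_mult by simp
qed

section \<open>Index and decompositions of multiples\<close>

lemma index_boundD:
  "index_bound M e n \<Longrightarrow> x \<in> carrier M \<Longrightarrow> x [^] m \<preceq> e \<Longrightarrow> n < m \<Longrightarrow> x = \<one>"
  using mle_trans[OF pow_mle[of x "n + 1" m]] by (auto simp: index_bound_def)

text \<open>A copy of \<open>y\<close> may lie partly below \<open>a\<close> and partly below
  \<open>b\<close>. Treating one copy at a time, the current element is replaced by a nontrivial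
  part of it that falls to one side; shrinking it keeps the copies already placed.\<close>

lemma pow_mle_mult_cases:
  assumes "y \<in> carrier M" "y \<noteq> \<one>" "a \<in> carrier M" "b \<in> carrier M" "y [^] (k :: nat) \<preceq> a \<otimes> b"
  shows "\<exists>x\<in>carrier M. \<exists>i j. x \<noteq> \<one> \<and> i + j = k \<and> x \<preceq> y \<and> x [^] i \<preceq> a \<and> x [^] j \<preceq> b"
  using assms
proof (induction k arbitrary: a b)
  case 0
  then show ?case using one_mle mle_refl by (intro bexI[of _ y] exI[of _ 0]) simp_all
next
  case (Suc k)
  obtain z where z: "z \<in> carrier M" "a \<otimes> b = y [^] Suc k \<otimes> z" using Suc.prems by (metis mleE)
  then have "y [^] k \<otimes> (y \<otimes> z) = a \<otimes> b" using Suc.prems by (simp add: m_ac)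
  then obtain c00 c01 c10 c11 where c: "c00 \<in> carrier M" "c01 \<in> carrier M" "c10 \<in> carrier M" "c11 \<in> carrier M"
    "y [^] k = c00 \<otimes> c01" "y \<otimes> z = c10 \<otimes> c11" "a = c00 \<otimes> c10" "b = c01 \<otimes> c11"
    using refinement[of "y [^] k" "y \<otimes> z" a b] Suc.prems z by auto
  obtain x i j where x: "x \<in> carrier M" "x \<noteq> \<one>" "i + j = k" "x \<preceq> y" "x [^] i \<preceq> c00" "x [^] j \<preceq> c01"
    using Suc.IH[of c00 c01] Suc.prems c mle_refl by auto
  have "x \<preceq> c10 \<otimes> c11" using mle_trans[OF x(4) mle_mult] x Suc.prems z c(6) by metis
  then obtain s t where st: "s \<in> carrier M" "t \<in> carrier M" "x = s \<otimes> t" "s \<preceq> c10" "t \<preceq> c11"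
    using riesz[of x c10 c11] x c by blast
  have le: "s \<preceq> x" "t \<preceq> x" using st mle_mult mle_mult2 by simp_all
  show ?case
  proof (cases "s = \<one>")
    case False
    have "s [^] i \<preceq> c00" "s [^] j \<preceq> c01" using mle_trans[OF pow_mono[OF le(1)]] st x by simp_all
    then have "s [^] Suc i \<preceq> a" "s [^] j \<preceq> b"
      using st c mle_mono[of "s [^] i" c00 s c10] mle_trans[of "s [^] j" c01 b] mle_mult by simp_all
    moreover have "s \<preceq> y" using mle_trans[OF le(1) x(4)] st by simp
    ultimately show ?thesis using False st x(3)
      by (intro bexI[of _ s] exI[of _ "Suc i"] exI[of _ j]) simp_all
  next
    case True
    then have "t \<noteq> \<one>" using x st by auto
    have "t [^] i \<preceq> c00" "t [^] j \<preceq> c01" using mle_trans[OF pow_mono[OF le(2)]] st x by simp_all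
    then have "t [^] i \<preceq> a" "t [^] Suc j \<preceq> b"
      using st c mle_mono[of "t [^] j" c01 t c11] mle_trans[of "t [^] i" c00 a] mle_mult by simp_all
    moreover have "t \<preceq> y" using mle_trans[OF le(2) x(4)] st by simp
    ultimately show ?thesis using \<open>t \<noteq> \<one>\<close> st x(3)
      by (intro bexI[of _ t] exI[of _ i] exI[of _ "Suc j"]) simp_all
  qed
qed

text \<open>Among \<open>m + n + 1\<close> copies distributed over \<open>a\<close> and
  \<open>b\<close>, more than \<open>m\<close> fall to \<open>a\<close> or more than
  \<open>n\<close> to \<open>b\<close>. Thus finite index passes from the types of elements to all
  of their sums.\<close>

lemma index_bound_mult:
  assumes "index_bound M a m" "index_bound M b n" "a \<in> carrier M" "b \<in> carrier M"
  shows "index_bound M (a \<otimes> b) (m + n)"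
  unfolding index_bound_def
proof (intro ballI impI)
  fix y assume y: "y \<in> carrier M" "y [^] (m + n + 1) \<preceq> a \<otimes> b"
  show "y = \<one>"
  proof (rule ccontr)
    assume "y \<noteq> \<one>"
    then obtain x i j where x: "x \<in> carrier M" "x \<noteq> \<one>" "i + j = m + n + 1" "x [^] i \<preceq> a" "x [^] j \<preceq> b"
      using pow_mle_mult_cases[OF y(1) _ assms(3,4) y(2)] by blast
    have "m < i \<or> n < j" using x(3) by linarith
    then show False using index_boundD[OF assms(1) x(1,4)] index_boundD[OF assms(2) x(1,5)] x(2) by blast
  qed
qed

lemma index_bound_one: "index_bound M \<one> n"
  unfolding index_bound_def
proof (intro ballI impI)
  fix x assume x: "x \<in> carrier M" "x [^] (n + 1) \<preceq> \<one>"
  then have "x \<otimes> x [^] n = \<one>" using mle_one[OF x(2)] by (simp add: m_comm)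
  then show "x = \<one>" using x conical by blast
qed

text \<open>Decomposed along the copies of \<open>d\<close>, a nontrivial \<open>y\<close> has a
  nontrivial piece under one of them.\<close>

lemma nontrivial_part:
  assumes "y \<in> carrier M" "y \<noteq> \<one>" "d \<in> carrier M" "y \<preceq> d [^] (n :: nat)"
  shows "\<exists>x\<in>carrier M. x \<noteq> \<one> \<and> x \<preceq> y \<and> x \<preceq> d"
  using assms
proof (induction n arbitrary: y)
  case 0
  then show ?case using mle_one by simp
next
  case (Suc n)
  then obtain u v where uv: "u \<in> carrier M" "v \<in> carrier M" "y = u \<otimes> v" "u \<preceq> d [^] n" "v \<preceq> d"
    using riesz[of y "d [^] n" d] by auto
  show ?case
  proof (cases "u = \<one>")
    case True
    then have "y = v" using uv by simp
    then show ?thesis using uv Suc.prems mle_refl by blast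
  next
    case False
    then obtain x where "x \<in> carrier M" "x \<noteq> \<one>" "x \<preceq> u" "x \<preceq> d"
      using Suc.IH uv Suc.prems by blast
    moreover then have "x \<preceq> y" using mle_trans[OF _ mle_mult] uv by metis
    ultimately show ?thesis by blast
  qed
qed

text \<open>The pieces of \<open>b\<close> under the copies of \<open>a\<close> are taken one after
  another. Of each piece, the part under the current remainder \<open>a'\<close> is moved into the
  common part, and the part under \<open>d\<close> goes to the remainder of
  \<open>b\<close>.\<close>

lemma common_part:
  assumes "a \<in> carrier M" "b \<in> carrier M" "b \<preceq> a [^] (k :: nat)"
  shows "\<exists>d\<in>carrier M. \<exists>a'\<in>carrier M. \<exists>b'\<in>carrier M. a = d \<otimes> a' \<and> b = d \<otimes> b' \<and> b' \<preceq> d [^] k"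
  using assms
proof (induction k arbitrary: b)
  case 0
  then show ?case using mle_one[of b] mle_refl
    by (intro bexI[of _ \<one>] bexI[of _ a]) simp_all
next
  case (Suc k)
  then obtain b0 y where y: "b0 \<in> carrier M" "y \<in> carrier M" "b = b0 \<otimes> y" "b0 \<preceq> a [^] k" "y \<preceq> a"
    using riesz[of b "a [^] k" a] by auto
  obtain d a' b0' where d: "d \<in> carrier M" "a' \<in> carrier M" "b0' \<in> carrier M" "a = d \<otimes> a'" "b0 = d \<otimes> b0'"
    "b0' \<preceq> d [^] k" using Suc.IH[OF assms(1) y(1,4)] by blast
  obtain y1 y2 where yy: "y1 \<in> carrier M" "y2 \<in> carrier M" "y = y1 \<otimes> y2" "y1 \<preceq> d" "y2 \<preceq> a'"
    using riesz[of y d a'] y d by metis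
  obtain a'' where a'': "a'' \<in> carrier M" "a' = y2 \<otimes> a''" using yy by (metis mleE)
  have A1: "a = (d \<otimes> y2) \<otimes> a''" "b = (d \<otimes> y2) \<otimes> (b0' \<otimes> y1)"
    using d y yy a'' by (simp_all add: m_ac)
  have A2: "b0' \<otimes> y1 \<preceq> (d \<otimes> y2) [^] Suc k"
  proof -
    have "b0' \<otimes> y1 \<preceq> d [^] Suc k" using mle_mono[of b0' "d [^] k" y1 d] d yy by simp
    moreover have "d [^] Suc k \<preceq> (d \<otimes> y2) [^] Suc k" using pow_mono[OF mle_mult] d yy by blast
    ultimately show ?thesis using mle_trans d yy by blast
  qed
  show ?case
    by (intro bexI[of _ "d \<otimes> y2"] bexI[of _ a''] bexI[of _ "b0' \<otimes> y1"] conjI A1 A2)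
      (use d(1-3) yy(1,2) a''(1) in simp_all)
qed

text \<open>\<open>r\<close> collects, copy by copy, the parts of \<open>p\<close> that fall under
  \<open>x\<close>; what is left, \<open>w\<close>, falls under \<open>y\<close> in every
  copy.\<close>

lemma pow_mle_split:
  assumes "p \<in> carrier M" "x \<in> carrier M" "y \<in> carrier M" "p [^] (n :: nat) \<preceq> x \<otimes> y"
  shows "\<exists>w\<in>carrier M. \<exists>r\<in>carrier M. p = w \<otimes> r \<and> w [^] n \<preceq> y \<and> r \<preceq> x"
  using assms
proof (induction n arbitrary: x y)
  case 0
  then show ?case using one_mle by (intro bexI[of _ p] bexI[of _ \<one>]) simp_all
next
  case (Suc n)
  obtain z where z: "z \<in> carrier M" "x \<otimes> y = p [^] Suc n \<otimes> z" using Suc.prems by (metis mleE)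
  then have "p [^] n \<otimes> (p \<otimes> z) = x \<otimes> y" using Suc.prems by (simp add: m_ac)
  then obtain c00 c01 c10 c11 where c: "c00 \<in> carrier M" "c01 \<in> carrier M" "c10 \<in> carrier M" "c11 \<in> carrier M"
    "p [^] n = c00 \<otimes> c01" "p \<otimes> z = c10 \<otimes> c11" "x = c00 \<otimes> c10" "y = c01 \<otimes> c11"
    using refinement[of "p [^] n" "p \<otimes> z" x y] Suc.prems z by auto
  obtain w r where w: "w \<in> carrier M" "r \<in> carrier M" "p = w \<otimes> r" "w [^] n \<preceq> c01" "r \<preceq> c00"
    using Suc.IH[of c00 c01] Suc.prems c mle_refl by auto
  have "w \<preceq> p" using w mle_mult by simp
  moreover have "p \<preceq> c10 \<otimes> c11" using Suc.prems(1) z(1) mle_mult c(6) by metis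
  ultimately have "w \<preceq> c10 \<otimes> c11" using mle_trans w by blast
  then obtain s t where st: "s \<in> carrier M" "t \<in> carrier M" "w = s \<otimes> t" "s \<preceq> c10" "t \<preceq> c11"
    using riesz[of w c10 c11] w c by blast
  have "p = t \<otimes> (r \<otimes> s)" using w st by (simp add: m_ac)
  moreover have "t [^] Suc n \<preceq> y"
  proof -
    have "t [^] n \<preceq> w [^] n" using pow_mono[of t w n] st w mle_mult2 by simp
    then have "t [^] n \<preceq> c01" using mle_trans w st by simp
    then show ?thesis using mle_mono[of "t [^] n" c01 t c11] st c by simp
  qed
  moreover have "r \<otimes> s \<preceq> x" using mle_mono[of r c00 s c10] w st c by simp
  ultimately show ?case using w st by blast
qed

text \<open>
  From \<open>a \<otimes> c = b \<otimes> c\<close> one splits off common parts of \<open>a\<close> and \<open>b\<close> again and again; the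
  remainders \<open>a'\<close> and \<open>b'\<close> after \<open>n\<close> steps satisfy \<open>a' [^] n \<preceq> c\<close> and \<open>b' [^] n \<preceq> c\<close>.
\<close>

lemma cancel_approx:
  assumes "a \<in> carrier M" "b \<in> carrier M" "c \<in> carrier M" "a \<otimes> c = b \<otimes> c"
  shows "\<exists>d\<in>carrier M. \<exists>a'\<in>carrier M. \<exists>b'\<in>carrier M. \<exists>c'\<in>carrier M. a = d \<otimes> a' \<and> b = d \<otimes> b' \<and>
    a' \<otimes> c' = b' \<otimes> c' \<and> a' [^] (n :: nat) \<otimes> c' \<preceq> c \<and> b' [^] n \<otimes> c' \<preceq> c"
proof (induction n)
  case 0
  show ?case using assms mle_refl
    by (intro bexI[of _ \<one>] bexI[of _ a] bexI[of _ b] bexI[of _ c]) simp_all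
next
  case (Suc n)
  then obtain d a' b' c' where d: "d \<in> carrier M" "a' \<in> carrier M" "b' \<in> carrier M" "c' \<in> carrier M"
    "a = d \<otimes> a'" "b = d \<otimes> b'" "a' \<otimes> c' = b' \<otimes> c'" "a' [^] n \<otimes> c' \<preceq> c" "b' [^] n \<otimes> c' \<preceq> c" by blast
  \<comment> \<open>Refining the equation against itself splits off \<open>e\<close> from
    \<open>a'\<close> and \<open>b'\<close>; the two decompositions of \<open>c'\<close> say that
    the remainders satisfy the same equation with \<open>c''\<close> in place of \<open>c'\<close>,
    after one more copy of each has been found in \<open>c\<close>.\<close>
  obtain e a'' b'' c'' where e: "e \<in> carrier M" "a'' \<in> carrier M" "b'' \<in> carrier M" "c'' \<in> carrier M"
    "a' = e \<otimes> a''" "c' = b'' \<otimes> c''" "b' = e \<otimes> b''" "c' = a'' \<otimes> c''"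
    using refinement[OF d(2,4,3,4,7)] by blast
  have le: "a'' \<preceq> a'" "b'' \<preceq> b'" using e mle_mult2 by simp_all
  have "a'' [^] Suc n \<otimes> c'' = a'' [^] n \<otimes> c'" "b'' [^] Suc n \<otimes> c'' = b'' [^] n \<otimes> c'"
    using e(1-4) by (simp_all add: e(8) m_assoc) (simp add: e(8)[symmetric] e(6))
  moreover have "a'' [^] n \<otimes> c' \<preceq> c" "b'' [^] n \<otimes> c' \<preceq> c"
    using mle_trans[OF mle_mono[OF pow_mono[OF le(1)] mle_refl] d(8)]
      mle_trans[OF mle_mono[OF pow_mono[OF le(2)] mle_refl] d(9)] d e by simp_all
  ultimately have A1: "a'' [^] Suc n \<otimes> c'' \<preceq> c" "b'' [^] Suc n \<otimes> c'' \<preceq> c" by simp_all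
  have A2: "a = (d \<otimes> e) \<otimes> a''" "b = (d \<otimes> e) \<otimes> b''" using d(1,5,6) e(1-3,5,7) by (simp_all add: m_assoc)
  have A3: "a'' \<otimes> c'' = b'' \<otimes> c''" using e by metis
  show ?case
    by (intro bexI[of _ "d \<otimes> e"] bexI[of _ a''] bexI[of _ b''] bexI[of _ c''] conjI A1 A2 A3)
      (use d(1) e(1-4) in simp_all)
qed

end

locale finite_index_refinement_monoid = conical_refinement_monoid +
  assumes finite_index: "e \<in> carrier M \<Longrightarrow> \<exists>n. index_bound M e n"
begin

text \<open>With one more step than an index bound of \<open>c\<close>, too many copies of the
  remainders lie below \<open>c\<close>, so both are trivial and only the common part is
  left.\<close>

lemma cancel:
  assumes "a \<in> carrier M" "b \<in> carrier M" "c \<in> carrier M" "a \<otimes> c = b \<otimes> c" shows "a = b"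
proof -
  obtain n where n: "index_bound M c n" using finite_index assms by blast
  obtain d a' b' c' where d: "d \<in> carrier M" "a' \<in> carrier M" "b' \<in> carrier M" "c' \<in> carrier M"
    "a = d \<otimes> a'" "b = d \<otimes> b'" "a' [^] Suc n \<otimes> c' \<preceq> c" "b' [^] Suc n \<otimes> c' \<preceq> c"
    using cancel_approx[OF assms, of "Suc n"] by blast
  have "a' [^] Suc n \<preceq> c" "b' [^] Suc n \<preceq> c"
    using mle_trans[OF mle_mult d(7)] mle_trans[OF mle_mult d(8)] d by (meson nat_pow_closed)+
  then have "a' = \<one>" "b' = \<one>" using index_boundD[OF n] d by blast+
  then show ?thesis using d by simp
qed

lemma cancel_left:
  "a \<in> carrier M \<Longrightarrow> b \<in> carrier M \<Longrightarrow> c \<in> carrier M \<Longrightarrow> c \<otimes> a = c \<otimes> b \<Longrightarrow> a = b"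
  using cancel[of a b c] by (simp add: m_comm)

lemma cancel_mle:
  assumes "a \<in> carrier M" "b \<in> carrier M" "c \<in> carrier M" "c \<otimes> a \<preceq> c \<otimes> b" shows "a \<preceq> b"
proof -
  obtain z where z: "z \<in> carrier M" "c \<otimes> b = c \<otimes> a \<otimes> z" using assms by (metis mleE)
  then have "b = a \<otimes> z" using cancel_left[of b "a \<otimes> z" c] assms by (simp add: m_assoc)
  then show ?thesis using z mleI by simp
qed

text \<open>
  Descent: \<open>p \<preceq> q [^] N\<close>, so a common part \<open>d\<close> of \<open>p\<close> and \<open>q\<close> can be split off such that the
  remainder of \<open>p\<close> is below a power of \<open>d\<close>. A nontrivial remainder of \<open>p\<close> after \<open>n\<close> steps would
  yield a nontrivial element below all \<open>n\<close> successive common parts, whose product is below \<open>q\<close>.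
\<close>

lemma pow_mle_pow_mult_imp_mle:
  assumes p: "p \<in> carrier M" and q: "q \<in> carrier M" and b: "b \<in> carrier M" and i: "index_bound M b i" "i < N"
    and le: "p [^] N \<preceq> q [^] N \<otimes> b"
  shows "p \<preceq> q"
proof -
  have step: "\<exists>D\<in>carrier M. \<exists>p'\<in>carrier M. \<exists>q'\<in>carrier M. p = D \<otimes> p' \<and> q = D \<otimes> q' \<and>
    p' [^] N \<preceq> q' [^] N \<otimes> b \<and>
    (\<forall>y\<in>carrier M. y \<noteq> \<one> \<longrightarrow> y \<preceq> p' \<longrightarrow> (\<exists>x\<in>carrier M. x \<noteq> \<one> \<and> x \<preceq> y \<and> x [^] n \<preceq> D))" for n :: nat
  proof (induction n)
    case 0
    show ?case using p q le mle_refl one_mle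
      by (intro bexI[of _ \<one>] bexI[of _ p] bexI[of _ q]) auto
  next
    case (Suc n)
    then obtain D p' q' where D: "D \<in> carrier M" "p' \<in> carrier M" "q' \<in> carrier M" "p = D \<otimes> p'" "q = D \<otimes> q'"
      "p' [^] N \<preceq> q' [^] N \<otimes> b"
      and part: "\<And>y. y \<in> carrier M \<Longrightarrow> y \<noteq> \<one> \<Longrightarrow> y \<preceq> p' \<Longrightarrow> \<exists>x\<in>carrier M. x \<noteq> \<one> \<and> x \<preceq> y \<and> x [^] n \<preceq> D"
      by blast
    obtain w r where w: "w \<in> carrier M" "r \<in> carrier M" "p' = w \<otimes> r" "w [^] N \<preceq> b" "r \<preceq> q' [^] N"
      using pow_mle_split[of p' "q' [^] N" b N] D b by auto
    \<comment> \<open>\<open>N\<close> copies of \<open>w\<close> lie below \<open>b\<close>, and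
      \<open>N\<close> exceeds the index bound \<open>i\<close> of \<open>b\<close>.\<close>
    then have "w = \<one>" using index_boundD i by blast
    then have "p' \<preceq> q' [^] N" using w by simp
    then obtain d q'' p'' where d: "d \<in> carrier M" "q'' \<in> carrier M" "p'' \<in> carrier M"
      "q' = d \<otimes> q''" "p' = d \<otimes> p''" "p'' \<preceq> d [^] N"
      using common_part[of q' p' N] D by blast
    have A1: "p = (D \<otimes> d) \<otimes> p''" "q = (D \<otimes> d) \<otimes> q''" using D d by (simp_all add: m_assoc)
    \<comment> \<open>Cancelling \<open>N\<close> copies of \<open>d\<close> restores the inequality
      for the remainders, so the same exponent serves in all steps.\<close>
    have A2: "p'' [^] N \<preceq> q'' [^] N \<otimes> b"
    proof (rule cancel_mle[of _ _ "d [^] N"])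
      show "d [^] N \<otimes> p'' [^] N \<preceq> d [^] N \<otimes> (q'' [^] N \<otimes> b)"
        using D(6) d(1-5) b by (simp add: mult_pow m_assoc)
    qed (use d b in simp_all)
    have A3: "\<exists>x\<in>carrier M. x \<noteq> \<one> \<and> x \<preceq> y \<and> x [^] Suc n \<preceq> D \<otimes> d"
      if y: "y \<in> carrier M" "y \<noteq> \<one>" "y \<preceq> p''" for y
    proof -
      have "y \<preceq> d [^] N" using mle_trans[OF y(3) d(6)] y by simp
      then obtain y' where y': "y' \<in> carrier M" "y' \<noteq> \<one>" "y' \<preceq> y" "y' \<preceq> d"
        using nontrivial_part y d by blast
      have "y' \<preceq> p'" using mle_trans[OF y'(4) mle_mult] y' d by simp
      then obtain x where x: "x \<in> carrier M" "x \<noteq> \<one>" "x \<preceq> y'" "x [^] n \<preceq> D" using part y' by blast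
      have "x \<preceq> d" "x \<preceq> y" using mle_trans x y' by blast+
      then show ?thesis using x mle_mono[of "x [^] n" D x d] by auto
    qed
    show ?case
      by (intro bexI[of _ "D \<otimes> d"] bexI[of _ p''] bexI[of _ q''] conjI ballI impI A1 A2 A3)
        (use D(1) d(1-3) in simp_all)
  qed
  \<comment> \<open>The number of steps has to exceed an index bound of \<open>q\<close>, because
    the product of all common parts lies below \<open>q\<close>.\<close>
  obtain n where n: "index_bound M q n" using finite_index q by blast
  obtain D p' q' where D: "D \<in> carrier M" "p' \<in> carrier M" "q' \<in> carrier M" "p = D \<otimes> p'" "q = D \<otimes> q'"
    and part: "\<And>y. y \<in> carrier M \<Longrightarrow> y \<noteq> \<one> \<Longrightarrow> y \<preceq> p' \<Longrightarrow> \<exists>x\<in>carrier M. x \<noteq> \<one> \<and> x \<preceq> y \<and> x [^] Suc n \<preceq> D"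
    using step[of "Suc n"] by blast
  have "p' = \<one>"
  proof (rule ccontr)
    assume "p' \<noteq> \<one>"
    then obtain x where x: "x \<in> carrier M" "x \<noteq> \<one>" "x [^] Suc n \<preceq> D" using part mle_refl D by blast
    then have "x [^] Suc n \<preceq> q" using mle_trans[OF x(3) mle_mult] D by simp
    then show False using index_boundD[OF n] x by blast
  qed
  then show ?thesis using D mle_mult by simp
qed

section \<open>The ordered group of differences\<close>

lemma mle_antisym:
  assumes "x \<preceq> y" "y \<preceq> x" "x \<in> carrier M" "y \<in> carrier M" shows "x = y"
proof -
  obtain z w where z: "z \<in> carrier M" "y = x \<otimes> z" "w \<in> carrier M" "x = y \<otimes> w" using assms by (metis mleE)
  have "x \<otimes> (z \<otimes> w) = y \<otimes> w" using z(1,2,3) assms(3) by (simp add: m_assoc)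
  also have "\<dots> = x \<otimes> \<one>" using z(4) assms(3) by simp
  finally have "z \<otimes> w = \<one>" using cancel_left[of "z \<otimes> w" \<one> x] z(1,3) assms(3) by simp
  then have "z = \<one>" using conical z(1,3) by blast
  then show ?thesis using z(2) assms(3) by simp
qed

text \<open>\<open>gdiff a b\<close> is the formal difference \<open>a - b\<close>, written additively.\<close>

definition gdiff :: "'a \<Rightarrow> 'a \<Rightarrow> ('a \<times> 'a) set" where
  "gdiff a b = {(c, d). c \<in> carrier M \<and> d \<in> carrier M \<and> a \<otimes> d = b \<otimes> c}"

definition diff_group :: "('a \<times> 'a) set monoid" where
  "diff_group = \<lparr>carrier = {gdiff a b | a b. a \<in> carrier M \<and> b \<in> carrier M},
     monoid.mult = (\<lambda>X Y. \<Union>(a, b)\<in>X. \<Union>(c, d)\<in>Y. gdiff (a \<otimes> c) (b \<otimes> d)), one = gdiff \<one> \<one>\<rparr>"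

definition diff_le :: "('a \<times> 'a) set \<Rightarrow> ('a \<times> 'a) set \<Rightarrow> bool" where
  "diff_le X Y \<longleftrightarrow> (\<exists>a\<in>carrier M. \<exists>b\<in>carrier M. \<exists>c\<in>carrier M. \<exists>d\<in>carrier M.
     X = gdiff a b \<and> Y = gdiff c d \<and> a \<otimes> d \<preceq> b \<otimes> c)"

lemma gdiff_eq_iff:
  assumes [simp]: "a \<in> carrier M" "b \<in> carrier M" "c \<in> carrier M" "d \<in> carrier M"
  shows "gdiff a b = gdiff c d \<longleftrightarrow> a \<otimes> d = b \<otimes> c"
proof
  assume "gdiff a b = gdiff c d"
  moreover have "(c, d) \<in> gdiff c d" by (simp add: gdiff_def m_comm)
  ultimately show "a \<otimes> d = b \<otimes> c" by (auto simp: gdiff_def)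
next
  assume eq: "a \<otimes> d = b \<otimes> c"
  have "a \<otimes> f = b \<otimes> e \<longleftrightarrow> c \<otimes> f = d \<otimes> e" if [simp]: "e \<in> carrier M" "f \<in> carrier M" for e f
  proof
    assume "a \<otimes> f = b \<otimes> e"
    then have "(a \<otimes> d) \<otimes> (b \<otimes> e) = (b \<otimes> c) \<otimes> (a \<otimes> f)" using eq by simp
    then have "(a \<otimes> b) \<otimes> (c \<otimes> f) = (a \<otimes> b) \<otimes> (d \<otimes> e)" by (simp add: m_ac)
    then show "c \<otimes> f = d \<otimes> e" by (rule cancel_left[rotated 3]) simp_all
  next
    assume "c \<otimes> f = d \<otimes> e"
    then have "(a \<otimes> d) \<otimes> (c \<otimes> f) = (b \<otimes> c) \<otimes> (d \<otimes> e)" using eq by simp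
    then have "(c \<otimes> d) \<otimes> (a \<otimes> f) = (c \<otimes> d) \<otimes> (b \<otimes> e)" by (simp add: m_ac)
    then show "a \<otimes> f = b \<otimes> e" by (rule cancel_left[rotated 3]) simp_all
  qed
  then show "gdiff a b = gdiff c d" by (auto simp: gdiff_def)
qed

lemma carrier_diff_group: "carrier diff_group = {gdiff a b | a b. a \<in> carrier M \<and> b \<in> carrier M}"
  and one_diff_group: "\<one>\<^bsub>diff_group\<^esub> = gdiff \<one> \<one>"
  by (simp_all add: diff_group_def)

lemma gdiff_closed: "a \<in> carrier M \<Longrightarrow> b \<in> carrier M \<Longrightarrow> gdiff a b \<in> carrier diff_group"
  by (auto simp: carrier_diff_group)

lemma diff_groupE:
  assumes "X \<in> carrier diff_group" obtains a b where "a \<in> carrier M" "b \<in> carrier M" "X = gdiff a b"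
  using assms by (auto simp: carrier_diff_group)

lemma mult_diff_group:
  assumes [simp]: "a \<in> carrier M" "b \<in> carrier M" "c \<in> carrier M" "d \<in> carrier M"
  shows "gdiff a b \<otimes>\<^bsub>diff_group\<^esub> gdiff c d = gdiff (a \<otimes> c) (b \<otimes> d)"
proof -
  have "gdiff (a' \<otimes> c') (b' \<otimes> d') = gdiff (a \<otimes> c) (b \<otimes> d)"
    if "(a', b') \<in> gdiff a b" "(c', d') \<in> gdiff c d" for a' b' c' d'
  proof -
    have *: "a' \<in> carrier M" "b' \<in> carrier M" "c' \<in> carrier M" "d' \<in> carrier M"
      "a \<otimes> b' = b \<otimes> a'" "c \<otimes> d' = d \<otimes> c'" using that by (auto simp: gdiff_def)
    then have "(a \<otimes> b') \<otimes> (c \<otimes> d') = (b \<otimes> a') \<otimes> (d \<otimes> c')" by simp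
    then have "(a' \<otimes> c') \<otimes> (b \<otimes> d) = (b' \<otimes> d') \<otimes> (a \<otimes> c)" using *(1-4) by (simp add: m_ac)
    then show ?thesis using *(1-4) by (simp add: gdiff_eq_iff)
  qed
  note m = this
  have ne: "(a, b) \<in> gdiff a b" "(c, d) \<in> gdiff c d" by (simp_all add: gdiff_def m_comm)
  have "gdiff a b \<otimes>\<^bsub>diff_group\<^esub> gdiff c d =
    (\<Union>(a', b')\<in>gdiff a b. \<Union>(c', d')\<in>gdiff c d. gdiff (a' \<otimes> c') (b' \<otimes> d'))"
    by (simp add: diff_group_def)
  also have "\<dots> = gdiff (a \<otimes> c) (b \<otimes> d)"
  proof (intro equalityI subsetI)
    fix x assume x: "x \<in> gdiff (a \<otimes> c) (b \<otimes> d)"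
    show "x \<in> (\<Union>(a', b')\<in>gdiff a b. \<Union>(c', d')\<in>gdiff c d. gdiff (a' \<otimes> c') (b' \<otimes> d'))"
      by (rule UN_I[OF ne(1)], unfold prod.case, rule UN_I[OF ne(2)], unfold prod.case, rule x)
  qed (auto simp: m)
  finally show ?thesis .
qed

lemma comm_group_diff_group: "comm_group diff_group"
proof (rule comm_groupI)
  show "X \<otimes>\<^bsub>diff_group\<^esub> Y \<in> carrier diff_group"
    if "X \<in> carrier diff_group" "Y \<in> carrier diff_group" for X Y
    using that by (auto elim!: diff_groupE simp: mult_diff_group gdiff_closed)
  show "X \<otimes>\<^bsub>diff_group\<^esub> Y = Y \<otimes>\<^bsub>diff_group\<^esub> X"
    if "X \<in> carrier diff_group" "Y \<in> carrier diff_group" for X Y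
    using that by (auto elim!: diff_groupE simp: mult_diff_group m_comm)
  show "X \<otimes>\<^bsub>diff_group\<^esub> Y \<otimes>\<^bsub>diff_group\<^esub> Z = X \<otimes>\<^bsub>diff_group\<^esub> (Y \<otimes>\<^bsub>diff_group\<^esub> Z)"
    if "X \<in> carrier diff_group" "Y \<in> carrier diff_group" "Z \<in> carrier diff_group" for X Y Z
    using that by (auto elim!: diff_groupE simp: mult_diff_group m_assoc)
  show "\<one>\<^bsub>diff_group\<^esub> \<otimes>\<^bsub>diff_group\<^esub> X = X" if "X \<in> carrier diff_group" for X
    using that by (auto elim!: diff_groupE simp: one_diff_group mult_diff_group)
  show "\<exists>Y\<in>carrier diff_group. Y \<otimes>\<^bsub>diff_group\<^esub> X = \<one>\<^bsub>diff_group\<^esub>"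
    if X: "X \<in> carrier diff_group" for X
  proof -
    obtain a b where ab: "a \<in> carrier M" "b \<in> carrier M" "X = gdiff a b" using X by (rule diff_groupE)
    then have "gdiff b a \<otimes>\<^bsub>diff_group\<^esub> X = \<one>\<^bsub>diff_group\<^esub>"
      by (simp add: one_diff_group mult_diff_group gdiff_eq_iff m_comm)
    then show ?thesis using ab gdiff_closed by blast
  qed
qed (simp add: one_diff_group gdiff_closed)

lemma pow_diff_group:
  assumes "a \<in> carrier M" "b \<in> carrier M"
  shows "gdiff a b [^]\<^bsub>diff_group\<^esub> (n :: nat) = gdiff (a [^] n) (b [^] n)"
  using assms by (induction n) (simp_all add: one_diff_group mult_diff_group)

text \<open>Independence of the representatives: multiplied by the entries of the other
  representatives, both sides acquire the common factor \<open>b' \<otimes> d'\<close>, which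
  cancellation removes.\<close>

lemma diff_le_iff:
  assumes [simp]: "a \<in> carrier M" "b \<in> carrier M" "c \<in> carrier M" "d \<in> carrier M"
  shows "diff_le (gdiff a b) (gdiff c d) \<longleftrightarrow> a \<otimes> d \<preceq> b \<otimes> c"
proof
  assume "diff_le (gdiff a b) (gdiff c d)"
  then obtain a' b' c' d' where *: "a' \<in> carrier M" "b' \<in> carrier M" "c' \<in> carrier M" "d' \<in> carrier M"
    "gdiff a b = gdiff a' b'" "gdiff c d = gdiff c' d'" "a' \<otimes> d' \<preceq> b' \<otimes> c'"
    unfolding diff_le_def by blast
  then have eq: "a \<otimes> b' = b \<otimes> a'" "c \<otimes> d' = d \<otimes> c'" by (simp_all add: gdiff_eq_iff)
  have "(b' \<otimes> d') \<otimes> (a \<otimes> d) = (a \<otimes> b') \<otimes> (d \<otimes> d')" using *(1-4) by (simp add: m_ac)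
  also have "\<dots> = (b \<otimes> d) \<otimes> (a' \<otimes> d')" unfolding eq(1) using *(1-4) by (simp add: m_ac)
  also have "\<dots> \<preceq> (b \<otimes> d) \<otimes> (b' \<otimes> c')" using *(1-4) by (intro mle_mono[OF mle_refl *(7)]) simp_all
  also have "(b \<otimes> d) \<otimes> (b' \<otimes> c') = (d \<otimes> c') \<otimes> (b \<otimes> b')" using *(1-4) by (simp add: m_ac)
  also have "\<dots> = (b' \<otimes> d') \<otimes> (b \<otimes> c)" unfolding eq(2)[symmetric] using *(1-4) by (simp add: m_ac)
  finally show "a \<otimes> d \<preceq> b \<otimes> c" by (rule cancel_mle[rotated 3]) (use *(1-4) in simp_all)
next
  assume "a \<otimes> d \<preceq> b \<otimes> c"
  then show "diff_le (gdiff a b) (gdiff c d)" unfolding diff_le_def using assms by blast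
qed

lemma partially_ordered_diff_group: "partially_ordered_abelian_group diff_group diff_le"
proof (intro partially_ordered_abelian_group.intro partially_ordered_abelian_group_axioms.intro
    comm_group_diff_group)
  show "diff_le X X" if "X \<in> carrier diff_group" for X
    using that by (auto elim!: diff_groupE simp: diff_le_iff m_comm mle_refl)
  show "X = Y" if "X \<in> carrier diff_group" "Y \<in> carrier diff_group" "diff_le X Y" "diff_le Y X" for X Y
  proof -
    obtain a b c d where "a \<in> carrier M" "b \<in> carrier M" "X = gdiff a b"
      "c \<in> carrier M" "d \<in> carrier M" "Y = gdiff c d" using \<open>X \<in> _\<close> \<open>Y \<in> _\<close> by (metis diff_groupE)
    then show ?thesis using that(3,4)
      by (simp add: diff_le_iff gdiff_eq_iff m_comm[of c b] m_comm[of d a] mle_antisym)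
  qed
  show "diff_le X Z" if "X \<in> carrier diff_group" "Y \<in> carrier diff_group" "Z \<in> carrier diff_group"
    "diff_le X Y" "diff_le Y Z" for X Y Z
  proof -
    obtain a b c d e f where *: "a \<in> carrier M" "b \<in> carrier M" "X = gdiff a b"
      "c \<in> carrier M" "d \<in> carrier M" "Y = gdiff c d" "e \<in> carrier M" "f \<in> carrier M" "Z = gdiff e f"
      using \<open>X \<in> _\<close> \<open>Y \<in> _\<close> \<open>Z \<in> _\<close> by (metis diff_groupE)
    then have 1: "a \<otimes> d \<preceq> b \<otimes> c" "c \<otimes> f \<preceq> d \<otimes> e" using that(4,5) by (simp_all add: diff_le_iff)
    then have "(a \<otimes> d) \<otimes> (c \<otimes> f) \<preceq> (b \<otimes> c) \<otimes> (d \<otimes> e)" using *(1,2,4,5,7,8) by (intro mle_mono[OF 1]) simp_all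
    then have "(c \<otimes> d) \<otimes> (a \<otimes> f) \<preceq> (c \<otimes> d) \<otimes> (b \<otimes> e)" using *(1,2,4,5,7,8) by (simp add: m_ac)
    then have "a \<otimes> f \<preceq> b \<otimes> e" by (rule cancel_mle[rotated 3]) (use *(1,2,4,5,7,8) in simp_all)
    then show ?thesis using * by (simp add: diff_le_iff)
  qed
  show "diff_le (X \<otimes>\<^bsub>diff_group\<^esub> Z) (Y \<otimes>\<^bsub>diff_group\<^esub> Z)"
    if "X \<in> carrier diff_group" "Y \<in> carrier diff_group" "Z \<in> carrier diff_group" "diff_le X Y" for X Y Z
  proof -
    obtain a b c d e f where *: "a \<in> carrier M" "b \<in> carrier M" "X = gdiff a b"
      "c \<in> carrier M" "d \<in> carrier M" "Y = gdiff c d" "e \<in> carrier M" "f \<in> carrier M" "Z = gdiff e f"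
      using \<open>X \<in> _\<close> \<open>Y \<in> _\<close> \<open>Z \<in> _\<close> by (metis diff_groupE)
    then have "a \<otimes> d \<preceq> b \<otimes> c" using that(4) by (simp add: diff_le_iff)
    from mle_mono[OF this mle_refl, of "e \<otimes> f"]
    have "(a \<otimes> d) \<otimes> (e \<otimes> f) \<preceq> (b \<otimes> c) \<otimes> (e \<otimes> f)" using *(1,2,4,5,7,8) by simp
    then have "(a \<otimes> e) \<otimes> (d \<otimes> f) \<preceq> (b \<otimes> f) \<otimes> (c \<otimes> e)" using *(1,2,4,5,7,8) by (simp add: m_ac)
    then show ?thesis using * by (simp add: mult_diff_group diff_le_iff)
  qed
qed

lemma one_diff_le_iff:
  "a \<in> carrier M \<Longrightarrow> b \<in> carrier M \<Longrightarrow> diff_le \<one>\<^bsub>diff_group\<^esub> (gdiff a b) \<longleftrightarrow> b \<preceq> a"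
  by (simp add: one_diff_group diff_le_iff)

lemma positive_cone_diff_group:
  "carrier (positive_cone diff_group diff_le) = (\<lambda>z. gdiff z \<one>) ` carrier M"
proof (intro equalityI subsetI)
  fix X assume "X \<in> carrier (positive_cone diff_group diff_le)"
  then have X: "X \<in> carrier diff_group" "diff_le \<one>\<^bsub>diff_group\<^esub> X" by (simp_all add: positive_cone_def)
  then obtain a b where ab: "a \<in> carrier M" "b \<in> carrier M" "X = gdiff a b" by (metis diff_groupE)
  then have "b \<preceq> a" using X by (simp add: one_diff_le_iff)
  then obtain z where "z \<in> carrier M" "a = b \<otimes> z" by (metis mleE)
  then show "X \<in> (\<lambda>z. gdiff z \<one>) ` carrier M" using ab by (intro image_eqI[of _ _ z]) (simp_all add: gdiff_eq_iff)
qed (auto simp: positive_cone_def gdiff_closed one_diff_le_iff one_mle)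

lemma positive_cone_ops:
  "one (positive_cone diff_group diff_le) = gdiff \<one> \<one>"
  "a \<in> carrier M \<Longrightarrow> b \<in> carrier M \<Longrightarrow>
    gdiff a \<one> \<otimes>\<^bsub>positive_cone diff_group diff_le\<^esub> gdiff b \<one> = gdiff (a \<otimes> b) \<one>"
  using mult_diff_group[of a \<one> b \<one>] by (simp_all add: positive_cone_def one_diff_group)

lemma refinement_positive_cone: "refinement_monoid (positive_cone diff_group diff_le)"
proof -
  let ?C = "positive_cone diff_group diff_le"
  note C = positive_cone_diff_group positive_cone_ops
  have "comm_monoid ?C"
    by (rule comm_monoidI) (auto simp: C m_ac)
  moreover have "refinement_monoid_axioms ?C"
  proof
    fix A0 A1 B0 B1
    assume "A0 \<in> carrier ?C" "A1 \<in> carrier ?C" "B0 \<in> carrier ?C" "B1 \<in> carrier ?C"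
      and eq: "A0 \<otimes>\<^bsub>?C\<^esub> A1 = B0 \<otimes>\<^bsub>?C\<^esub> B1"
    then obtain a0 a1 b0 b1 where c: "a0 \<in> carrier M" "a1 \<in> carrier M" "b0 \<in> carrier M" "b1 \<in> carrier M"
      and A: "A0 = gdiff a0 \<one>" "A1 = gdiff a1 \<one>" "B0 = gdiff b0 \<one>" "B1 = gdiff b1 \<one>"
      unfolding C by blast
    then have "a0 \<otimes> a1 = b0 \<otimes> b1" using eq by (simp add: C gdiff_eq_iff)
    then obtain c00 c01 c10 c11 where *: "c00 \<in> carrier M" "c01 \<in> carrier M" "c10 \<in> carrier M" "c11 \<in> carrier M"
      "a0 = c00 \<otimes> c01" "a1 = c10 \<otimes> c11" "b0 = c00 \<otimes> c10" "b1 = c01 \<otimes> c11"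
      using refinement[OF c] by blast
    show "\<exists>c00\<in>carrier ?C. \<exists>c01\<in>carrier ?C. \<exists>c10\<in>carrier ?C. \<exists>c11\<in>carrier ?C.
       A0 = c00 \<otimes>\<^bsub>?C\<^esub> c01 \<and> A1 = c10 \<otimes>\<^bsub>?C\<^esub> c11 \<and> B0 = c00 \<otimes>\<^bsub>?C\<^esub> c10 \<and> B1 = c01 \<otimes>\<^bsub>?C\<^esub> c11"
      unfolding A *(5-8)
      using *(1-4) by (intro bexI[of _ "gdiff c00 \<one>"] bexI[of _ "gdiff c01 \<one>"] bexI[of _ "gdiff c10 \<one>"]
        bexI[of _ "gdiff c11 \<one>"]) (auto simp: C)
  qed
  ultimately show ?thesis by (rule refinement_monoid.intro)
qed

lemma archimedean_diff_group: "archimedean_dimension_group diff_group diff_le"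
proof (intro archimedean_dimension_group.intro archimedean_dimension_group_axioms.intro
    dimension_group.intro dimension_group_axioms.intro partially_ordered_diff_group refinement_positive_cone)
  fix X Y assume "X \<in> carrier diff_group" "Y \<in> carrier diff_group"
  then obtain a b c d where *: "a \<in> carrier M" "b \<in> carrier M" "X = gdiff a b"
      "c \<in> carrier M" "d \<in> carrier M" "Y = gdiff c d" by (metis diff_groupE)
  have "a \<preceq> b \<otimes> (a \<otimes> c)" "c \<preceq> d \<otimes> (a \<otimes> c)"
    using * mleI[of "b \<otimes> c" a] mleI[of "d \<otimes> a" c] by (simp_all add: m_ac)
  then have "diff_le X (gdiff (a \<otimes> c) \<one>)" "diff_le Y (gdiff (a \<otimes> c) \<one>)"
    using * by (simp_all add: diff_le_iff)
  then show "\<exists>Z\<in>carrier diff_group. diff_le X Z \<and> diff_le Y Z" using gdiff_closed * by blast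
next
  fix X and m :: nat assume X: "X \<in> carrier diff_group" "0 < m" "diff_le \<one>\<^bsub>diff_group\<^esub> (X [^]\<^bsub>diff_group\<^esub> m)"
  then obtain a b where ab: "a \<in> carrier M" "b \<in> carrier M" "X = gdiff a b" by (metis diff_groupE)
  then have "b [^] m \<preceq> a [^] m" using X by (simp add: pow_diff_group one_diff_le_iff)
  \<comment> \<open>Unperforation is the case of a trivial summand: the unit has index bound 0, so
    every positive exponent is admissible.\<close>
  then have "b \<preceq> a" using pow_mle_pow_mult_imp_mle[OF ab(2,1) one_closed index_bound_one X(2)] ab by simp
  then show "diff_le \<one>\<^bsub>diff_group\<^esub> X" using ab by (simp add: one_diff_le_iff)
next
  fix X Y assume X: "X \<in> carrier diff_group" and Y: "Y \<in> carrier diff_group"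
    and le: "\<And>n::nat. diff_le (X [^]\<^bsub>diff_group\<^esub> n) Y"
  obtain p q b c where *: "p \<in> carrier M" "q \<in> carrier M" "X = gdiff p q"
      "b \<in> carrier M" "c \<in> carrier M" "Y = gdiff b c" using X Y by (metis diff_groupE)
  have P: "p [^] n \<preceq> q [^] n \<otimes> b" for n :: nat
  proof -
    have 1: "p [^] n \<otimes> c \<preceq> q [^] n \<otimes> b" using le[of n] * by (simp add: pow_diff_group diff_le_iff)
    have 2: "p [^] n \<preceq> p [^] n \<otimes> c" by (rule mle_mult) (use *(1,5) in simp_all)
    show ?thesis by (rule mle_trans[OF 2 1]) (use *(1) in simp)
  qed
  obtain i where i: "index_bound M b i" using finite_index *(4) by blast
  \<comment> \<open>All exponents are available here, so one just above an index bound of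
    \<open>b\<close> can be used.\<close>
  have "p \<preceq> q" by (rule pow_mle_pow_mult_imp_mle[OF *(1,2,4) i lessI P])
  then show "diff_le X \<one>\<^bsub>diff_group\<^esub>" using * by (simp add: one_diff_group diff_le_iff)
qed

theorem is_archimedean_dimension_group_cone: "is_archimedean_dimension_group_cone M"
proof -
  have "(\<lambda>z. gdiff z \<one>) \<in> iso M (positive_cone diff_group diff_le)"
    by (auto simp: iso_def hom_def bij_betw_def inj_on_def positive_cone_diff_group positive_cone_ops gdiff_eq_iff)
  then show ?thesis
    unfolding is_archimedean_dimension_group_cone_def using archimedean_diff_group is_isoI by blast
qed

end

section \<open>The type monoid\<close>

context rel_bias
begin

text \<open>Green's relation D between idempotents, read on their supports.\<close>

definition equidec :: "'x set \<Rightarrow> 'x set \<Rightarrow> bool" where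
  "equidec D E \<longleftrightarrow> (\<exists>z\<in>A. Domain z = D \<and> Range z = E)"

lemma equidecI: "z \<in> A \<Longrightarrow> Domain z = D \<Longrightarrow> Range z = E \<Longrightarrow> equidec D E"
  by (auto simp: equidec_def)

lemma equidec_refl: "D \<in> supports \<Longrightarrow> equidec D D"
  by (rule equidecI[of "Id_on D"]) (auto simp: supports_iff)

lemma equidec_sym: "equidec D E \<Longrightarrow> equidec E D"
  unfolding equidec_def using converse_mem by (metis Domain_converse Range_converse)

lemma equidec_trans:
  assumes "equidec D E" "equidec E F" shows "equidec D F"
proof -
  obtain z w where "z \<in> A" "Domain z = D" "Range z = E" "w \<in> A" "Domain w = E" "Range w = F"
    using assms by (auto simp: equidec_def)
  then show ?thesis by (intro equidecI[of "z O w"] comp_mem) blast+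
qed

lemma equidec_supports: "equidec D E \<Longrightarrow> D \<in> supports \<and> E \<in> supports"
  by (auto simp: equidec_def Domain_supports Range_supports)

lemma equidec_Un:
  assumes "equidec D D'" "equidec E E'" "D \<inter> E = {}" "D' \<inter> E' = {}"
  shows "equidec (D \<union> E) (D' \<union> E')"
proof -
  obtain z w where "z \<in> A" "Domain z = D" "Range z = D'" "w \<in> A" "Domain w = E" "Range w = E'"
    using assms by (auto simp: equidec_def)
  then show ?thesis using assms by (intro equidecI[of "z \<union> w"] Un_mem) auto
qed

text \<open>The images under the bijection. This carries a partition of a set to any other set of
  the same type, so that sums given by different sets can be compared inside one of them.\<close>

lemma equidec_UnE:
  assumes "equidec (D1 \<union> D2) E" and D: "D1 \<in> supports" "D2 \<in> supports" and disj: "D1 \<inter> D2 = {}"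
  obtains E1 E2 where "equidec D1 E1" "equidec D2 E2" "E = E1 \<union> E2" "E1 \<inter> E2 = {}"
proof -
  obtain z where z: "z \<in> A" "Domain z = D1 \<union> D2" "Range z = E" using assms by (auto simp: equidec_def)
  have 1: "equidec D' (z `` D')" if "D' \<in> supports" "D' \<subseteq> Domain z" for D'
  proof (rule equidecI[of "Id_on D' O z"])
    show "Id_on D' O z \<in> A" using z that by (simp add: comp_mem supports_iff)
    show "Domain (Id_on D' O z) = D'" using that(2) by blast
  qed auto
  have "z `` D1 \<inter> z `` D2 = {}" using pbij_inj[OF elem_pbij[OF z(1)]] disj by blast
  moreover have "E = z `` D1 \<union> z `` D2" using z by blast
  ultimately show ?thesis using that[of "z `` D1" "z `` D2"] 1[OF D(1)] 1[OF D(2)] z by blast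
qed

end

section \<open>The type interval as supports up to equidecomposition\<close>

context rel_representation
begin

text \<open>The definition links the domain of \<open>x\<close> with the range of \<open>y\<close>;
  but \<open>y\<close> itself is a bijection between its domain and its range.\<close>

lemma green_D_iff:
  "(x, y) \<in> green_D S \<longleftrightarrow> x \<in> carrier S \<and> y \<in> carrier S \<and> equidec (Domain (\<rho> x)) (Domain (\<rho> y))"
proof
  assume "(x, y) \<in> green_D S"
  then obtain z where z: "x \<in> carrier S" "y \<in> carrier S" "z \<in> carrier S" "sdom S x = sdom S z" "sran S z = sran S y"
    by (auto simp: green_D_def green_L_def green_R_def)
  then have "Id_on (Domain (\<rho> x)) = Id_on (Domain (\<rho> z))" "Id_on (Range (\<rho> z)) = Id_on (Range (\<rho> y))"
    using rep_sdom rep_sran by metis+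
  then have "Domain (\<rho> z) = Domain (\<rho> x)" "Range (\<rho> z) = Range (\<rho> y)" by (metis Domain_Id_on)+
  then have "equidec (Domain (\<rho> x)) (Range (\<rho> y))" using z rep_mem by (intro equidecI[of "\<rho> z"]) auto
  moreover have "equidec (Range (\<rho> y)) (Domain (\<rho> y))"
    using z rep_mem by (intro equidecI[of "(\<rho> y)\<inverse>"] converse_mem) auto
  ultimately show "x \<in> carrier S \<and> y \<in> carrier S \<and> equidec (Domain (\<rho> x)) (Domain (\<rho> y))"
    using z equidec_trans by blast
next
  assume *: "x \<in> carrier S \<and> y \<in> carrier S \<and> equidec (Domain (\<rho> x)) (Domain (\<rho> y))"
  then have "equidec (Domain (\<rho> y)) (Range (\<rho> y))" using rep_mem by (intro equidecI[of "\<rho> y"]) auto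
  then have "equidec (Domain (\<rho> x)) (Range (\<rho> y))" using * equidec_trans by blast
  then obtain z where z: "z \<in> A" "Domain z = Domain (\<rho> x)" "Range z = Range (\<rho> y)"
    unfolding equidec_def by blast
  let ?z = "of_rel z"
  have "sdom S x = sdom S ?z" "sran S ?z = sran S y"
    using * z by (simp_all add: rep_eq_iff[symmetric] sdom_closed sran_closed of_rel_closed rep_sdom
        rep_sran rep_of_rel)
  then show "(x, y) \<in> green_D S"
    using * z of_rel_closed unfolding green_D_def green_L_def green_R_def by blast
qed

text \<open>The type of the idempotent with support \<open>D\<close>; every type has this
  form.\<close>

definition tcls :: "'x set \<Rightarrow> 'a set" where
  "tcls D = {y \<in> carrier S. equidec D (Domain (\<rho> y))}"

lemma green_D_Image: "x \<in> carrier S \<Longrightarrow> green_D S `` {x} = tcls (Domain (\<rho> x))"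
  by (auto simp: tcls_def green_D_iff)

lemma of_rel_Id_on:
  assumes "D \<in> supports" shows "of_rel (Id_on D) \<in> carrier S" "\<rho> (of_rel (Id_on D)) = Id_on D"
  using assms by (simp_all add: supports_iff of_rel_closed rep_of_rel)

lemma tcls_eq_iff:
  assumes "D \<in> supports" "E \<in> supports" shows "tcls D = tcls E \<longleftrightarrow> equidec D E"
proof
  assume eq: "tcls D = tcls E"
  have "of_rel (Id_on E) \<in> tcls E" using of_rel_Id_on[OF assms(2)] equidec_refl[OF assms(2)] by (simp add: tcls_def)
  then have "of_rel (Id_on E) \<in> tcls D" using eq by simp
  then show "equidec D E" using of_rel_Id_on[OF assms(2)] by (simp add: tcls_def)
next
  assume "equidec D E"
  then have "equidec D F \<longleftrightarrow> equidec E F" for F using equidec_sym equidec_trans by blast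
  then show "tcls D = tcls E" by (simp add: tcls_def)
qed

lemma carrier_type_interval: "carrier (type_interval S) = tcls ` supports"
proof -
  have "carrier (type_interval S) = (\<lambda>x. tcls (Domain (\<rho> x))) ` carrier S"
    using green_D_Image by (auto simp: type_interval_def quotient_def)
  also have "\<dots> = tcls ` (Domain ` (\<rho> ` carrier S))" by (simp add: image_image)
  finally show ?thesis by (simp add: rep_image supports_def)
qed

lemma pzero_type_interval: "pzero (type_interval S) = tcls {}"
  by (simp add: type_interval_def green_D_Image zero_closed rep_zero)

lemma psum_type_interval:
  "psum (type_interval S) a b c \<longleftrightarrow>
     (\<exists>D\<in>supports. \<exists>E\<in>supports. D \<inter> E = {} \<and> a = tcls D \<and> b = tcls E \<and> c = tcls (D \<union> E))"
proof
  assume "psum (type_interval S) a b c"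
  then obtain x y where x: "x \<in> carrier S" "y \<in> carrier S" "orthogonal S x y"
    "a = green_D S `` {x}" "b = green_D S `` {y}" "c = green_D S `` {oplus S x y}"
    by (auto simp: type_interval_def)
  have "c = tcls (Domain (\<rho> x) \<union> Domain (\<rho> y))"
    using rep_oplus[OF x(1-3)] x(6) by (simp add: green_D_Image Domain_Un_eq)
  then show "\<exists>D\<in>supports. \<exists>E\<in>supports. D \<inter> E = {} \<and> a = tcls D \<and> b = tcls E \<and> c = tcls (D \<union> E)"
    using x Domain_supports rep_mem orthogonal_iff
    by (intro bexI[of _ "Domain (\<rho> x)"] bexI[of _ "Domain (\<rho> y)"]) (simp_all add: green_D_Image)
next
  assume "\<exists>D\<in>supports. \<exists>E\<in>supports. D \<inter> E = {} \<and> a = tcls D \<and> b = tcls E \<and> c = tcls (D \<union> E)"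
  then obtain D E where *: "D \<in> supports" "E \<in> supports" "D \<inter> E = {}" "a = tcls D" "b = tcls E"
    "c = tcls (D \<union> E)" by blast
  let ?x = "of_rel (Id_on D)" and ?y = "of_rel (Id_on E)"
  note o = of_rel_Id_on[OF *(1)] of_rel_Id_on[OF *(2)]
  have orth: "orthogonal S ?x ?y" using o *(3) by (auto simp: orthogonal_iff)
  have "green_D S `` {oplus S ?x ?y} = c"
    using rep_oplus[OF o(1,3) orth] o *(6) by (simp add: green_D_Image Domain_Un_eq)
  then show "psum (type_interval S) a b c"
    using orth o * unfolding type_interval_def
    by (simp, intro bexI[of _ ?x] bexI[of _ ?y]) (simp_all add: green_D_Image)
qed

text \<open>The same type may be presented by different sets. Once \<open>equidec_UnE\<close> has
  moved one partition onto the other set, associativity is that of disjoint unions, and refinement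
  consists in intersecting two partitions of one set.\<close>

lemma partial_refinement_monoid_type_interval: "partial_refinement_monoid (type_interval S)"
proof
  fix a b c d e a0 a1 b0 b1
  show "a \<in> carrier (type_interval S) \<and> b \<in> carrier (type_interval S) \<and> c \<in> carrier (type_interval S)"
    if "psum (type_interval S) a b c"
    using that Un_supports unfolding psum_type_interval carrier_type_interval by blast
  show "c = d" if s1: "psum (type_interval S) a b c" and s2: "psum (type_interval S) a b d"
  proof -
    obtain D E where D: "D \<in> supports" "E \<in> supports" "D \<inter> E = {}" "a = tcls D" "b = tcls E" "c = tcls (D \<union> E)"
      using s1 unfolding psum_type_interval by blast
    obtain D' E' where D': "D' \<in> supports" "E' \<in> supports" "D' \<inter> E' = {}" "a = tcls D'" "b = tcls E'" "d = tcls (D' \<union> E')"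
      using s2 unfolding psum_type_interval by blast
    have "equidec D D'" "equidec E E'" using D D' by (simp_all add: tcls_eq_iff[symmetric])
    then show ?thesis using equidec_Un D D' by (simp add: tcls_eq_iff Un_supports)
  qed
  show "psum (type_interval S) b a c" if "psum (type_interval S) a b c"
    using that unfolding psum_type_interval by (metis Int_commute Un_commute)
  show "\<exists>f. psum (type_interval S) b c f \<and> psum (type_interval S) a f e"
    if s1: "psum (type_interval S) a b d" and s2: "psum (type_interval S) d c e"
  proof -
    obtain D1 D2 where D: "D1 \<in> supports" "D2 \<in> supports" "D1 \<inter> D2 = {}" "a = tcls D1" "b = tcls D2" "d = tcls (D1 \<union> D2)"
      using s1 unfolding psum_type_interval by blast
    obtain D' E' where D': "D' \<in> supports" "E' \<in> supports" "D' \<inter> E' = {}" "d = tcls D'" "c = tcls E'" "e = tcls (D' \<union> E')"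
      using s2 unfolding psum_type_interval by blast
    have "equidec (D1 \<union> D2) D'" using D D' by (simp add: tcls_eq_iff[symmetric] Un_supports)
    then obtain F1 F2 where F: "equidec D1 F1" "equidec D2 F2" "D' = F1 \<union> F2" "F1 \<inter> F2 = {}"
      using equidec_UnE D by metis
    then have s: "F1 \<in> supports" "F2 \<in> supports" using equidec_supports by blast+
    have ab: "a = tcls F1" "b = tcls F2" using D F s by (simp_all add: tcls_eq_iff)
    have "psum (type_interval S) b c (tcls (F2 \<union> E'))"
      unfolding psum_type_interval using s D' F ab by (intro bexI[of _ F2] bexI[of _ E']) auto
    moreover have "psum (type_interval S) a (tcls (F2 \<union> E')) e"
      unfolding psum_type_interval using s D' F ab Un_supports
      by (intro bexI[of _ F1] bexI[of _ "F2 \<union> E'"]) (auto simp: Un_assoc)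
    ultimately show ?thesis by blast
  qed
  show "pzero (type_interval S) \<in> carrier (type_interval S)"
    using empty_supports by (simp add: pzero_type_interval carrier_type_interval)
  show "psum (type_interval S) (pzero (type_interval S)) a a" if "a \<in> carrier (type_interval S)"
    using that empty_supports unfolding pzero_type_interval carrier_type_interval psum_type_interval
    by (metis Int_empty_left Un_empty_left imageE)
  show "a = pzero (type_interval S)" if s1: "psum (type_interval S) a b (pzero (type_interval S))"
  proof -
    obtain D E where D: "D \<in> supports" "E \<in> supports" "D \<inter> E = {}" "a = tcls D" "tcls {} = tcls (D \<union> E)"
      using s1 unfolding psum_type_interval pzero_type_interval by blast
    then have "equidec {} (D \<union> E)" by (simp add: tcls_eq_iff[symmetric] empty_supports Un_supports)
    then have "D \<union> E = {}" unfolding equidec_def by (metis Domain_empty_iff Range_empty)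
    then have "D = {}" by simp
    then show ?thesis using D by (simp add: pzero_type_interval)
  qed
  show "\<exists>c00 c01 c10 c11. psum (type_interval S) c00 c01 a0 \<and> psum (type_interval S) c10 c11 a1 \<and>
      psum (type_interval S) c00 c10 b0 \<and> psum (type_interval S) c01 c11 b1"
    if s1: "psum (type_interval S) a0 a1 c" and s2: "psum (type_interval S) b0 b1 c"
  proof -
    obtain D0 D1 where D: "D0 \<in> supports" "D1 \<in> supports" "D0 \<inter> D1 = {}" "a0 = tcls D0" "a1 = tcls D1" "c = tcls (D0 \<union> D1)"
      using s1 unfolding psum_type_interval by blast
    obtain E0 E1 where E: "E0 \<in> supports" "E1 \<in> supports" "E0 \<inter> E1 = {}" "b0 = tcls E0" "b1 = tcls E1" "c = tcls (E0 \<union> E1)"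
      using s2 unfolding psum_type_interval by blast
    have "equidec (D0 \<union> D1) (E0 \<union> E1)" using D E by (simp add: tcls_eq_iff[symmetric] Un_supports)
    then obtain F0 F1 where F: "equidec D0 F0" "equidec D1 F1" "E0 \<union> E1 = F0 \<union> F1" "F0 \<inter> F1 = {}"
      using equidec_UnE D by metis
    then have s: "F0 \<in> supports" "F1 \<in> supports" using equidec_supports by blast+
    have a: "a0 = tcls F0" "a1 = tcls F1" using D F s by (simp_all add: tcls_eq_iff)
    have p: "psum (type_interval S) (tcls X) (tcls Y) (tcls Z)"
      if "X \<in> supports" "Y \<in> supports" "X \<inter> Y = {}" "Z = X \<union> Y" for X Y Z
      using that unfolding psum_type_interval by blast
    have "psum (type_interval S) (tcls (F0 \<inter> E0)) (tcls (F0 \<inter> E1)) a0"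
      "psum (type_interval S) (tcls (F1 \<inter> E0)) (tcls (F1 \<inter> E1)) a1"
      "psum (type_interval S) (tcls (F0 \<inter> E0)) (tcls (F1 \<inter> E0)) b0"
      "psum (type_interval S) (tcls (F0 \<inter> E1)) (tcls (F1 \<inter> E1)) b1"
      unfolding a E(4,5) using F s E(1-3) by (intro p Int_supports; blast)+
    then show ?thesis by blast
  qed
qed

sublocale T: partial_refinement_monoid "type_interval S"
  by (rule partial_refinement_monoid_type_interval)

lemma typ_elem_eq: "x \<in> carrier S \<Longrightarrow> typ_elem S x = T.ucls {#tcls (Domain (\<rho> x))#}"
  by (simp add: typ_elem_def green_D_Image)

text \<open>The outermost partial sum divides \<open>E\<close> into a copy of \<open>D\<close> and a
  rest that contains the remaining copies; the division is moved from the sets presenting the sum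
  into \<open>E\<close> by \<open>equidec_UnE\<close>.\<close>

lemma msum_disjoint_copies:
  assumes "D \<in> supports"
  shows "E \<in> supports \<Longrightarrow> T.msum (replicate_mset n (tcls D) + w) (tcls E) \<Longrightarrow>
    \<exists>s. (\<forall>i<n. s i \<in> A \<and> Domain (s i) = D \<and> Range (s i) \<subseteq> E) \<and>
        (\<forall>i<n. \<forall>j<n. i \<noteq> j \<longrightarrow> Range (s i) \<inter> Range (s j) = {})"
proof (induction n arbitrary: E)
  case (Suc n)
  then obtain b where b: "T.msum (replicate_mset n (tcls D) + w) b" "psum (type_interval S) (tcls D) b (tcls E)"
    by (auto simp: T.msum_add_mset_iff)
  obtain D1 D2 where D: "D1 \<in> supports" "D2 \<in> supports" "D1 \<inter> D2 = {}" "tcls D = tcls D1" "b = tcls D2"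
    "tcls E = tcls (D1 \<union> D2)" using b(2) unfolding psum_type_interval by blast
  have "equidec (D1 \<union> D2) E"
    using D(1,2,6) Suc.prems(1) Un_supports by (simp add: tcls_eq_iff[symmetric])
  then obtain E1 E2 where E: "equidec D1 E1" "equidec D2 E2" "E = E1 \<union> E2" "E1 \<inter> E2 = {}"
    using equidec_UnE D by metis
  have E2: "E2 \<in> supports" "b = tcls E2"
    using D(2,5) E(2) equidec_supports[OF E(2)] by (simp_all add: tcls_eq_iff)
  obtain s where s: "\<And>i. i < n \<Longrightarrow> s i \<in> A \<and> Domain (s i) = D \<and> Range (s i) \<subseteq> E2"
    "\<And>i j. i < n \<Longrightarrow> j < n \<Longrightarrow> i \<noteq> j \<Longrightarrow> Range (s i) \<inter> Range (s j) = {}"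
    using Suc.IH[OF E2(1)] b(1) E2(2) by blast
  have "equidec D D1" using D(1,4) assms by (simp add: tcls_eq_iff)
  then have "equidec D E1" using E(1) by (rule equidec_trans)
  then obtain z where z: "z \<in> A" "Domain z = D" "Range z = E1" by (auto simp: equidec_def)
  show ?case
  proof (intro exI[of _ "s(n := z)"] conjI allI impI)
    fix i j assume i: "i < Suc n" and j: "j < Suc n" "i \<noteq> j"
    consider "i < n" "j < n" | "i = n" "j < n" | "i < n" "j = n" using i j by linarith
    then show "Range ((s(n := z)) i) \<inter> Range ((s(n := z)) j) = {}"
    proof cases
      case 1
      then show ?thesis using s(2) j by simp
    next
      case 2
      then show ?thesis using s(1)[of j] z E by auto
    next
      case 3
      then show ?thesis using s(1)[of i] z E by auto
    qed
  next
    fix i assume "i < Suc n"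
    then have "(s(n := z)) i \<in> A \<and> Domain ((s(n := z)) i) = D \<and> Range ((s(n := z)) i) \<subseteq> E"
      using s(1)[of i] z E(3) by (cases "i = n") auto
    then show "(s(n := z)) i \<in> A" "Domain ((s(n := z)) i) = D" "Range ((s(n := z)) i) \<subseteq> E"
      by simp_all
  qed
qed simp

lemma index_bound_typ_elem:
  assumes sat: "rel_sat A E" and h: "symmetric_inverse (Suc h) \<notin> bias_variety E" and e: "e \<in> carrier S"
  shows "index_bound (Typ S) (typ_elem S e) h"
  unfolding index_bound_def Typ_def
proof (intro ballI impI; rule ccontr)
  fix X assume X: "X \<in> carrier T.M" "monoid_le T.M (X [^]\<^bsub>T.M\<^esub> (h + 1)) (typ_elem S e)" "X \<noteq> \<one>\<^bsub>T.M\<^esub>"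
  let ?E = "Domain (\<rho> e)"
  have E: "?E \<in> supports" using e by (simp add: Domain_supports rep_mem)
  then have "tcls ?E \<in> carrier (type_interval S)" by (simp add: carrier_type_interval)
  then obtain a w where a: "a \<in> carrier (type_interval S)" "a \<noteq> pzero (type_interval S)"
    "T.msum (replicate_mset (h + 1) a + w) (tcls ?E)"
    using T.multiple_le_msum[OF _ X(1,3), of "tcls ?E" "h + 1"] X(2) e by (auto simp: typ_elem_eq)
  then obtain D where D: "D \<in> supports" "a = tcls D" by (auto simp: carrier_type_interval)
  have "D \<noteq> {}" using a(2) D by (auto simp: pzero_type_interval)
  obtain s where s: "\<forall>i<h + 1. s i \<in> A \<and> Domain (s i) = D \<and> Range (s i) \<subseteq> ?E"
    "\<forall>i<h + 1. \<forall>j<h + 1. i \<noteq> j \<longrightarrow> Range (s i) \<inter> Range (s j) = {}"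
    using msum_disjoint_copies[OF D(1) E a(3)[unfolded D(2)]] by blast
  have "rel_sat {r. pbij r \<and> r \<subseteq> {..<h + 1} \<times> {..<h + 1}} E"
    by (rule matrix_units_sat[where s = s and D = D]) (use s \<open>D \<noteq> {}\<close> sat in simp_all)
  \<comment> \<open>The matrix units are indexed by the \<open>h + 1\<close> numbers below
    \<open>h + 1\<close>; equal cardinality carries the identities over to
    \<open>{1..Suc h}\<close>.\<close>
  then have "rel_sat (pbij_upto (Suc h)) E" by (rule rel_sat_pbij_card_le[rotated 3]) simp_all
  then show False using h by (simp add: symmetric_inverse_in_variety_iff)
qed

text \<open>An element of \<open>Typ S\<close> is a finite sum of types of idempotents, each with
  index bound \<open>h\<close>, and index bounds add up. The bound thus depends on the number of
  summands.\<close>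

lemma finite_index_refinement_monoid_Typ:
  assumes "rel_sat A E" "symmetric_inverse (Suc h) \<notin> bias_variety E"
  shows "finite_index_refinement_monoid (Typ S)"
proof -
  interpret R: refinement_monoid T.M by (rule T.refinement_monoid_M)
  interpret C: conical_refinement_monoid T.M
    by standard (rule T.conical_M)
  have "\<exists>n. index_bound T.M (T.ucls u) n" if "set_mset u \<subseteq> carrier (type_interval S)" for u
    using that
  proof (induction u)
    case empty
    then show ?case using C.index_bound_one by (auto simp: T.one_M[symmetric])
  next
    case (add a u)
    then obtain n where n: "index_bound T.M (T.ucls u) n" by auto
    obtain D where D: "D \<in> supports" "a = tcls D" using add.prems by (auto simp: carrier_type_interval)
    have "index_bound T.M (T.ucls {#a#}) h"
      using index_bound_typ_elem[OF assms, of "of_rel (Id_on D)"] of_rel_Id_on[OF D(1)] D(2)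
      by (simp add: typ_elem_eq Typ_def)
    from C.index_bound_mult[OF this n] add.prems show ?case
      by (auto simp: T.ucls_closed T.mult_M)
  qed
  then have "\<exists>n. index_bound T.M X n" if "X \<in> carrier T.M" for X
    using that by (elim T.carrierE) simp
  then have "finite_index_refinement_monoid_axioms T.M"
    by (rule finite_index_refinement_monoid_axioms.intro)
  then show ?thesis unfolding Typ_def
    by (intro finite_index_refinement_monoid.intro C.conical_refinement_monoid_axioms)
qed

end

lemma monoid_index_le: "index_bound M e n \<Longrightarrow> monoid_index M e \<le> enat n"
  by (auto simp: monoid_index_def intro: Least_le)

text \<open>The type of the identity on \<open>{1..h}\<close> is the sum of \<open>h\<close> copies
  of the nonzero type of \<open>{1}\<close>, so no number below \<open>h\<close> bounds its
  index.\<close>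

lemma monoid_index_symmetric_inverse:
  assumes sat: "symmetric_inverse h \<in> bias_variety E" and h: "symmetric_inverse (Suc h) \<notin> bias_variety E"
  shows "\<exists>e \<in> Idp (symmetric_inverse h).
    monoid_index (Typ (symmetric_inverse h)) (typ_elem (symmetric_inverse h) e) = enat h"
proof -
  \<comment> \<open>Otherwise the simplifier would rewrite the \<open>1\<close> in
    \<open>{1}\<close> and \<open>{1..h}\<close> to \<open>Suc 0\<close>.\<close>
  note One_nat_def [simp del]
  let ?S = "symmetric_inverse h"
  interpret R: rel_representation ?S "\<lambda>f. {(i, j). f i = Some j}" "pbij_upto h"
    by (rule rel_representation_symmetric_inverse)
  let ?e = "R.of_rel (Id_on {1..h})"
  have supp: "D \<in> R.supports" if "D \<subseteq> {1..h}" for D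
    unfolding R.supports_iff using that by auto
  have e: "?e \<in> Idp ?S" "?e \<in> carrier ?S"
    using R.of_rel_Idp[OF supp] R.of_rel_Id_on[OF supp] by simp_all
  have te: "typ_elem ?S ?e = R.T.ucls {#R.tcls {1..h}#}"
    using R.typ_elem_eq[OF e(2)] R.of_rel_Id_on(2)[OF supp, of "{1..h}"] by simp
  have sat': "rel_sat (pbij_upto h) E" using sat by (simp add: symmetric_inverse_in_variety_iff)
  have bound: "index_bound (Typ ?S) (typ_elem ?S ?e) h"
    by (rule R.index_bound_typ_elem[OF sat' h e(2)])
  have "h \<le> n" if n: "index_bound (Typ ?S) (typ_elem ?S ?e) n" for n
  proof (rule ccontr)
    assume "\<not> h \<le> n"
    have sum: "R.T.msum (replicate_mset k (R.tcls {1})) (R.tcls {1..k})" if "k \<le> h" for k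
      using that
    proof (induction k)
      case 0
      then show ?case using R.T.msum_empty by (simp add: R.pzero_type_interval)
    next
      case (Suc k)
      have z: "{(Suc k, 1)} \<in> pbij_upto h" using Suc.prems by (auto simp: pbij_def single_valued_def)
      have supps: "{Suc k} \<in> R.supports" "{1} \<in> R.supports" "{1..k} \<in> R.supports"
        using Suc.prems by (auto intro: supp)
      have "R.equidec {Suc k} {1}" using z by (rule R.equidecI) auto
      then have "R.tcls {Suc k} = R.tcls {1}" by (rule R.tcls_eq_iff[OF supps(1,2), THEN iffD2])
      moreover have "psum (type_interval ?S) (R.tcls {Suc k}) (R.tcls {1..k}) (R.tcls ({Suc k} \<union> {1..k}))"
        unfolding R.psum_type_interval
        by (rule bexI[OF _ supps(1)], rule bexI[OF _ supps(3)]) simp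
      moreover have "{Suc k} \<union> {1..k} = {1..Suc k}" by auto
      ultimately have "psum (type_interval ?S) (R.tcls {1}) (R.tcls {1..k}) (R.tcls {1..Suc k})" by simp
      with Suc show ?case using R.T.msum_step[of _ _ "R.tcls {1}"] by simp
    qed
    let ?a = "R.tcls {1}"
    have one: "{1} \<in> R.supports" using \<open>\<not> h \<le> n\<close> by (intro supp) auto
    then have a: "?a \<in> carrier (type_interval ?S)" by (simp add: R.carrier_type_interval)
    \<comment> \<open>Since \<open>n < h\<close>, the copies beyond the \<open>n + 1\<close> that
      the index bound speaks of serve as the complement.\<close>
    have "replicate_mset h ?a = replicate_mset (n + 1) ?a + replicate_mset (h - (n + 1)) ?a"
      using \<open>\<not> h \<le> n\<close> by (intro multiset_eqI) simp
    then have "monoid_le R.T.M (R.T.ucls {#?a#} [^]\<^bsub>R.T.M\<^esub> (n + 1)) (R.T.ucls {#R.tcls {1..h}#})"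
      using R.T.msum_multiple_le[OF _ a] sum[of h] by simp
    then have "R.T.ucls {#?a#} = \<one>\<^bsub>R.T.M\<^esub>"
      using n a R.T.ucls_closed[of "{#?a#}"] unfolding index_bound_def Typ_def te by simp
    then have "R.tcls {1} = R.tcls {}"
      using R.T.ucls_single_eq_one_iff[OF a] by (simp add: R.pzero_type_interval)
    then have "R.equidec {1} {}" by (rule R.tcls_eq_iff[OF one R.empty_supports, THEN iffD1])
    then show False by (auto simp: R.equidec_def)
  qed
  then have "(LEAST n. index_bound (Typ ?S) (typ_elem ?S ?e) n) = h"
    using bound by (intro Least_equality) auto
  then show ?thesis using bound e by (intro bexI[of _ ?e]) (auto simp: monoid_index_def)
qed

section \<open>Proper varieties of biases\<close>

lemma bias_variety_representation:
  assumes "S \<in> bias_variety E"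
  shows "rel_representation S (inverse_semigroup0.germ_rep S) (inverse_semigroup0.germ_rep S ` carrier S)"
    and "rel_sat (inverse_semigroup0.germ_rep S ` carrier S) E"
proof -
  have "boolean_inverse_semigroup S" using assms by (simp add: bias_variety_def)
  then show r: "rel_representation S (inverse_semigroup0.germ_rep S) (inverse_semigroup0.germ_rep S ` carrier S)"
    by (rule boolean_inverse_semigroup.rel_representation_germ_rep)
  show "rel_sat (inverse_semigroup0.germ_rep S ` carrier S) E"
    using assms rel_representation.bias_variety_iff[OF r] by blast
qed

theorem theorem6p3:
  fixes E :: "bias_identity set"
  assumes proper: "proper_bias_variety TYPE('p) E"
  shows
    "(\<exists>h. symmetric_inverse h \<in> bias_variety E
          \<and> (\<forall>m. symmetric_inverse m \<in> bias_variety E \<longrightarrow> m \<le> h)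
          \<and> (\<forall>S \<in> (bias_variety E :: 'a semigroup0 set).
               \<forall>e \<in> Idp S. monoid_index (Typ S) (typ_elem S e) \<le> enat h)
          \<and> (\<exists>S \<in> (bias_variety E :: (nat \<rightharpoonup> nat) semigroup0 set).
               \<exists>e \<in> Idp S. monoid_index (Typ S) (typ_elem S e) = enat h))
     \<and> (\<forall>S \<in> (bias_variety E :: 'a semigroup0 set).
          (\<forall>x \<in> carrier (Typ S). monoid_index (Typ S) x \<noteq> \<infinity>)
          \<and> is_archimedean_dimension_group_cone (Typ S))
     \<and> (\<forall>F :: bias_identity set.
          {T \<in> (bias_variety E :: nat semigroup0 set). fully_group_matricial T} \<subseteq> bias_variety F
          \<longrightarrow> (bias_variety E :: 'a semigroup0 set) \<subseteq> bias_variety F)"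
proof -
  obtain h where h: "symmetric_inverse h \<in> bias_variety E"
    and max: "\<And>m. symmetric_inverse m \<in> bias_variety E \<Longrightarrow> m \<le> h"
    using proper_variety_largest_symmetric_inverse[OF proper] by blast
  have h': "symmetric_inverse (Suc h) \<notin> bias_variety E"
    using max[of "Suc h"] by auto
  have index: "monoid_index (Typ S) (typ_elem S e) \<le> enat h"
    if S: "S \<in> bias_variety E" and e: "e \<in> Idp S" for S :: "'a semigroup0" and e
    using e by (intro monoid_index_le rel_representation.index_bound_typ_elem[OF
          bias_variety_representation[OF S] h']) (simp add: Idp_def)
  have Typ: "(\<forall>x \<in> carrier (Typ S). monoid_index (Typ S) x \<noteq> \<infinity>) \<and>
      is_archimedean_dimension_group_cone (Typ S)"
    if S: "S \<in> bias_variety E" for S :: "'a semigroup0"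
  proof -
    interpret finite_index_refinement_monoid "Typ S"
      by (rule rel_representation.finite_index_refinement_monoid_Typ[OF
            bias_variety_representation[OF S] h'])
    show ?thesis
      using finite_index is_archimedean_dimension_group_cone by (simp add: monoid_index_def)
  qed
  show ?thesis
  proof (intro conjI allI ballI impI)
    show "\<exists>h. symmetric_inverse h \<in> bias_variety E
          \<and> (\<forall>m. symmetric_inverse m \<in> bias_variety E \<longrightarrow> m \<le> h)
          \<and> (\<forall>S \<in> (bias_variety E :: 'a semigroup0 set).
               \<forall>e \<in> Idp S. monoid_index (Typ S) (typ_elem S e) \<le> enat h)
          \<and> (\<exists>S \<in> (bias_variety E :: (nat \<rightharpoonup> nat) semigroup0 set).
               \<exists>e \<in> Idp S. monoid_index (Typ S) (typ_elem S e) = enat h)"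
    proof (intro exI[of _ h] conjI allI ballI impI)
      show "\<exists>S \<in> (bias_variety E :: (nat \<rightharpoonup> nat) semigroup0 set).
               \<exists>e \<in> Idp S. monoid_index (Typ S) (typ_elem S e) = enat h"
        using monoid_index_symmetric_inverse[OF h h'] h by blast
    qed (use h max index in blast)+
    show "monoid_index (Typ S) x \<noteq> \<infinity>" if "S \<in> bias_variety E" "x \<in> carrier (Typ S)"
      for S :: "'a semigroup0" and x using Typ that by blast
    show "is_archimedean_dimension_group_cone (Typ S)" if "S \<in> bias_variety E" for S :: "'a semigroup0"
      using Typ that by blast
    show "(bias_variety E :: 'a semigroup0 set) \<subseteq> bias_variety F"
      if "{T \<in> (bias_variety E :: nat semigroup0 set). fully_group_matricial T} \<subseteq> bias_variety F" for F
      by (rule variety_generated_by_fully_group_matricial[OF h' that])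
  qed
qed

end
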